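(* Let $\lambda\in\mathbb{C}$, $\lambda\notin\mathbb{Z}_{\ge 0}\cup\{-\tfrac12\}$, and let the superalgebra $\mathfrak{B}_\lambda$, its elements $F,G,H,\tau$, the form $\langle\cdot,\cdot\rangle$, the forms $\langle\cdot,\cdot\rangle_{\pm j}$ on $\mathbb{C}[H,\tau]$, the operators $\Delta,\nabla,\Delta_2,\nabla_2$ and the polynomials $f_{k,j}$ be as defined in the context. Then: 1) $\langle(\mathfrak{B}_\lambda)_{i},(\mathfrak{B}_\lambda)_{j}\rangle=0$ for $i\ne j$. 2) The polynomials $f_{k,j}(H)$ are orthogonal relative to the form $\langle\cdot,\cdot\rangle_{j}$; the polynomial $f_{k,j}(H)$ is a degree $k$ polynomial in $H$ and $\tau$. 3) The polynomial $f=f_{k,2i}(H)$ satisfies the difference equation $$\left(H-\tau+\tfrac12\right)\Delta\nabla f+2(H-i)\nabla f+\left(2i+\tfrac12\right)f=(-1)^{p(k)}\left(2i+k+\tfrac12\right)f.$$ 4) The polynomial $f=f_{k,2i+1}(H)$ satisfies the difference equation $$\left(H-\tau+\tfrac12\right)\Delta\nabla f+2\left(H-\tau-i+\tfrac12\right)\nabla f+\left(2i+\tfrac52\right)f=(-1)^{p(k)}\left(2i+k+\tfrac52\right)f.$$ 5) The polynomials $f_{k,j}(-H)$ are orthogonal relative to the form $\langle\cdot,\cdot\rangle_{-j}$; $f_{k,j}(-H)$ is a degree $k$ polynomial in $H$ and $\tau$. 6) The polynomial $f=f_{k,2i}(-H)$ satisfies the difference equation $$\left[(H+1)^2-\left(\tau+\tfrac12\right)^2\right]\Delta_2\nabla_2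 f+4(i+1)(H-i)\nabla_2 f+4i(i+1)f=\begin{cases}(2i+k)(2i+k+2)f & \text{for } k\text{ even},\\ (2i+k-1)(2i+k+1)f & \text{for } k\text{ odd}.\end{cases}$$ 7) The polynomial $f=f_{k,2i+1}(-H)$ satisfies the difference equation $$\left[(H+1)^2-\left(\tau+\tfrac12\right)^2\right]\Delta_2\nabla_2 f+\left[(2i+3)(2H-2i-1)-2\tau\right]\nabla_2 f+(2i+1)(2i+5)f=\begin{cases}(2i+k+1)(2i+k+3)f & \text{for } k\text{ even},\\ (2i+k)(2i+k+2)f & \text{for } k\text{ odd}.\end{cases}$$ 8) The polynomials $f_{k,2i}(H)$ can be expressed via Hahn polynomials with parameter $\tau$, namely $$f_{2k,2i}(H)=(-1)^k\frac{(i+1)_k\left(i+\tfrac12-\tau\right)_k}{k!}\;{}_3F_2\!\left(\begin{array}{c}-k,\ k+2i+1,\ \tfrac12\left(2i+\tfrac12-\tau-H\right)\\ i+1,\ i+\tfrac12-\tau\end{array}\Big|\,1\right),$$ $$f_{2k+1,2i}(H)=\tfrac12\left[(2k+2i+1)\tau-\left(\lambda+\tfrac12\right)^2\right]f_{2k,2i}(H).$$ 9) The polynomials $f_{k,2i+1}(H)$ can be expressed via Hahn polynomials with parameter $\tau$, namely $$f_{2k,2i+1}(H)=(-1)^k\frac{(i+2)_k\left(i+\tfrac32-\tau\right)_k}{k!}\;{}_3F_2\!\left(\begin{array}{c}-k,\ k+2i+2,\ \tfrac12\left(2i+\tfrac52-\tau-H\right)\\ i+2,\ i+\tfrac32-\tau\end{array}\Big|\,1\right),$$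 $$f_{2k+1,2i+1}(H)=-\frac{\tau}{2i+k+2}\,f_{2k,2i+1}(H).$$
   Context: Superalgebras are over $\mathbb{C}$; $p(\cdot)$ denotes parity (for an integer $k$, $p(k)$ is the parity of $k$); $[a,b]=ab-(-1)^{p(a)p(b)}ba$ is the supercommutator, and $(\mathrm{ad}\,a)(b)=[a,b]$. $\mathfrak{B}_\lambda$ is the quotient of $U(\mathfrak{osp}(1|2))$ by the maximal two-sided ideal $\mathfrak m_\lambda$ generated by $\tau^2-(\lambda+\frac12)^2$; it is the associative superalgebra generated by odd $F,G$ and even $H$ subject to $[H,G]=G$, $[H,F]=-F$, $[G,F]=H$, $\tau^2=(\lambda+\tfrac12)^2$, where $\tau=H+\tfrac12-2FG$. It is $\mathbb{Z}$-graded with $(\mathfrak{B}_\lambda)_i=\{u\in\mathfrak{B}_\lambda: [H,u]=iu\}$ for $i\in\mathbb{Z}$; $(\mathfrak{B}_\lambda)_0=\mathbb{C}[H,\tau]$, and for $j\ge 0$, $(\mathfrak{B}_\lambda)_j=\mathbb{C}[H,\tau]G^j$ and $(\mathfrak{B}_\lambda)_{-j}=\mathbb{C}[H,\tau]F^j$. On $\mathbb{C}[H,\tau]$ (with $\tau^2=(\lambda+\frac12)^2$) degrees are given by $\deg H=2$, $\deg\tau=1$. The antiautomorphism $u\mapsto u^t$ is the even linear map with $(uv)^t=(-1)^{p(u)p(v)}v^tu^t$, $H^t=H$, $F^t=G$, $G^t=-F$. Let $L$ (the supertrace) be the nontrivial linear functional on $\mathfrak{B}_\lambda$ vanishing on all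 supercommutators (it is unique up to a scalar factor), and put $\langle u,v\rangle=L(uv^t)$. For $f,g\in\mathbb{C}[H,\tau]$ and $j\ge0$: $\langle f,g\rangle_j=\langle fG^j,gG^j\rangle$, $\langle f,g\rangle_{-j}=\langle fF^j,gF^j\rangle$. A basis $\{f_k\}_{k\ge0}$ of $\mathbb{C}[H,\tau]$ such that $\deg f_k=k$ and $f_k$ is orthogonal to every $f$ with $\deg f<k$ is called a system of orthogonal polynomials in $H$ and $\tau$. Operators on $f=f(H,\tau)\in\mathbb{C}[H,\tau]$: $\Delta f=f(H+1,-\tau)-f(H,\tau)$ and $\nabla f=f(H,\tau)-f(H-1,-\tau)$ (so $\Delta H=\nabla H=1$, $\Delta\tau=-2\tau$, $\nabla\tau=2\tau$); $\Delta_2f=f(H+2,\tau)-f(H,\tau)$ and $\nabla_2f=f(H,\tau)-f(H-2,\tau)$ (so $\Delta_2\tau=\nabla_2\tau=0$). The polynomials $f_{k,j}\in\mathbb{C}[H,\tau]$ are defined, for $i,k\ge0$, by $f_{k,2i}G^{2i}=(\mathrm{ad}\,F)^k(G^{2i+k})$ for $k$ even, $f_{k,2i}G^{2i}=(\mathrm{ad}\,F)^k(G^{2i+k}\tau)$ for $k$ odd; $f_{k,2i+1}G^{2i+1}=(\mathrm{ad}\,F)^{k+1}(G^{2i+k+2})$ for $k$ even, $f_{k,2i+1}G^{2i+1}=(\mathrm{ad}\,F)^{k+1}(G^{2i+k}\tau)$ for $k$ odd. One writes $f_{k,j}(H)$ for $f_{k,j}$, suppressing $\tau$; $f_{k,j}(-H)$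 is obtained by $H\mapsto-H$, $\tau\mapsto\tau$. $(a)_0=1$, $(a)_s=a(a+1)\cdots(a+s-1)$ for $s>0$, and ${}_3F_2\!\left(\begin{array}{c}a_1,a_2,a_3\\ b_1,b_2\end{array}\Big|z\right)=\sum_{s=0}^{\infty}\frac{(a_1)_s(a_2)_s(a_3)_s}{(b_1)_s(b_2)_s}\frac{z^s}{s!}$.
   Formalization: Corrected: f_{k,2i+1}, k odd, is (ad F)^{k-1}(G^{2i+k}τ); 4) -1/2 for +1/2 and, k odd, eigenvalue -(2i+k+1/2); 6),7) printed form is for f(H), reflected for f(-H); 7) 2i+3 for 2i+5; 8),9) prefactors 1, i+k+1 for (-1)^k/k!; 8) 2(λ+1/2)^2; 9) -τ/(i+k+1). *)

theory Defs
  imports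
    Complex_Main
    "HOL-Library.Poly_Mapping"
    "HOL-Computational_Algebra.Polynomial"
    "HOL-Computational_Algebra.Fraction_Field"
    "HOL-Algebra.QuotRing"
begin

section \<open>The free superalgebra on \<open>F\<close>, \<open>G\<close> (odd) and \<open>H\<close> (even)\<close>

datatype letter = LF | LG | LH

datatype word = Word (letters: "letter list")

instantiation word :: monoid_add
begin

definition zero_word :: word where "zero_word = Word []"

definition plus_word :: "word \<Rightarrow> word \<Rightarrow> word" where
  "plus_word v w = Word (letters v @ letters w)"

instance
  by standard (simp_all add: zero_word_def plus_word_def)

end

text \<open>The monoid algebra of the monoid of words (concatenation being written additively), with
  the convolution product of \<^theory>\<open>HOL-Library.Poly_Mapping\<close>: this is the free associative
  unital algebra.\<close>

type_synonym free = "word \<Rightarrow>\<^sub>0 complex"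

definition smul :: "complex \<Rightarrow> free \<Rightarrow> free" where
  "smul c u = Poly_Mapping.single 0 c * u"

definition word_elt :: "word \<Rightarrow> free" where
  "word_elt w = Poly_Mapping.single w 1"

definition gF :: free where "gF = word_elt (Word [LF])"
definition gG :: free where "gG = word_elt (Word [LG])"
definition gH :: free where "gH = word_elt (Word [LH])"

definition gtau :: free where
  "gtau = gH + smul (1/2) 1 - smul 2 (gF * gG)"

definition lin_ext :: "(word \<Rightarrow> free) \<Rightarrow> free \<Rightarrow> free" where
  "lin_ext \<phi> u = (\<Sum>w\<in>Poly_Mapping.keys u. smul (Poly_Mapping.lookup u w) (\<phi> w))"

definition odd_word :: "word \<Rightarrow> bool" where
  "odd_word w \<longleftrightarrow> odd (length (filter (\<lambda>x. x \<noteq> LH) (letters w)))"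

text \<open>\<open>koszul a b\<close> is the sign \<open>(-1)\<^bsup>p(a)p(b)\<^esup>\<close>.\<close>

definition koszul :: "word \<Rightarrow> word \<Rightarrow> complex" where
  "koszul a b = (if odd_word a \<and> odd_word b then -1 else 1)"

definition scomm :: "free \<Rightarrow> free \<Rightarrow> free" where
  "scomm u v =
     lin_ext (\<lambda>a. lin_ext (\<lambda>b. word_elt a * word_elt b - smul (koszul a b) (word_elt b * word_elt a)) v) u"

fun transp_letter :: "letter \<Rightarrow> free" where
  "transp_letter LF = gG"
| "transp_letter LG = - gF"
| "transp_letter LH = gH"

fun transp_letters :: "letter list \<Rightarrow> free" where
  "transp_letters [] = 1"
| "transp_letters (x # xs) =
     smul (koszul (Word [x]) (Word xs)) (transp_letters xs * transp_letter x)"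

text \<open>The even linear map with \<open>(uv)\<^sup>t = (-1)\<^bsup>p(u)p(v)\<^esup> v\<^sup>t u\<^sup>t\<close> that extends
  \<open>H \<mapsto> H\<close>, \<open>F \<mapsto> G\<close>, \<open>G \<mapsto> -F\<close>. It preserves the ideal \<open>ideal_B\<close> below, hence it induces the
  antiautomorphism of the quotient; likewise \<open>scomm\<close> induces the supercommutator of the quotient,
  the ideal being generated by homogeneous elements.\<close>

definition stransp :: "free \<Rightarrow> free" where
  "stransp u = lin_ext (\<lambda>w. transp_letters (letters w)) u"


section \<open>The superalgebra \<open>B\<^sub>\<lambda>\<close>\<close>

definition free_ring :: "free ring" where
  "free_ring = \<lparr>carrier = UNIV, mult = (*), one = 1, zero = 0, add = (+)\<rparr>"

definition relators :: "complex \<Rightarrow> free set" where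
  "relators lam = {scomm gH gG - gG, scomm gH gF + gF, scomm gG gF - gH,
                  gtau ^ 2 - smul ((lam + 1/2) ^ 2) 1}"

definition ideal_B :: "complex \<Rightarrow> free set" where
  "ideal_B lam = Idl\<^bsub>free_ring\<^esub> (relators lam)"

definition B_alg :: "complex \<Rightarrow> free set ring" where
  "B_alg lam = free_ring Quot (ideal_B lam)"

definition cls :: "complex \<Rightarrow> free \<Rightarrow> free set" where
  "cls lam u = ideal_B lam +>\<^bsub>free_ring\<^esub> u"

text \<open>Every element of \<open>carrier (B_alg lam)\<close> is of the form \<open>cls lam u\<close>. Below, elements of \<open>B_alg lam\<close> are
  given by representatives \<open>u\<close> in the free algebra.\<close>

definition graded_part :: "complex \<Rightarrow> int \<Rightarrow> free set" where
  "graded_part lam i = {u. cls lam (scomm gH u) = cls lam (smul (of_int i) u)}"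

definition supertrace :: "complex \<Rightarrow> (free set \<Rightarrow> complex) \<Rightarrow> bool" where
  "supertrace lam L \<longleftrightarrow>
     (\<forall>u v. L (cls lam (u + v)) = L (cls lam u) + L (cls lam v)) \<and>
     (\<forall>c u. L (cls lam (smul c u)) = c * L (cls lam u)) \<and>
     (\<forall>u v. L (cls lam (scomm u v)) = 0) \<and>
     (\<exists>u. L (cls lam u) \<noteq> 0)"

definition form :: "complex \<Rightarrow> (free set \<Rightarrow> complex) \<Rightarrow> free \<Rightarrow> free \<Rightarrow> complex" where
  "form lam L u v = L (cls lam (u * stransp v))"


section \<open>Polynomials in \<open>H\<close> and \<open>\<tau>\<close>\<close>

text \<open>A bivariate polynomial \<open>P(H, \<tau>)\<close> is a polynomial in the outer variable \<open>\<tau>\<close> whose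
  coefficients are polynomials in \<open>H\<close>.\<close>

type_synonym bipoly = "complex poly poly"

definition cst :: "complex \<Rightarrow> bipoly" where "cst c = [:[:c:]:]"
definition vH :: bipoly where "vH = [:[:0, 1:]:]"
definition vtau :: bipoly where "vtau = [:0, 1:]"

definition in_free :: "bipoly \<Rightarrow> free" where
  "in_free P = (\<Sum>b\<le>degree P. \<Sum>a\<le>degree (coeff P b).
                  smul (coeff (coeff P b) a) (gH ^ a * gtau ^ b))"

definition ev :: "complex \<Rightarrow> bipoly \<Rightarrow> free set" where
  "ev lam P = cls lam (in_free P)"

text \<open>As \<open>\<tau>\<^sup>2\<close> is a scalar, each element of the subalgebra \<open>\<complex>[H,\<tau>]\<close> of \<open>B_alg lam\<close> is \<open>ev lam P\<close> for
  exactly one \<open>P = p(H) + q(H) \<tau>\<close>. These \<open>P\<close> are used as the elements of \<open>\<complex>[H,\<tau>]\<close>. Products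
  are taken among all bivariate polynomials, and compared in \<open>B_alg lam\<close> by means of \<open>ev lam\<close>.\<close>

definition CHtau :: "bipoly set" where
  "CHtau = {P. degree P \<le> 1}"

text \<open>\<open>deg H = 2\<close> and \<open>deg \<tau> = 1\<close>; the degree of \<open>0\<close> is set to \<open>0\<close>.\<close>

definition wdeg :: "bipoly \<Rightarrow> nat" where
  "wdeg P = Max (insert 0 {2 * a + b |a b. coeff (coeff P b) a \<noteq> 0})"

text \<open>\<open>subst_lin \<alpha> \<beta> \<sigma> P\<close> is \<open>P(\<alpha> H + \<beta>, \<sigma> \<tau>)\<close>.\<close>

definition subst_lin :: "complex \<Rightarrow> complex \<Rightarrow> complex \<Rightarrow> bipoly \<Rightarrow> bipoly" where
  "subst_lin \<alpha> \<beta> \<sigma> P = pcompose (map_poly (\<lambda>p. pcompose p [:\<beta>, \<alpha>:]) P) [:0, [:\<sigma>:]:]"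

definition fwd :: "bipoly \<Rightarrow> bipoly" where "fwd P = subst_lin 1 1 (-1) P - P"
definition bwd :: "bipoly \<Rightarrow> bipoly" where "bwd P = P - subst_lin 1 (-1) (-1) P"
definition fwd2 :: "bipoly \<Rightarrow> bipoly" where "fwd2 P = subst_lin 1 2 1 P - P"
definition bwd2 :: "bipoly \<Rightarrow> bipoly" where "bwd2 P = P - subst_lin 1 (-2) 1 P"

definition reflect_H :: "bipoly \<Rightarrow> bipoly" where "reflect_H P = subst_lin (-1) 0 1 P"

definition form_pos :: "complex \<Rightarrow> (free set \<Rightarrow> complex) \<Rightarrow> nat \<Rightarrow> bipoly \<Rightarrow> bipoly \<Rightarrow> complex" where
  "form_pos lam L j P Q = form lam L (in_free P * gG ^ j) (in_free Q * gG ^ j)"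

definition form_neg :: "complex \<Rightarrow> (free set \<Rightarrow> complex) \<Rightarrow> nat \<Rightarrow> bipoly \<Rightarrow> bipoly \<Rightarrow> complex" where
  "form_neg lam L j P Q = form lam L (in_free P * gF ^ j) (in_free Q * gF ^ j)"

definition basis_CHtau :: "(nat \<Rightarrow> bipoly) \<Rightarrow> bool" where
  "basis_CHtau f \<longleftrightarrow> (\<forall>k. f k \<in> CHtau) \<and>
     (\<forall>P\<in>CHtau. \<exists>!c :: nat \<Rightarrow> complex. finite {k. c k \<noteq> 0} \<and> P = (\<Sum>k | c k \<noteq> 0. cst (c k) * f k))"

definition orthogonal_polynomials ::
    "(bipoly \<Rightarrow> bipoly \<Rightarrow> complex) \<Rightarrow> (nat \<Rightarrow> bipoly) \<Rightarrow> bool" where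
  "orthogonal_polynomials frm f \<longleftrightarrow>
     basis_CHtau f \<and> (\<forall>k. wdeg (f k) = k) \<and>
     (\<forall>k. \<forall>P\<in>CHtau. wdeg P < k \<longrightarrow> frm (f k) P = 0 \<and> frm P (f k) = 0)"


section \<open>The polynomials \<open>f\<^bsub>k,j\<^esub>\<close>\<close>

text \<open>For \<open>j = 2 i + 1\<close> and odd \<open>k\<close> the element is \<open>(ad F)\<^bsup>k-1\<^esup>(G\<^bsup>2i+k\<^esup> \<tau>)\<close>. (With \<open>k + 1\<close> in place
  of \<open>k - 1\<close>, as is sometimes printed, it would have weight \<open>2 i - 1\<close> and not be of the form
  \<open>f G\<^bsup>2i+1\<^esup>\<close>.)\<close>

definition ad_F_element :: "nat \<Rightarrow> nat \<Rightarrow> free" where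
  "ad_F_element k j = (let i = j div 2 in
     if even j then
       (if even k then (scomm gF ^^ k) (gG ^ (2 * i + k))
        else (scomm gF ^^ k) (gG ^ (2 * i + k) * gtau))
     else
       (if even k then (scomm gF ^^ (k + 1)) (gG ^ (2 * i + k + 2))
        else (scomm gF ^^ (k - 1)) (gG ^ (2 * i + k) * gtau)))"

definition fpoly :: "complex \<Rightarrow> nat \<Rightarrow> nat \<Rightarrow> bipoly" where
  "fpoly lam k j =
     (THE P. P \<in> CHtau \<and> cls lam (in_free P * gG ^ j) = cls lam (ad_F_element k j))"


section \<open>Hypergeometric series\<close>

text \<open>Only meant for terminating series, i.e. when finitely many terms are nonzero.\<close>

definition hyp3F2 :: "'a::field \<Rightarrow> 'a \<Rightarrow> 'a \<Rightarrow> 'a \<Rightarrow> 'a \<Rightarrow> 'a \<Rightarrow> 'a" where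
  "hyp3F2 a1 a2 a3 b1 b2 z =
     (let term = (\<lambda>s. pochhammer a1 s * pochhammer a2 s * pochhammer a3 s
                        / (pochhammer b1 s * pochhammer b2 s) * z ^ s / of_nat (fact s))
      in \<Sum>s | term s \<noteq> 0. term s)"

text \<open>The quotients by \<open>(b - \<tau>)\<^sub>s\<close> in the Hahn polynomials are formed in the field \<open>\<complex>(H,\<tau>)\<close> of
  rational functions in two indeterminates, and the relation \<open>\<tau>\<^sup>2 = (lam + 1/2)\<^sup>2\<close> is imposed only
  once the denominators have cancelled: \<open>b - \<tau>\<close> may be a zero divisor in \<open>\<complex>[H,\<tau>]\<close>.\<close>

type_synonym ratfun = "bipoly fract"

definition ratf :: "bipoly \<Rightarrow> ratfun" where "ratf P = Fract P 1"

abbreviation rc :: "complex \<Rightarrow> ratfun" where "rc c \<equiv> ratf (cst c)"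

definition equals_ratfun :: "complex \<Rightarrow> bipoly \<Rightarrow> ratfun \<Rightarrow> bool" where
  "equals_ratfun lam f R \<longleftrightarrow> (\<exists>P. ratf P = R \<and> ev lam f = ev lam P)"

end

theory Submission
  imports Defs
begin

text \<open>
  Moving \<open>F\<close> or \<open>G\<close> past a polynomial in \<open>H\<close> and \<open>\<tau>\<close> shifts \<open>H\<close> by \<open>\<plusminus>1\<close> and changes the sign of
  \<open>\<tau>\<close>. Hence, once \<open>P G\<^sup>j\<close> is identified with the function \<open>(h, t) \<mapsto> P(h, t)\<close>, the maps \<open>ad F\<close> and
  \<open>ad G\<close> become explicit difference operators \<open>lower_fun\<close> and \<open>raise_fun\<close>. As \<open>\<tau>\<^sup>2 = (\<lambda> + 1/2)\<^sup>2\<close> and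
  \<open>\<lambda> \<noteq> -1/2\<close>, an element of \<open>\<complex>[H,\<tau>]\<close> is determined by its values at the two distinct points
  \<open>t = \<plusminus>(\<lambda> + 1/2)\<close> (\<open>ev_eqI\<close>); a representation by difference operators shows that the algebra does
  not collapse (\<open>in_free_G_power_inj\<close>), so that the polynomials \<open>f\<^bsub>k,j\<^esub>\<close> are well defined and their
  values are iterates of \<open>lower_fun\<close> (\<open>fpoly_props\<close>). All the identities between polynomials are then
  identities between functions of two complex variables.

  Difference equations. The vectors \<open>G\<^sup>n\<close> (\<open>n\<close> even) and \<open>G\<^sup>n\<tau>\<close> (\<open>n\<close> odd) are killed by \<open>ad G\<close>,
  and \<open>f\<^bsub>k,j\<^esub> G\<^sup>j\<close> is the image of one of them under a power of \<open>ad F\<close>. Since \<open>[ad G, ad F] = ad H\<close>,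
  it is an eigenvector of \<open>(ad F)(ad G)\<close> (\<open>lower_raise_lowers_fun\<close>); written out, this is the equation
  in \<open>\<Delta>\<close> and \<open>\<nabla>\<close>. The same argument for the \<open>sl(2)\<close> spanned by \<open>F\<^sup>2\<close>, \<open>G\<^sup>2\<close> and \<open>H\<close> gives the equation
  in \<open>\<Delta>\<^sub>2\<close> and \<open>\<nabla>\<^sub>2\<close> (\<open>lower2_raise2_hahn_fun\<close>).

  Hahn polynomials. Up to a factor that depends on \<open>\<tau>\<close> only, \<open>f\<^bsub>k,j\<^esub> G\<^sup>j\<close> is \<open>(ad F\<^sup>2)\<^sup>r(G\<^bsup>j+2r\<^esup>)\<close> with
  \<open>r = k div 2\<close> (\<open>lowers_fun_top_fun\<close>). In a suitable variable \<open>A\<close> the operator \<open>ad F\<^sup>2\<close> maps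
  \<open>(A + 1)\<^sub>s\<close> to a combination of \<open>(A)\<^sub>s\<close> and \<open>(A)\<^bsub>s+1\<^esub>\<close> (\<open>lower2_fun_pochhammer\<close>), and the resulting
  two-term recursion is solved by the coefficients of a terminating \<open>\<^sub>3F\<^sub>2\<close> (\<open>hahn_fun_closed\<close>). The
  closed form also gives the degrees, because the leading coefficient in \<open>H\<close> is a non-zero
  constant that is independent of \<open>\<tau>\<close> (\<open>fpoly_coeffs\<close>).

  Orthogonality. A supertrace vanishes on supercommutators, so a power of \<open>ad F\<close> can be moved from
  one factor of a product to the other. On \<open>F\<^sup>j Q\<close> the operator \<open>(ad F)\<^sup>2\<close> acts as \<open>\<nabla>\<^sub>2\<close> on \<open>Q\<close> and lowers
  the degree by 2, hence it annihilates all \<open>Q\<close> of small degree. A single term survives, when \<open>j\<close> and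
  \<open>k\<close> are both odd; it is the trace of \<open>G\<^sup>n\<tau>F\<^sup>n\<close> with \<open>n\<close> odd, which vanishes because \<open>F\<^sup>n\<close> is a multiple
  of \<open>[G, F\<^bsup>n+1\<^esup>]\<close> whereas \<open>[G, G\<^sup>n\<tau>] = 0\<close>. The automorphism \<open>F \<mapsto> G\<close>, \<open>G \<mapsto> -F\<close>, \<open>H \<mapsto> -H\<close>
  fixes \<open>\<tau>\<close> and transports the result to the forms with negative index.
\<close>

section \<open>Linear and multiplicative maps on the free algebra\<close>

lemma smul_add_right: "smul c (u + v) = smul c u + smul c v"
  by (simp add: smul_def algebra_simps)

lemma smul_add_left: "smul (c + d) u = smul c u + smul d u"
  by (simp add: smul_def single_add algebra_simps)

lemma smul_zero_left [simp]: "smul 0 u = 0"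
  by (simp add: smul_def)

lemma smul_zero_right [simp]: "smul c 0 = 0"
  by (simp add: smul_def)

lemma smul_one [simp]: "smul 1 u = u"
  by (simp add: smul_def)

lemma smul_smul [simp]: "smul c (smul d u) = smul (c * d) u"
  by (simp add: smul_def mult_single flip: mult.assoc)

lemma smul_minus_right: "smul c (- u) = - smul c u"
  by (simp add: smul_def)

lemma smul_minus_left: "smul (- c) u = - smul c u"
  by (simp add: smul_def single_uminus)

lemma smul_diff_right: "smul c (u - v) = smul c u - smul c v"
  by (simp add: smul_def algebra_simps)

lemma smul_diff_left: "smul (c - d) u = smul c u - smul d u"
  by (simp add: smul_def single_diff algebra_simps)

lemma mult_smul_left [simp]: "smul c u * v = smul c (u * v)"
  by (simp add: smul_def mult.assoc)

lemma smul_word_elt: "smul c (word_elt w) = Poly_Mapping.single w c"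
  by (simp add: smul_def word_elt_def mult_single)

lemma free_eq_sum: "u = (\<Sum>w\<in>Poly_Mapping.keys u. smul (Poly_Mapping.lookup u w) (word_elt w))"
  by (rule poly_mapping_eqI)
    (simp add: smul_word_elt lookup_sum lookup_single when_def in_keys_iff)

lemma free_induct [case_names monom add]:
  assumes "\<And>c w. P (smul c (word_elt w))" and "\<And>u v. P u \<Longrightarrow> P v \<Longrightarrow> P (u + v)"
  shows "P u"
proof -
  have "P (\<Sum>w\<in>A. smul (Poly_Mapping.lookup u w) (word_elt w))" if "finite A" for A
    using that
  proof (induction A rule: finite_induct)
    case empty
    show ?case using assms(1)[of 0] by simp
  next
    case (insert x F)
    then show ?case using assms by simp
  qed
  from this[OF finite_keys[of u]] show ?thesis using free_eq_sum[of u] by simp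
qed

lemma mult_smul_right [simp]: "v * smul c u = smul c (v * u)"
proof (induction v rule: free_induct)
  case (monom d w)
  show ?case
  proof (induction u rule: free_induct)
    case (monom d w)
    then show ?case
      by (simp only: smul_smul smul_word_elt mult_single) (simp add: smul_def mult_single mult_ac)
  next
    case (add u v)
    then show ?case by (simp add: smul_add_right distrib_left)
  qed
next
  case (add u v)
  then show ?case by (simp add: smul_add_right distrib_right)
qed

lemma word_elt_mult [simp]: "word_elt v * word_elt w = word_elt (v + w)"
  by (simp add: word_elt_def mult_single)

lemma word_elt_0 [simp]: "word_elt 0 = 1"
  by (simp add: word_elt_def)

text \<open>Stated for an arbitrary scaling \<open>sc\<close>, so that it serves both for linear maps into the free
  algebra and, evaluated at a point, for the representation on functions.\<close>

lemma sum_keys_add: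
  fixes sc :: "complex \<Rightarrow> 'a::comm_monoid_add \<Rightarrow> 'a" and u v :: free
  assumes "\<And>x. sc 0 x = 0" and "\<And>a b x. sc (a + b) x = sc a x + sc b x"
  shows "(\<Sum>w\<in>Poly_Mapping.keys (u + v). sc (Poly_Mapping.lookup (u + v) w) (\<phi> w)) =
     (\<Sum>w\<in>Poly_Mapping.keys u. sc (Poly_Mapping.lookup u w) (\<phi> w)) +
     (\<Sum>w\<in>Poly_Mapping.keys v. sc (Poly_Mapping.lookup v w) (\<phi> w))"
proof -
  define A where "A = Poly_Mapping.keys u \<union> Poly_Mapping.keys v"
  have *: "(\<Sum>w\<in>Poly_Mapping.keys x. sc (Poly_Mapping.lookup x w) (\<phi> w)) =
      (\<Sum>w\<in>A. sc (Poly_Mapping.lookup x w) (\<phi> w))" if "Poly_Mapping.keys x \<subseteq> A" for x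
    by (rule sum.mono_neutral_left) (use that assms(1) in \<open>auto simp: A_def in_keys_iff\<close>)
  have "Poly_Mapping.keys (u + v) \<subseteq> A"
    unfolding A_def by (rule Poly_Mapping.keys_add)
  then show ?thesis
    by (subst (1 2 3) *) (auto simp: A_def lookup_add assms(2) sum.distrib)
qed

lemma lin_ext_add [simp]: "lin_ext \<phi> (u + v) = lin_ext \<phi> u + lin_ext \<phi> v"
  unfolding lin_ext_def by (rule sum_keys_add) (simp_all add: smul_add_left)

lemma lin_ext_monom: "lin_ext \<phi> (smul c (word_elt w)) = smul c (\<phi> w)"
  by (cases "c = 0") (simp_all add: lin_ext_def smul_word_elt lookup_single)

lemma lin_ext_word [simp]: "lin_ext \<phi> (word_elt w) = \<phi> w"
  using lin_ext_monom[of \<phi> 1] by simp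

lemma lin_ext_smul [simp]: "lin_ext \<phi> (smul c u) = smul c (lin_ext \<phi> u)"
  by (induction u rule: free_induct) (simp_all add: lin_ext_monom smul_add_right)

lemma lin_ext_zero [simp]: "lin_ext \<phi> 0 = 0"
  by (simp add: lin_ext_def)

lemma lin_ext_uminus [simp]: "lin_ext \<phi> (- u) = - lin_ext \<phi> u"
  using lin_ext_smul[of \<phi> "-1" u] by (simp add: smul_minus_left)

lemma lin_ext_diff [simp]: "lin_ext \<phi> (u - v) = lin_ext \<phi> u - lin_ext \<phi> v"
  using lin_ext_add[of \<phi> u "-v"] by simp

lemma lin_ext_mult:
  assumes "\<And>v w. \<phi> (v + w) = \<phi> v * \<phi> w"
  shows "lin_ext \<phi> (u * v) = lin_ext \<phi> u * lin_ext \<phi> v"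
proof (induction u rule: free_induct)
  case (monom c w)
  show ?case
    by (induction v rule: free_induct) (simp_all add: lin_ext_monom assms distrib_left smul_add_right)
next
  case (add u u')
  then show ?case by (simp add: distrib_right)
qed

section \<open>Parity\<close>

text \<open>With the grading automorphism, supercommutators with a generator need no case distinction on
  the parity of the second argument: \<open>[F, u] = F u - parity(u) F\<close> for all \<open>u\<close>.\<close>

definition parity :: "free \<Rightarrow> free" where
  "parity = lin_ext (\<lambda>w. smul (if odd_word w then -1 else 1) (word_elt w))"

lemma odd_word_0 [simp]: "\<not> odd_word 0"
  by (simp add: odd_word_def zero_word_def)

lemma odd_word_add [simp]: "odd_word (v + w) \<longleftrightarrow> odd_word v \<noteq> odd_word w"
  by (auto simp: odd_word_def plus_word_def)

lemma parity_add [simp]: "parity (u + v) = parity u + parity v"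
  and parity_diff [simp]: "parity (u - v) = parity u - parity v"
  and parity_uminus [simp]: "parity (- u) = - parity u"
  and parity_smul [simp]: "parity (smul c u) = smul c (parity u)"
  and parity_zero [simp]: "parity 0 = 0"
  by (simp_all add: parity_def)

lemma parity_word: "parity (word_elt w) = smul (if odd_word w then -1 else 1) (word_elt w)"
  by (simp add: parity_def)

lemma parity_mult [simp]: "parity (u * v) = parity u * parity v"
  unfolding parity_def by (rule lin_ext_mult) simp

lemma parity_parity [simp]: "parity (parity u) = u"
  by (induction u rule: free_induct) (simp_all add: parity_word)

lemma parity_one [simp]: "parity 1 = 1"
  using parity_word[of 0] by simp

lemma parity_power [simp]: "parity (u ^ n) = parity u ^ n"
  by (induction n) simp_all

lemma parity_gens [simp]: "parity gF = - gF" "parity gG = - gG" "parity gH = gH" "parity gtau = gtau"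
proof -
  show *: "parity gF = - gF" "parity gG = - gG" "parity gH = gH"
    by (simp_all add: gF_def gG_def gH_def parity_word odd_word_def smul_minus_left)
  show "parity gtau = gtau"
    by (simp add: gtau_def *)
qed

lemma scomm_add_right [simp]: "scomm u (v + w) = scomm u v + scomm u w"
  by (induction u rule: free_induct)
    (simp_all add: scomm_def lin_ext_monom smul_add_right)

lemma scomm_word:
  "scomm (word_elt a) u = word_elt a * u - (if odd_word a then parity u else u) * word_elt a"
proof (induction u rule: free_induct)
  case (monom c w)
  then show ?case
    by (simp add: scomm_def lin_ext_monom koszul_def smul_diff_right parity_word smul_minus_left)
next
  case (add u v)
  then show ?case by (cases "odd_word a") (simp_all add: algebra_simps)
qed

lemma scomm_gF: "scomm gF u = gF * u - parity u * gF"
  and scomm_gG: "scomm gG u = gG * u - parity u * gG"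
  and scomm_gH: "scomm gH u = gH * u - u * gH"
  by (simp_all add: gF_def gG_def gH_def scomm_word odd_word_def)

section \<open>The antiautomorphism\<close>

lemma koszul_Cons_append:
  "koszul (Word [x]) (Word (xs @ ys)) = koszul (Word [x]) (Word xs) * koszul (Word [x]) (Word ys)"
  by (auto simp: koszul_def odd_word_def)

lemma koszul_append_left:
  "koszul (Word (x # xs)) w = koszul (Word [x]) w * koszul (Word xs) w"
  by (auto simp: koszul_def odd_word_def)

lemma transp_letters_append:
  "transp_letters (xs @ ys) =
     smul (koszul (Word xs) (Word ys)) (transp_letters ys * transp_letters xs)"
proof (induction xs)
  case Nil
  then show ?case by (simp add: koszul_def odd_word_def)
next
  case (Cons x xs)
  then show ?case
    by (simp add: koszul_Cons_append koszul_append_left[of x xs] mult_ac)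
qed

lemma stransp_add [simp]: "stransp (u + v) = stransp u + stransp v"
  and stransp_diff [simp]: "stransp (u - v) = stransp u - stransp v"
  and stransp_uminus [simp]: "stransp (- u) = - stransp u"
  and stransp_smul [simp]: "stransp (smul c u) = smul c (stransp u)"
  and stransp_zero [simp]: "stransp 0 = 0"
  and stransp_word: "stransp (word_elt w) = transp_letters (letters w)"
  by (simp_all add: stransp_def)

lemma stransp_gens [simp]: "stransp gF = gG" "stransp gG = - gF" "stransp gH = gH"
  by (simp_all add: gF_def gG_def gH_def stransp_word koszul_def odd_word_def)

lemma stransp_one [simp]: "stransp 1 = 1"
  using stransp_word[of 0] by (simp only: word_elt_0) (simp add: zero_word_def)

text \<open>The Koszul sign \<open>(-1)\<^bsup>p(u)p(b)\<^esup>\<close> is absorbed into the grading automorphism, which makes the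
  antiautomorphism property linear in \<open>u\<close>.\<close>

lemma stransp_mult_word:
  "stransp (u * word_elt b) = stransp (word_elt b) * stransp (if odd_word b then parity u else u)"
proof (induction u rule: free_induct)
  case (monom c w)
  have "koszul (Word (letters w)) (Word (letters b)) = (if odd_word w \<and> odd_word b then -1 else 1)"
    by (simp add: koszul_def)
  then show ?case
    by (auto simp: stransp_word plus_word_def transp_letters_append parity_word)
next
  case (add u v)
  then show ?case by (simp add: algebra_simps split: if_splits)
qed

lemma stransp_word_mult:
  "stransp (word_elt b * u) = stransp (if odd_word b then parity u else u) * stransp (word_elt b)"
proof (induction u rule: free_induct)
  case (monom c w)
  have "koszul (Word (letters b)) (Word (letters w)) = (if odd_word w \<and> odd_word b then -1 else 1)"
    by (simp add: koszul_def)
  then show ?case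
    by (auto simp: stransp_word plus_word_def transp_letters_append parity_word)
next
  case (add u v)
  then show ?case by (simp add: algebra_simps split: if_splits)
qed

lemma stransp_mult_even:
  assumes "parity u = u"
  shows "stransp (u * v) = stransp v * stransp u"
proof (induction v rule: free_induct)
  case (monom c w)
  then show ?case by (simp add: stransp_mult_word assms)
next
  case (add v v')
  then show ?case by (simp add: algebra_simps)
qed

lemma stransp_mult_gens:
  "stransp (u * gF) = gG * stransp (parity u)"
  "stransp (u * gG) = - (gF * stransp (parity u))"
  "stransp (u * gH) = gH * stransp u"
  using stransp_mult_word[of u "Word [LF]"] stransp_mult_word[of u "Word [LG]"]
     stransp_mult_word[of u "Word [LH]"]
     stransp_gens
  by (simp_all add: gF_def gG_def gH_def odd_word_def)

lemma stransp_gtau [simp]: "stransp gtau = gtau"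
  by (simp add: gtau_def stransp_mult_gens)

text \<open>Only the existence of the sign matters, since orthogonality is insensitive to it.\<close>

lemma stransp_powers:
  "\<exists>e\<in>{1, -1}. stransp (gG ^ n) = smul e (gF ^ n)"
  "\<exists>e\<in>{1, -1}. stransp (gF ^ n) = smul e (gG ^ n)"
proof -
  have p: "parity (gG ^ n) = smul ((-1) ^ n) (gG ^ n)" "parity (gF ^ n) = smul ((-1) ^ n) (gF ^ n)" for n
    by (induction n) (simp_all add: smul_minus_left smul_minus_right)
  have s: "(-1 :: complex) ^ n = 1 \<or> (-1 :: complex) ^ n = -1" for n :: nat
    by (cases "even n") auto
  show "\<exists>e\<in>{1, -1}. stransp (gG ^ n) = smul e (gF ^ n)"
  proof (induction n)
    case (Suc n)
    then obtain e where e: "e = 1 \<or> e = -1" "stransp (gG ^ n) = smul e (gF ^ n)" by blast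
    have "stransp (gG ^ Suc n) = smul (- ((-1) ^ n * e)) (gF ^ Suc n)"
      unfolding power_Suc2[of gG] by (simp add: stransp_mult_gens p e(2) smul_minus_left del: parity_power)
    then show ?case using e(1) s[of n] by force
  qed (rule bexI[of _ 1], auto)
  show "\<exists>e\<in>{1, -1}. stransp (gF ^ n) = smul e (gG ^ n)"
  proof (induction n)
    case (Suc n)
    then obtain e where e: "e = 1 \<or> e = -1" "stransp (gF ^ n) = smul e (gG ^ n)" by blast
    have "stransp (gF ^ Suc n) = smul ((-1) ^ n * e) (gG ^ Suc n)"
      unfolding power_Suc2[of gF] by (simp add: stransp_mult_gens p e(2) del: parity_power)
    then show ?case using e(1) s[of n] by force
  qed (rule bexI[of _ 1], auto)
qed

section \<open>The automorphism exchanging \<open>F\<close> and \<open>G\<close>\<close>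

fun refl_letter :: "letter \<Rightarrow> free" where
  "refl_letter LF = gG"
| "refl_letter LG = - gF"
| "refl_letter LH = - gH"

text \<open>Modulo the ideal it maps \<open>P G\<^sup>j\<close> to \<open>\<plusminus>P(-H, \<tau>) F\<^sup>j\<close> and so
  exchanges the positive and the negative part of the grading.\<close>

definition refl_aut :: "free \<Rightarrow> free" where
  "refl_aut = lin_ext (\<lambda>w. prod_list (map refl_letter (letters w)))"

lemma refl_aut_add [simp]: "refl_aut (u + v) = refl_aut u + refl_aut v"
  and refl_aut_diff [simp]: "refl_aut (u - v) = refl_aut u - refl_aut v"
  and refl_aut_uminus [simp]: "refl_aut (- u) = - refl_aut u"
  and refl_aut_smul [simp]: "refl_aut (smul c u) = smul c (refl_aut u)"
  and refl_aut_zero [simp]: "refl_aut 0 = 0"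
  and refl_aut_word: "refl_aut (word_elt w) = prod_list (map refl_letter (letters w))"
  by (simp_all add: refl_aut_def)

lemma refl_aut_mult [simp]: "refl_aut (u * v) = refl_aut u * refl_aut v"
  unfolding refl_aut_def by (rule lin_ext_mult) (simp add: plus_word_def)

lemma refl_aut_gens [simp]: "refl_aut gF = gG" "refl_aut gG = - gF" "refl_aut gH = - gH"
  by (simp_all add: gF_def gG_def gH_def refl_aut_word)

lemma refl_aut_one [simp]: "refl_aut 1 = 1"
  using refl_aut_word[of 0] by (simp only: word_elt_0) (simp add: zero_word_def)

lemma refl_aut_power [simp]: "refl_aut (u ^ n) = refl_aut u ^ n"
  by (induction n) simp_all

lemma parity_refl_aut: "refl_aut (parity u) = parity (refl_aut u)"
proof (induction u rule: free_induct)
  case (monom c w)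
  have l: "parity (refl_letter x) = smul (if x \<noteq> LH then -1 else 1) (refl_letter x)" for x
    by (cases x) (simp_all add: smul_minus_left)
  have "parity (prod_list (map refl_letter xs)) =
      smul (if odd_word (Word xs) then -1 else 1) (prod_list (map refl_letter xs))" for xs
    by (induction xs) (auto simp: odd_word_def l)
  from this[of "letters w"] show ?case
    by (simp add: parity_word refl_aut_word)
qed simp

section \<open>The defining ideal\<close>

lemma ring_free_ring: "ring free_ring"
proof (rule ringI)
  show "abelian_group free_ring"
  proof (rule abelian_groupI)
    show "\<exists>y\<in>carrier free_ring. y \<oplus>\<^bsub>free_ring\<^esub> x = \<zero>\<^bsub>free_ring\<^esub>" for x
      by (rule bexI[of _ "- x"]) (simp_all add: free_ring_def)
  qed (simp_all add: free_ring_def algebra_simps)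
  show "Group.monoid free_ring"
    by (rule Group.monoidI) (simp_all add: free_ring_def mult.assoc)
qed (simp_all add: free_ring_def algebra_simps)

lemma ideal_ideal_B: "ideal (ideal_B lam) free_ring"
  unfolding ideal_B_def by (rule ring.genideal_ideal[OF ring_free_ring]) (simp add: free_ring_def)

lemma ideal_B_zero: "0 \<in> ideal_B lam"
  using additive_subgroup.zero_closed[OF ideal.axioms(1)[OF ideal_ideal_B]]
  by (simp add: free_ring_def)

lemma ideal_B_add: "u \<in> ideal_B lam \<Longrightarrow> v \<in> ideal_B lam \<Longrightarrow> u + v \<in> ideal_B lam"
  using additive_subgroup.a_closed[OF ideal.axioms(1)[OF ideal_ideal_B]]
  by (simp add: free_ring_def)

lemma ideal_B_mult_left: "u \<in> ideal_B lam \<Longrightarrow> v * u \<in> ideal_B lam"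
  using ideal.I_l_closed[OF ideal_ideal_B] by (simp add: free_ring_def)

lemma ideal_B_mult_right: "u \<in> ideal_B lam \<Longrightarrow> u * v \<in> ideal_B lam"
  using ideal.I_r_closed[OF ideal_ideal_B] by (simp add: free_ring_def)

lemma ideal_B_smul: "u \<in> ideal_B lam \<Longrightarrow> smul c u \<in> ideal_B lam"
  unfolding smul_def by (rule ideal_B_mult_left)

lemma ideal_B_uminus: "u \<in> ideal_B lam \<Longrightarrow> - u \<in> ideal_B lam"
  using ideal_B_smul[of u lam "-1"] by (simp add: smul_minus_left)

lemma ideal_B_diff: "u \<in> ideal_B lam \<Longrightarrow> v \<in> ideal_B lam \<Longrightarrow> u - v \<in> ideal_B lam"
  using ideal_B_add[of u lam "- v"] ideal_B_uminus[of v lam] by simp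

lemma ideal_B_relators: "r \<in> relators lam \<Longrightarrow> r \<in> ideal_B lam"
  unfolding ideal_B_def
  using ring.genideal_self[OF ring_free_ring, of "relators lam"] by (auto simp: free_ring_def)

text \<open>Induction on the generation of a two-sided ideal, obtained from minimality.\<close>

lemma ideal_B_least:
  assumes "u \<in> ideal_B lam"
    and rel: "\<And>r. r \<in> relators lam \<Longrightarrow> P r"
    and zero: "P 0" and add: "\<And>u v. P u \<Longrightarrow> P v \<Longrightarrow> P (u + v)"
    and mult: "\<And>u v. P u \<Longrightarrow> P (v * u)" "\<And>u v. P u \<Longrightarrow> P (u * v)"
  shows "P u"
proof -
  have grp: "Group.group (add_monoid free_ring)"
    by (rule abelian_group.a_group[OF ring.is_abelian_group[OF ring_free_ring]])
  have "ideal {u. P u} free_ring"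
  proof (rule idealI[OF ring_free_ring])
    show "subgroup {u. P u} (add_monoid free_ring)"
    proof (rule group.subgroupI)
      show "Group.group (add_monoid free_ring)"
        by (rule grp)
    next
      show "{u. P u} \<noteq> {}" using zero by auto
    next
      fix a assume a: "a \<in> {u. P u}"
      have "inv\<^bsub>add_monoid free_ring\<^esub> a = - a"
        by (rule group.inv_equality[OF grp]) (auto simp: free_ring_def)
      then show "inv\<^bsub>add_monoid free_ring\<^esub> a \<in> {u. P u}" using mult(1)[of a "-1"] a by simp
    qed (use add in \<open>auto simp: free_ring_def\<close>)
  qed (use mult in \<open>auto simp: free_ring_def\<close>)
  then have "ideal_B lam \<subseteq> {u. P u}"
    unfolding ideal_B_def by (rule ring.genideal_minimal[OF ring_free_ring]) (use rel in auto)
  with assms(1) show ?thesis by auto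
qed

text \<open>Equality of classes serves as the congruence modulo the ideal throughout, so that chains of
  equations can be used in the quotient.\<close>

lemma cls_eq_iff: "cls lam u = cls lam v \<longleftrightarrow> u - v \<in> ideal_B lam"
proof -
  have cls: "cls lam w = {x + w |x. x \<in> ideal_B lam}" for w
    by (auto simp: cls_def a_r_coset_def r_coset_def free_ring_def)
  show ?thesis
  proof
    assume "cls lam u = cls lam v"
    moreover have "0 + u \<in> cls lam u" unfolding cls using ideal_B_zero by blast
    ultimately obtain x where "0 + u = x + v" "x \<in> ideal_B lam" unfolding cls by auto
    then show "u - v \<in> ideal_B lam" by simp
  next
    assume *: "u - v \<in> ideal_B lam"
    show "cls lam u = cls lam v"
      unfolding cls
    proof safe
      fix x assume "x \<in> ideal_B lam"
      then show "\<exists>y. x + u = y + v \<and> y \<in> ideal_B lam"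
        using ideal_B_add[OF _ *] by (intro exI[of _ "x + (u - v)"]) simp
    next
      fix x assume "x \<in> ideal_B lam"
      then show "\<exists>y. x + v = y + u \<and> y \<in> ideal_B lam"
        using ideal_B_diff[OF _ *] by (intro exI[of _ "x - (u - v)"]) simp
    qed
  qed
qed

lemma cls_add: "cls lam u = cls lam u' \<Longrightarrow> cls lam v = cls lam v' \<Longrightarrow> cls lam (u + v) = cls lam (u' + v')"
  unfolding cls_eq_iff using ideal_B_add[of "u - u'" lam "v - v'"] by (simp add: algebra_simps)

lemma cls_diff: "cls lam u = cls lam u' \<Longrightarrow> cls lam v = cls lam v' \<Longrightarrow> cls lam (u - v) = cls lam (u' - v')"
  unfolding cls_eq_iff using ideal_B_diff[of "u - u'" lam "v - v'"] by (simp add: algebra_simps)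

lemma cls_smul: "cls lam u = cls lam u' \<Longrightarrow> cls lam (smul c u) = cls lam (smul c u')"
  unfolding cls_eq_iff using ideal_B_smul[of "u - u'" lam c] by (simp add: smul_diff_right)

lemma cls_uminus: "cls lam u = cls lam u' \<Longrightarrow> cls lam (- u) = cls lam (- u')"
  using cls_smul[of lam u u' "-1"] by (simp add: smul_minus_left)

lemma cls_mult: "cls lam u = cls lam u' \<Longrightarrow> cls lam v = cls lam v' \<Longrightarrow> cls lam (u * v) = cls lam (u' * v')"
  unfolding cls_eq_iff
  using ideal_B_add[OF ideal_B_mult_right[of "u - u'" lam v] ideal_B_mult_left[of "v - v'" lam u']]
  by (simp add: algebra_simps)

lemma cls_mult_left: "cls lam v = cls lam v' \<Longrightarrow> cls lam (u * v) = cls lam (u * v')"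
  and cls_mult_right: "cls lam u = cls lam u' \<Longrightarrow> cls lam (u * v) = cls lam (u' * v)"
  by (rule cls_mult; simp)+

lemma relators_eq:
  "relators lam = {gH * gG - gG * gH - gG, gH * gF - gF * gH + gF, gG * gF + gF * gG - gH,
     gtau * gtau - smul ((lam + 1/2) ^ 2) 1}"
proof -
  have "scomm gG gF = gG * gF + gF * gG" by (simp add: scomm_gG)
  then show ?thesis unfolding relators_def scomm_gH power2_eq_square[of gtau] by (simp only:)
qed

lemma relators_mem:
  "gH * gG - gG * gH - gG \<in> ideal_B lam"
  "gH * gF - gF * gH + gF \<in> ideal_B lam"
  "gG * gF + gF * gG - gH \<in> ideal_B lam"
  "gtau * gtau - smul ((lam + 1/2) ^ 2) 1 \<in> ideal_B lam"
  by (rule ideal_B_relators, simp add: relators_eq)+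

lemma smul_2: "smul 2 u = u + u"
  using smul_add_left[of 1 1 u] by simp

lemma smul_half: "smul (1/2) u + smul (1/2) u = u"
  using smul_add_left[of "1/2" "1/2" u] by simp

lemma cls_GF: "cls lam (gG * gF) = cls lam (gH - gF * gG)"
  unfolding cls_eq_iff using relators_mem(3)[of lam] by (simp add: algebra_simps)

lemma cls_HF: "cls lam (gH * gF) = cls lam (gF * gH - gF)"
  unfolding cls_eq_iff using relators_mem(2)[of lam] by (simp add: algebra_simps)

lemma cls_FH: "cls lam (gF * gH) = cls lam (gH * gF + gF)"
  unfolding cls_eq_iff using ideal_B_uminus[OF relators_mem(2)[of lam]] by (simp add: algebra_simps)

lemma cls_GH: "cls lam (gG * gH) = cls lam (gH * gG - gG)"
  unfolding cls_eq_iff using ideal_B_uminus[OF relators_mem(1)[of lam]] by (simp add: algebra_simps)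

lemma cls_Ftau: "cls lam (gF * gtau) = cls lam (- gtau * gF)"
proof -
  \<comment> \<open>\<open>F\<tau> + \<tau>F\<close> as a combination of relators\<close>
  have "gF * gtau - (- gtau * gF) =
      (gH * gF - gF * gH + gF) - smul 2 (gF * (gG * gF + gF * gG - gH))"
    unfolding gtau_def using smul_half[of gF] by (simp add: algebra_simps smul_2)
  then show ?thesis
    unfolding cls_eq_iff by (simp add: ideal_B_diff ideal_B_smul ideal_B_mult_left relators_mem)
qed

lemma cls_Gtau: "cls lam (gG * gtau) = cls lam (- gtau * gG)"
proof -
  have "gG * gtau - (- gtau * gG) =
      - (gH * gG - gG * gH - gG) - smul 2 ((gG * gF + gF * gG - gH) * gG)"
    unfolding gtau_def using smul_half[of gG] by (simp add: algebra_simps smul_2)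
  then show ?thesis
    unfolding cls_eq_iff
    by (simp only:) (intro ideal_B_diff ideal_B_uminus ideal_B_smul ideal_B_mult_right relators_mem)
qed

lemma cls_Htau: "cls lam (gH * gtau) = cls lam (gtau * gH)"
proof -
  have "gH * gtau - gtau * gH =
      - smul 2 ((gH * gF - gF * gH + gF) * gG + gF * (gH * gG - gG * gH - gG))"
    unfolding gtau_def by (simp add: algebra_simps smul_2)
  then show ?thesis
    unfolding cls_eq_iff
    by (simp only:) (intro ideal_B_add ideal_B_uminus ideal_B_smul ideal_B_mult_right
        ideal_B_mult_left relators_mem)
qed

lemma cls_tau_tau: "cls lam (gtau * gtau) = cls lam (smul ((lam + 1/2) ^ 2) 1)"
  unfolding cls_eq_iff by (rule relators_mem)

lemma gF_gG: "gF * gG = smul (1/2) (gH + smul (1/2) 1 - gtau)"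
  by (simp add: gtau_def)

lemma ideal_B_parity: "u \<in> ideal_B lam \<Longrightarrow> parity u \<in> ideal_B lam"
proof (erule ideal_B_least)
  fix r assume "r \<in> relators lam"
  then have "parity r = r \<or> parity r = - r"
    by (auto simp: relators_eq)
  then show "parity r \<in> ideal_B lam"
    using ideal_B_relators[OF \<open>r \<in> relators lam\<close>] ideal_B_uminus by auto
qed (simp_all add: ideal_B_zero ideal_B_add ideal_B_mult_left ideal_B_mult_right)

lemma cls_parity: "cls lam u = cls lam v \<Longrightarrow> cls lam (parity u) = cls lam (parity v)"
  unfolding cls_eq_iff using ideal_B_parity[of "u - v"] by simp

lemma cls_scomm_gF: "cls lam u = cls lam v \<Longrightarrow> cls lam (scomm gF u) = cls lam (scomm gF v)"
  unfolding scomm_gF by (intro cls_diff cls_mult cls_parity) auto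

lemma cls_refl_aut_gtau: "cls lam (refl_aut gtau) = cls lam gtau"
proof -
  have "refl_aut gtau - gtau = smul 2 (gG * gF + gF * gG - gH)"
    by (simp add: gtau_def smul_2 algebra_simps)
  then show ?thesis
    unfolding cls_eq_iff by (simp add: ideal_B_smul relators_mem)
qed

lemma ideal_B_refl_aut: "u \<in> ideal_B lam \<Longrightarrow> refl_aut u \<in> ideal_B lam"
proof (erule ideal_B_least)
  from cls_mult[OF cls_refl_aut_gtau cls_refl_aut_gtau] have "cls lam (refl_aut (gtau * gtau)) = cls lam (smul ((lam + 1/2) ^ 2) 1)"
    by (simp add: cls_tau_tau)
  then have "refl_aut (gtau * gtau - smul ((lam + 1/2) ^ 2) 1) \<in> ideal_B lam"
    unfolding cls_eq_iff by simp
  moreover have "refl_aut (gH * gG - gG * gH - gG) = gH * gF - gF * gH + gF"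
    "refl_aut (gH * gF - gF * gH + gF) = - (gH * gG - gG * gH - gG)"
    "refl_aut (gG * gF + gF * gG - gH) = - (gG * gF + gF * gG - gH)"
    by (simp_all add: algebra_simps)
  ultimately show "refl_aut r \<in> ideal_B lam" if "r \<in> relators lam" for r
    using that relators_mem(1-3)[of lam] relators_mem(1,3)[THEN ideal_B_uminus, of lam]
    unfolding relators_eq by (elim insertE emptyE) (simp_all only:)
qed (simp_all add: ideal_B_zero ideal_B_add ideal_B_mult_left ideal_B_mult_right)

lemma cls_refl_aut: "cls lam u = cls lam v \<Longrightarrow> cls lam (refl_aut u) = cls lam (refl_aut v)"
  unfolding cls_eq_iff using ideal_B_refl_aut[of "u - v"] by simp

text \<open>An antiautomorphism with Koszul signs maps \<open>u v\<close> to a product with \<open>stransp (parity u)\<close> when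
  \<open>v\<close> is odd; the claim therefore has to be proved for \<open>u\<close> and \<open>parity u\<close> simultaneously.\<close>

lemma ideal_B_stransp:
  assumes "u \<in> ideal_B lam" shows "stransp u \<in> ideal_B lam"
proof -
  have "stransp u \<in> ideal_B lam \<and> stransp (parity u) \<in> ideal_B lam"
    using assms
  proof (rule ideal_B_least)
    fix r assume r: "r \<in> relators lam"
    have "stransp (gH * gG - gG * gH - gG) = gH * gF - gF * gH + gF"
      "stransp (gH * gF - gF * gH + gF) = - (gH * gG - gG * gH - gG)"
      "stransp (gG * gF + gF * gG - gH) = gG * gF + gF * gG - gH"
      "stransp (gtau * gtau - smul ((lam + 1/2) ^ 2) 1) = gtau * gtau - smul ((lam + 1/2) ^ 2) 1"
      by (simp_all add: stransp_mult_gens stransp_mult_even algebra_simps)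
    then have s: "stransp r \<in> ideal_B lam"
      using r relators_mem[of lam] relators_mem(1)[THEN ideal_B_uminus, of lam]
      unfolding relators_eq by (elim insertE emptyE) (simp_all only:)
    moreover have "parity r = r \<or> parity r = - r" using r by (auto simp: relators_eq)
    ultimately show "stransp r \<in> ideal_B lam \<and> stransp (parity r) \<in> ideal_B lam"
      using ideal_B_uminus by auto
  next
    fix u v assume u: "stransp u \<in> ideal_B lam \<and> stransp (parity u) \<in> ideal_B lam"
    have 1: "stransp (v * u) \<in> ideal_B lam" if u: "stransp u \<in> ideal_B lam \<and> stransp (parity u) \<in> ideal_B lam" for u v
      by (induction v rule: free_induct)
        (use u in \<open>auto simp: stransp_word_mult distrib_right ideal_B_add ideal_B_smul ideal_B_mult_right\<close>)
    have 2: "stransp (u * v) \<in> ideal_B lam" if u: "stransp u \<in> ideal_B lam \<and> stransp (parity u) \<in> ideal_B lam" for u v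
      by (induction v rule: free_induct)
        (use u in \<open>auto simp: stransp_mult_word distrib_left ideal_B_add ideal_B_smul ideal_B_mult_left\<close>)
    show "stransp (v * u) \<in> ideal_B lam \<and> stransp (parity (v * u)) \<in> ideal_B lam"
      using 1[of u v] 1[of "parity u" "parity v"] u by auto
    show "stransp (u * v) \<in> ideal_B lam \<and> stransp (parity (u * v)) \<in> ideal_B lam"
      using 2[of u v] 2[of "parity u" "parity v"] u by auto
  qed (simp_all add: ideal_B_zero ideal_B_add)
  then show ?thesis by simp
qed

lemma cls_stransp: "cls lam u = cls lam v \<Longrightarrow> cls lam (stransp u) = cls lam (stransp v)"
  unfolding cls_eq_iff using ideal_B_stransp[of "u - v"] by simp

section \<open>A representation by difference operators\<close>

text \<open>Functions on the two lines \<open>\<tau> = c\<close> and \<open>\<tau> = -c\<close>, the flag selecting the line. Letting \<open>H\<close> and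
  \<open>\<tau>\<close> act by multiplication and \<open>G\<close> by \<open>(h, t) \<mapsto> (h - 1, -t)\<close> forces \<open>F\<close> to act by the opposite
  shift times \<open>(h + 1/2 - t)/2\<close>, as \<open>F G = (H + 1/2 - \<tau>)/2\<close>.\<close>

type_synonym fun_on_lines = "complex \<Rightarrow> bool \<Rightarrow> complex"

definition tau_val :: "complex \<Rightarrow> bool \<Rightarrow> complex" where
  "tau_val c s = (if s then c else - c)"

lemma tau_val_not [simp]: "tau_val c (\<not> s) = - tau_val c s"
  by (simp add: tau_val_def)

fun act_letter :: "complex \<Rightarrow> letter \<Rightarrow> fun_on_lines \<Rightarrow> fun_on_lines" where
  "act_letter c LF \<phi> = (\<lambda>h s. (h + 1/2 - tau_val c s) / 2 * \<phi> (h + 1) (\<not> s))"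
| "act_letter c LG \<phi> = (\<lambda>h s. \<phi> (h - 1) (\<not> s))"
| "act_letter c LH \<phi> = (\<lambda>h s. h * \<phi> h s)"

definition act :: "complex \<Rightarrow> free \<Rightarrow> fun_on_lines \<Rightarrow> fun_on_lines" where
  "act c u \<phi> = (\<lambda>h s. \<Sum>w\<in>Poly_Mapping.keys u.
      Poly_Mapping.lookup u w * foldr (act_letter c) (letters w) \<phi> h s)"

lemma act_add: "act c (u + v) \<phi> = (\<lambda>h s. act c u \<phi> h s + act c v \<phi> h s)"
  unfolding act_def by (intro ext sum_keys_add) (simp_all add: algebra_simps)

lemma act_monom: "act c (smul d (word_elt w)) \<phi> = (\<lambda>h s. d * foldr (act_letter c) (letters w) \<phi> h s)"
  by (cases "d = 0") (simp_all add: act_def smul_word_elt lookup_single)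

lemma act_smul: "act c (smul d u) \<phi> = (\<lambda>h s. d * act c u \<phi> h s)"
  by (induction u rule: free_induct) (simp_all add: act_monom act_add smul_add_right algebra_simps)

lemma act_zero: "act c 0 \<phi> = (\<lambda>h s. 0)"
  by (simp add: act_def)

lemma act_uminus: "act c (- u) \<phi> = (\<lambda>h s. - act c u \<phi> h s)"
  using act_smul[of c "-1" u] by (simp add: smul_minus_left)

lemma act_diff: "act c (u - v) \<phi> = (\<lambda>h s. act c u \<phi> h s - act c v \<phi> h s)"
  using act_add[of c u "- v"] by (simp add: act_uminus)

text \<open>Homogeneity and additivity in a single statement; either follows by specialisation.\<close>

lemma foldr_act_letter_linear:
  "foldr (act_letter c) xs (\<lambda>h s. a * \<phi> h s + \<psi> h s) =
     (\<lambda>h s. a * foldr (act_letter c) xs \<phi> h s + foldr (act_letter c) xs \<psi> h s)"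
proof (induction xs)
  case (Cons x xs)
  then show ?case by (cases x) (simp_all add: algebra_simps)
qed simp

lemma foldr_act_letter_zero: "foldr (act_letter c) xs (\<lambda>h s. 0) = (\<lambda>h s. 0)"
  using foldr_act_letter_linear[of c xs "-1" "\<lambda>h s. 0" "\<lambda>h s. 0"] by simp

lemma act_mult: "act c (u * v) \<phi> = act c u (act c v \<phi>)"
proof (induction u rule: free_induct)
  case (monom d w)
  show ?case
  proof (induction v rule: free_induct)
    case (monom e w')
    then show ?case
      using foldr_act_letter_linear[of c "letters w" e "foldr (act_letter c) (letters w') \<phi>" "\<lambda>h s. 0"]
      by (simp add: act_monom plus_word_def foldr_act_letter_zero mult_ac)
  next
    case (add v v')
    show ?case
      using foldr_act_letter_linear[of c "letters w" 1 "act c v \<phi>" "act c v' \<phi>"] add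
      by (simp add: act_monom act_add distrib_left smul_add_right fun_eq_iff)
  qed
next
  case (add u u')
  then show ?case by (simp add: act_add distrib_right)
qed

lemma act_gens:
  "act c gF \<phi> = (\<lambda>h s. (h + 1/2 - tau_val c s) / 2 * \<phi> (h + 1) (\<not> s))"
  "act c gG \<phi> = (\<lambda>h s. \<phi> (h - 1) (\<not> s))"
  "act c gH \<phi> = (\<lambda>h s. h * \<phi> h s)"
  "act c 1 \<phi> = \<phi>"
  using act_monom[of c 1 "Word [LF]" \<phi>] act_monom[of c 1 "Word [LG]" \<phi>] act_monom[of c 1 "Word [LH]" \<phi>]
    act_monom[of c 1 0 \<phi>]
  by (simp_all add: gF_def gG_def gH_def zero_word_def[symmetric]) (simp add: zero_word_def)

lemma act_gtau: "act c gtau \<phi> = (\<lambda>h s. tau_val c s * \<phi> h s)"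
  by (simp add: gtau_def act_add act_diff act_smul act_mult act_gens fun_eq_iff field_simps)

text \<open>This keeps the quotient from collapsing: elements that act differently on functions have
  different classes.\<close>

lemma act_ideal_B:
  assumes "u \<in> ideal_B lam" shows "act (lam + 1/2) u \<phi> = (\<lambda>h s. 0)"
proof -
  define c where "c = lam + 1/2"
  have "\<forall>\<phi>. act c u \<phi> = (\<lambda>h s. 0)"
    using assms
  proof (rule ideal_B_least)
    fix r assume r: "r \<in> relators lam"
    have "tau_val c s * (tau_val c s * x) = c^2 * x" for s x by (simp add: tau_val_def power2_eq_square)
    then show "\<forall>\<phi>. act c r \<phi> = (\<lambda>h s. 0)"
      using r unfolding relators_eq c_def[symmetric]
      by (elim insertE emptyE; hypsubst)
        (simp_all add: act_add act_diff act_smul act_mult act_gens act_gtau fun_eq_iff field_simps)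
  next
    fix u v assume u: "\<forall>\<phi>. act c u \<phi> = (\<lambda>h s. 0)"
    have "act c v (\<lambda>h s. 0) = (\<lambda>h s. 0)"
      by (induction v rule: free_induct) (simp_all add: act_monom foldr_act_letter_zero act_add)
    with u show "\<forall>\<phi>. act c (v * u) \<phi> = (\<lambda>h s. 0)" "\<forall>\<phi>. act c (u * v) \<phi> = (\<lambda>h s. 0)"
      by (simp_all add: act_mult)
  qed (simp_all add: act_zero act_add)
  then show ?thesis by (simp add: c_def)
qed

lemma act_cls:
  assumes "cls lam u = cls lam v"
  shows "act (lam + 1/2) u \<phi> = act (lam + 1/2) v \<phi>"
  using act_ideal_B[of "u - v" lam \<phi>] assms by (simp add: cls_eq_iff act_diff fun_eq_iff)

section \<open>Evaluation of bivariate polynomials\<close>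

text \<open>The value at \<open>H = h\<close>, \<open>\<tau> = t\<close>.\<close>

definition bival :: "bipoly \<Rightarrow> complex \<Rightarrow> complex \<Rightarrow> complex" where
  "bival P h t = poly (poly P [:t:]) h"

lemma bival_simps [simp]:
  "bival (P + Q) h t = bival P h t + bival Q h t"
  "bival (P - Q) h t = bival P h t - bival Q h t"
  "bival (- P) h t = - bival P h t"
  "bival (P * Q) h t = bival P h t * bival Q h t"
  "bival (P ^ n) h t = bival P h t ^ n"
  "bival (cst c) h t = c" "bival vH h t = h" "bival vtau h t = t"
  "bival 0 h t = 0" "bival 1 h t = 1"
  "bival (pCons p P) h t = poly p h + t * bival P h t"
  by (simp_all add: bival_def cst_def vH_def vtau_def)

lemma subst_lin_0 [simp]: "subst_lin \<alpha> \<beta> \<sigma> 0 = 0"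
  by (simp add: subst_lin_def)

lemma subst_lin_pCons:
  "subst_lin \<alpha> \<beta> \<sigma> (pCons p P) = pCons (pcompose p [:\<beta>, \<alpha>:]) (smult [:\<sigma>:] (subst_lin \<alpha> \<beta> \<sigma> P))"
  by (simp add: subst_lin_def map_poly_pCons pcompose_pCons)

lemma bival_smult [simp]: "bival (smult p P) h t = poly p h * bival P h t"
  by (simp add: bival_def)

lemma bival_subst_lin [simp]: "bival (subst_lin \<alpha> \<beta> \<sigma> P) h t = bival P (\<alpha> * h + \<beta>) (\<sigma> * t)"
  by (induction P) (simp_all add: subst_lin_pCons poly_pcompose algebra_simps)

text \<open>For fixed \<open>t\<close> the difference vanishes at infinitely many \<open>h\<close>; as a polynomial in \<open>\<tau>\<close> over the
  domain \<open>\<complex>[H]\<close> it then has infinitely many roots \<open>[:t:]\<close>.\<close>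

lemma bipoly_eqI:
  assumes "\<And>h t. bival P h t = bival Q h t"
  shows "P = Q"
proof (rule ccontr)
  assume "P \<noteq> Q"
  then have "finite {x. poly (P - Q) x = 0}" by (intro poly_roots_finite) simp
  moreover have "poly (P - Q) [:t:] = 0" for t
    using assms by (intro poly_eqI_degree[of UNIV] iffD1[OF poly_all_0_iff_0])
      (auto simp: bival_def)
  then have "range (\<lambda>t. [:t:]) \<subseteq> {x. poly (P - Q) x = 0}" by auto
  ultimately have "finite (range (\<lambda>t::complex. [:t:]))" using finite_subset by blast
  moreover have "inj (\<lambda>t::complex. [:t:])" by (auto simp: inj_on_def)
  ultimately show False using finite_imageD infinite_UNIV_char_0 by blast
qed

lemma CHtau_iff: "P \<in> CHtau \<longleftrightarrow> (\<exists>p q. P = [:p, q:])"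
proof
  assume P: "P \<in> CHtau"
  obtain p P' where 1: "P = pCons p P'" by (cases P)
  obtain q P'' where 2: "P' = pCons q P''" by (cases P')
  have "P'' = 0" using P unfolding 1 2 CHtau_def by (simp split: if_splits)
  then show "\<exists>p q. P = [:p, q:]" using 1 2 by auto
qed (auto simp: CHtau_def)

text \<open>The two equations \<open>p \<plusminus> c q = p' \<plusminus> c q'\<close> determine \<open>p\<close> and \<open>q\<close> because \<open>c \<noteq> 0\<close>.\<close>

lemma CHtau_eqI:
  assumes "P \<in> CHtau" "Q \<in> CHtau" "c \<noteq> 0"
    and eq: "\<And>h s. bival P h (tau_val c s) = bival Q h (tau_val c s)"
  shows "P = Q"
proof -
  obtain p q p' q' where P: "P = [:p, q:]" and Q: "Q = [:p', q':]"
    using assms(1,2) by (auto simp: CHtau_iff)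
  have *: "poly p h + c * poly q h = poly p' h + c * poly q' h"
    "poly p h - c * poly q h = poly p' h - c * poly q' h" for h
    using eq[of h True] eq[of h False] by (simp_all add: P Q tau_val_def)
  have "poly p h = poly p' h" for h
  proof -
    have "(poly p h + c * poly q h) + (poly p h - c * poly q h) =
        (poly p' h + c * poly q' h) + (poly p' h - c * poly q' h)"
      by (simp only: *)
    then show ?thesis by simp
  qed
  moreover from this have "poly q h = poly q' h" for h using *[of h] \<open>c \<noteq> 0\<close> by simp
  ultimately show ?thesis unfolding P Q by (metis poly_eq_poly_eq_iff ext)
qed

section \<open>Polynomials as elements of the algebra\<close>

text \<open>The image in the free algebra of a polynomial in \<open>H\<close> alone; \<open>in_free\<close> is a Horner scheme in \<open>\<tau>\<close>
  with such coefficients.\<close>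

definition uni_free :: "complex poly \<Rightarrow> free" where
  "uni_free p = (\<Sum>a\<le>degree p. smul (coeff p a) (gH ^ a))"

lemma uni_free_altdef: "degree p \<le> n \<Longrightarrow> uni_free p = (\<Sum>a\<le>n. smul (coeff p a) (gH ^ a))"
  unfolding uni_free_def by (rule sum.mono_neutral_left) (auto simp: coeff_eq_0)

lemma uni_free_0 [simp]: "uni_free 0 = 0"
  by (simp add: uni_free_def)

lemma uni_free_pCons: "uni_free (pCons a p) = smul a 1 + gH * uni_free p"
proof -
  have "uni_free (pCons a p) = (\<Sum>b\<le>Suc (degree p). smul (coeff (pCons a p) b) (gH ^ b))"
    by (rule uni_free_altdef) (rule degree_pCons_le)
  also have "\<dots> = smul a 1 + (\<Sum>b\<le>degree p. smul (coeff p b) (gH * gH ^ b))"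
    by (simp add: sum.atMost_Suc_shift del: sum.atMost_Suc)
  finally show ?thesis by (simp add: uni_free_def sum_distrib_left)
qed

lemma uni_free_add: "uni_free (p + q) = uni_free p + uni_free q"
  by (induction p q rule: poly_induct2) (simp_all add: uni_free_pCons smul_add_left algebra_simps)

lemma uni_free_uminus: "uni_free (- p) = - uni_free p"
  using uni_free_add[of "- p" p] by (simp add: eq_neg_iff_add_eq_0)

lemma uni_free_smult: "uni_free (smult c p) = smul c (uni_free p)"
  by (induction p) (simp_all add: uni_free_pCons smul_add_right)

lemma uni_free_mult: "uni_free (p * q) = uni_free p * uni_free q"
  by (induction p) (simp_all add: uni_free_pCons uni_free_add uni_free_smult algebra_simps)

lemma in_free_altdef:
  "degree P \<le> n \<Longrightarrow> in_free P = (\<Sum>b\<le>n. uni_free (coeff P b) * gtau ^ b)"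
proof -
  assume n: "degree P \<le> n"
  have "in_free P = (\<Sum>b\<le>degree P. uni_free (coeff P b) * gtau ^ b)"
    by (simp add: in_free_def uni_free_def sum_distrib_right)
  also have "\<dots> = (\<Sum>b\<le>n. uni_free (coeff P b) * gtau ^ b)"
    by (rule sum.mono_neutral_left) (use n in \<open>auto simp: coeff_eq_0\<close>)
  finally show ?thesis .
qed

lemma in_free_0 [simp]: "in_free 0 = 0"
  by (simp add: in_free_def)

lemma in_free_pCons: "in_free (pCons p P) = uni_free p + in_free P * gtau"
proof -
  have "in_free (pCons p P) = (\<Sum>b\<le>Suc (degree P). uni_free (coeff (pCons p P) b) * gtau ^ b)"
    by (rule in_free_altdef) (rule degree_pCons_le)
  also have "\<dots> = uni_free p + (\<Sum>b\<le>degree P. uni_free (coeff P b) * gtau ^ b * gtau)"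
    by (simp add: sum.atMost_Suc_shift mult.assoc power_commutes del: sum.atMost_Suc)
  finally show ?thesis by (simp add: in_free_altdef[OF order_refl] sum_distrib_right)
qed

lemma in_free_add: "in_free (P + Q) = in_free P + in_free Q"
  by (induction P Q rule: poly_induct2) (simp_all add: in_free_pCons uni_free_add algebra_simps)

lemma in_free_smult: "in_free (smult p P) = uni_free p * in_free P"
  by (induction P) (simp_all add: in_free_pCons uni_free_mult distrib_left mult.assoc)

lemma in_free_cst [simp]: "in_free (cst c) = smul c 1"
  by (simp add: cst_def in_free_pCons uni_free_pCons)

lemma in_free_1 [simp]: "in_free 1 = 1"
  using in_free_cst[of 1] by (simp add: cst_def one_pCons)

lemma in_free_vH [simp]: "in_free vH = gH"
  by (simp add: vH_def in_free_pCons uni_free_pCons)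

lemma in_free_vtau [simp]: "in_free vtau = gtau"
  by (simp add: vtau_def in_free_pCons uni_free_pCons one_pCons)

lemma in_free_cst_mult [simp]: "in_free (cst c * P) = smul c (in_free P)"
  by (simp add: cst_def in_free_smult uni_free_pCons)

lemma in_free_uminus [simp]: "in_free (- P) = - in_free P"
  using in_free_add[of "- P" P] by (simp add: eq_neg_iff_add_eq_0)

lemma in_free_diff: "in_free (P - Q) = in_free P - in_free Q"
  using in_free_add[of P "- Q"] by simp

lemma parity_in_free [simp]: "parity (in_free P) = in_free P"
proof -
  have "parity (uni_free p) = uni_free p" for p
    by (induction p) (simp_all add: uni_free_pCons)
  then show ?thesis by (induction P) (simp_all add: in_free_pCons)
qed

text \<open>Commutation with the generators \<open>H\<close> and \<open>\<tau>\<close> propagates to all polynomials. It is applied with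
  \<open>X = F, G\<close> (shifts) and with \<open>X\<close> itself a polynomial in \<open>H\<close> and \<open>\<tau>\<close> (commutativity).\<close>

lemma intertwine:
  assumes H: "cls lam (X * gH) = cls lam ((smul \<alpha> gH + smul \<beta> 1) * X)"
    and T: "cls lam (X * gtau) = cls lam (smul \<sigma> gtau * X)"
  shows "cls lam (X * in_free P) = cls lam (in_free (subst_lin \<alpha> \<beta> \<sigma> P) * X)"
proof -
  have uni: "cls lam (X * uni_free p) = cls lam (uni_free (pcompose p [:\<beta>, \<alpha>:]) * X)" for p
  proof (induction p)
    case (pCons a p)
    have "cls lam (X * uni_free (pCons a p)) = cls lam (smul a X + (X * gH) * uni_free p)"
      by (simp add: uni_free_pCons algebra_simps)
    also have "\<dots> = cls lam (smul a X + (smul \<alpha> gH + smul \<beta> 1) * (X * uni_free p))"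
      unfolding mult.assoc[symmetric] by (intro cls_add cls_mult H refl)
    also have "\<dots> = cls lam (smul a X + (smul \<alpha> gH + smul \<beta> 1) * (uni_free (pcompose p [:\<beta>, \<alpha>:]) * X))"
      by (intro cls_add cls_mult pCons.IH refl)
    also have "\<dots> = cls lam (uni_free (pcompose (pCons a p) [:\<beta>, \<alpha>:]) * X)"
      by (simp add: pcompose_pCons uni_free_add uni_free_mult uni_free_smult uni_free_pCons algebra_simps)
    finally show ?case .
  qed simp
  show ?thesis
  proof (induction P)
    case (pCons p P)
    let ?S = "subst_lin \<alpha> \<beta> \<sigma>"
    have "cls lam (X * in_free (pCons p P)) = cls lam (X * uni_free p + X * in_free P * gtau)"
      by (simp add: in_free_pCons algebra_simps)
    also have "\<dots> = cls lam (uni_free (pcompose p [:\<beta>, \<alpha>:]) * X + in_free (?S P) * (X * gtau))"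
      unfolding mult.assoc[symmetric] by (intro cls_add cls_mult pCons.IH uni refl)
    also have "\<dots> = cls lam (uni_free (pcompose p [:\<beta>, \<alpha>:]) * X + in_free (?S P) * (smul \<sigma> gtau * X))"
      by (intro cls_add cls_mult T refl)
    also have "\<dots> = cls lam (in_free (?S (pCons p P)) * X)"
      by (simp add: subst_lin_pCons in_free_pCons in_free_smult uni_free_pCons algebra_simps)
    finally show ?case .
  qed simp
qed

lemma subst_lin_id [simp]: "subst_lin 1 0 1 P = P"
  by (rule bipoly_eqI) simp

lemma cls_H_in_free: "cls lam (gH * in_free P) = cls lam (in_free P * gH)"
  using intertwine[of lam gH 1 0 1 P] cls_Htau by simp

lemma cls_tau_in_free: "cls lam (gtau * in_free P) = cls lam (in_free P * gtau)"
  using intertwine[of lam gtau 1 0 1 P] cls_Htau[of lam] by simp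

lemma cls_in_free_commute: "cls lam (in_free P * in_free Q) = cls lam (in_free Q * in_free P)"
  using intertwine[of lam "in_free P" 1 0 1 Q] cls_H_in_free[of lam P] cls_tau_in_free[of lam P] by simp

lemma cls_F_in_free: "cls lam (gF * in_free P) = cls lam (in_free (subst_lin 1 1 (-1) P) * gF)"
  using cls_FH[of lam] cls_Ftau[of lam] by (intro intertwine) (simp_all add: smul_minus_left algebra_simps)

lemma cls_G_in_free: "cls lam (gG * in_free P) = cls lam (in_free (subst_lin 1 (-1) (-1) P) * gG)"
  using cls_GH[of lam] cls_Gtau[of lam] by (intro intertwine) (simp_all add: smul_minus_left algebra_simps)

lemma cls_in_free_mult: "cls lam (in_free (P * Q)) = cls lam (in_free P * in_free Q)"
proof (induction Q)
  case (pCons q Q)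
  have "cls lam (uni_free q * in_free P) = cls lam (in_free P * uni_free q)"
    using cls_in_free_commute[of lam "[:q:]" P] by (simp add: in_free_pCons)
  then have "cls lam (uni_free q * in_free P + in_free (P * Q) * gtau) =
      cls lam (in_free P * uni_free q + (in_free P * in_free Q) * gtau)"
    by (intro cls_add cls_mult_right pCons.IH)
  then show ?case
    by (simp add: in_free_add in_free_smult in_free_pCons algebra_simps)
qed simp

lemma cls_refl_aut_in_free: "cls lam (refl_aut (in_free P)) = cls lam (in_free (reflect_H P))"
proof -
  have uni: "refl_aut (uni_free p) = uni_free (pcompose p [:0, -1:])" for p
    by (induction p) (simp_all add: uni_free_pCons pcompose_pCons uni_free_add uni_free_uminus algebra_simps)
  show ?thesis
    unfolding reflect_H_def
  proof (induction P)
    case (pCons p P)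
    have "cls lam (refl_aut (in_free P) * refl_aut gtau) = cls lam (in_free (subst_lin (-1) 0 1 P) * gtau)"
      by (intro cls_mult pCons.IH cls_refl_aut_gtau)
    then have "cls lam (uni_free (pcompose p [:0, -1:]) + refl_aut (in_free P) * refl_aut gtau) =
      cls lam (uni_free (pcompose p [:0, -1:]) + in_free (subst_lin (-1) 0 1 P) * gtau)"
      by (intro cls_add refl)
    then show ?case by (simp add: in_free_pCons uni subst_lin_pCons flip: one_pCons)
  qed simp
qed

lemma stransp_in_free: "cls lam (stransp (in_free P)) = cls lam (in_free P)"
proof -
  have par: "parity (uni_free p) = uni_free p" for p
    using parity_in_free[of "[:p:]"] by (simp add: in_free_pCons)
  have uni: "stransp (uni_free p) = uni_free p" for p
  proof (induction p)
    case (pCons a p)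
    have "uni_free p * gH = gH * uni_free p"
      using uni_free_mult[of p "[:0,1:]"] uni_free_mult[of "[:0,1:]" p] by (simp add: uni_free_pCons mult.commute)
    then show ?case by (simp add: uni_free_pCons stransp_mult_even pCons.IH)
  qed simp
  show ?thesis
  proof (induction P)
    case (pCons p P)
    have "cls lam (uni_free p + gtau * stransp (in_free P)) = cls lam (uni_free p + gtau * in_free P)"
      by (intro cls_add cls_mult_left pCons.IH refl)
    also have "\<dots> = cls lam (uni_free p + in_free P * gtau)"
      by (intro cls_add cls_tau_in_free refl)
    finally show ?case by (simp add: in_free_pCons stransp_mult_even uni)
  qed simp
qed

section \<open>Normal form modulo the relation for \<open>\<tau>\<^sup>2\<close>\<close>

text \<open>Repeatedly replacing \<open>\<tau>\<^sup>2\<close> by the scalar \<open>(\<lambda> + 1/2)\<^sup>2\<close>; the values at \<open>\<tau> = \<plusminus>(\<lambda> + 1/2)\<close> do not change.\<close>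

lemma CHtau_reduce:
  "\<exists>Q\<in>CHtau. ev lam Q = ev lam P \<and> (\<forall>h s. bival Q h (tau_val (lam + 1/2) s) = bival P h (tau_val (lam + 1/2) s))"
proof (induction P)
  case 0
  show ?case by (intro bexI[of _ 0]) (auto simp: CHtau_def)
next
  case (pCons p P)
  then obtain Q where Q: "Q \<in> CHtau" "ev lam Q = ev lam P"
    "\<And>h s. bival Q h (tau_val (lam + 1/2) s) = bival P h (tau_val (lam + 1/2) s)" by blast
  then obtain a b where ab: "Q = [:a, b:]" by (auto simp: CHtau_iff)
  define c where "c = lam + 1/2"
  have "cls lam (in_free (pCons p P)) = cls lam (uni_free p + in_free Q * gtau)"
    unfolding in_free_pCons using Q(2) by (intro cls_add cls_mult refl) (simp add: ev_def)
  also have "uni_free p + in_free Q * gtau = uni_free p + (uni_free a * gtau + uni_free b * (gtau * gtau))"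
    by (simp add: ab in_free_pCons algebra_simps)
  also have "cls lam \<dots> = cls lam (uni_free p + (uni_free a * gtau + uni_free b * smul (c^2) 1))"
    unfolding c_def by (intro cls_add cls_mult cls_tau_tau refl)
  also have "\<dots> = cls lam (in_free [:p + smult (c^2) b, a:])"
    by (simp add: in_free_pCons uni_free_add uni_free_smult algebra_simps)
  finally have "ev lam [:p + smult (c^2) b, a:] = ev lam (pCons p P)" by (simp add: ev_def)
  moreover have "bival [:p + smult (c^2) b, a:] h (tau_val c s) = bival (pCons p P) h (tau_val c s)" for h s
  proof -
    have "tau_val c s * tau_val c s = c ^ 2" by (simp add: tau_val_def power2_eq_square)
    then show ?thesis
      using Q(3)[of h s, folded c_def, symmetric]
      by (simp add: ab distrib_left flip: mult.assoc)
  qed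
  ultimately show ?case unfolding c_def by (intro bexI[of _ "[:p + smult (c^2) b, a:]"]) (auto simp: CHtau_def c_def)
qed

text \<open>This reduces equations in the quotient to equations between complex numbers.\<close>

lemma ev_eqI:
  assumes "lam \<noteq> -1/2" "\<And>h s. bival P h (tau_val (lam + 1/2) s) = bival Q h (tau_val (lam + 1/2) s)"
  shows "ev lam P = ev lam Q"
proof -
  obtain P' where P': "P' \<in> CHtau" "ev lam P' = ev lam P"
    "\<And>h s. bival P' h (tau_val (lam + 1/2) s) = bival P h (tau_val (lam + 1/2) s)" using CHtau_reduce by blast
  obtain Q' where Q': "Q' \<in> CHtau" "ev lam Q' = ev lam Q"
    "\<And>h s. bival Q' h (tau_val (lam + 1/2) s) = bival Q h (tau_val (lam + 1/2) s)" using CHtau_reduce by blast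
  have "lam + 1/2 \<noteq> 0" using assms(1) by (auto simp: add_eq_0_iff2)
  then have "P' = Q'" using P' Q' assms(2) by (intro CHtau_eqI[of _ _ "lam + 1/2"]) auto
  then show ?thesis using P' Q' by simp
qed

lemma act_in_free: "act c (in_free P) \<phi> = (\<lambda>h s. bival P h (tau_val c s) * \<phi> h s)"
proof -
  have uni: "act c (uni_free p) \<phi> = (\<lambda>h s. poly p h * \<phi> h s)" for p \<phi>
    by (induction p arbitrary: \<phi>) (simp_all add: uni_free_pCons act_zero act_add act_smul act_mult act_gens algebra_simps)
  show ?thesis
    by (induction P arbitrary: \<phi>) (simp_all add: in_free_pCons act_zero act_add act_mult uni act_gtau algebra_simps)
qed

lemma act_power_gG: "act c (gG ^ j) (\<lambda>h s. 1) = (\<lambda>h s. 1)"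
  by (induction j) (simp_all add: act_gens act_mult)

text \<open>Letting \<open>P G\<^sup>j\<close> act on the constant function 1 recovers the values of \<open>P\<close>.\<close>

lemma in_free_G_power_inj:
  assumes "lam \<noteq> -1/2" "P \<in> CHtau" "Q \<in> CHtau"
    and "cls lam (in_free P * gG ^ j) = cls lam (in_free Q * gG ^ j)"
  shows "P = Q"
proof (rule CHtau_eqI[OF assms(2,3), of "lam + 1/2"])
  show "lam + 1/2 \<noteq> 0" using assms(1) by (auto simp: add_eq_0_iff2)
  show "bival P h (tau_val (lam + 1/2) s) = bival Q h (tau_val (lam + 1/2) s)" for h s
    using act_cls[OF assms(4), of "\<lambda>h s. 1"] by (simp add: act_mult act_power_gG act_in_free fun_eq_iff)
qed

section \<open>The adjoint action of \<open>F\<close> and the polynomials \<open>f\<^bsub>k,j\<^esub>\<close>\<close>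

text \<open>The elements \<open>F G\<close> and, moved to the left through \<open>G\<^sup>j\<close>, \<open>G F\<close>, as polynomials in \<open>H\<close> and \<open>\<tau>\<close>:
  \<open>G\<^bsup>j+1\<^esup> F\<close> equals \<open>GF_poly j\<close> times \<open>G\<^sup>j\<close>.\<close>

definition FG_poly :: bipoly where
  "FG_poly = cst (1/2) * (vH + cst (1/2) - vtau)"

definition GF_poly :: "nat \<Rightarrow> bipoly" where
  "GF_poly j = cst (1/2) * (vH - cst (of_nat j + 1/2) + cst ((-1) ^ j) * vtau)"

lemma in_free_FG_poly: "in_free FG_poly = gF * gG"
  by (simp add: FG_poly_def in_free_add in_free_diff gF_gG)

lemma cls_G_power_GF: "cls lam (gG ^ Suc j * gF) = cls lam (in_free (GF_poly j) * gG ^ j)"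
proof (induction j)
  case 0
  have "in_free (GF_poly 0) = gH - gF * gG"
  proof -
    have "smul (1/2) gH + smul (1/2) gH = gH" by (rule smul_half)
    then have "gH - smul (1/2) gH = smul (1/2) gH" by (simp only: diff_eq_eq)
    moreover have "in_free (GF_poly 0) = smul (1/2) gH - smul (1/4) 1 + smul (1/2) gtau"
      by (simp add: GF_poly_def in_free_add in_free_diff smul_add_right smul_diff_right)
    ultimately show ?thesis by (simp add: gF_gG smul_diff_right smul_add_right)
  qed
  then show ?case using cls_GF[of lam] by simp
next
  case (Suc j)
  have e: "subst_lin 1 (-1) (-1) (GF_poly j) = GF_poly (Suc j)"
    by (rule bipoly_eqI) (simp add: GF_poly_def field_simps)
  have "cls lam (gG ^ Suc (Suc j) * gF) = cls lam (gG * (gG ^ Suc j * gF))"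
    by (simp add: mult.assoc)
  also have "\<dots> = cls lam (gG * in_free (GF_poly j) * gG ^ j)"
    unfolding mult.assoc by (intro cls_mult_left Suc.IH)
  also have "\<dots> = cls lam (in_free (GF_poly (Suc j)) * gG * gG ^ j)"
    unfolding e[symmetric] by (intro cls_mult_right cls_G_in_free)
  finally show ?case by (simp add: mult.assoc)
qed

lemma parity_G_power: "parity (gG ^ n) = smul ((-1) ^ n) (gG ^ n)"
  and parity_F_power: "parity (gF ^ n) = smul ((-1) ^ n) (gF ^ n)"
  by (induction n) (simp_all add: smul_minus_left smul_minus_right)

text \<open>The polynomial \<open>P'\<close> with \<open>[F, P G\<^bsup>j+1\<^esup>] = P' G\<^sup>j\<close>.\<close>

definition lower :: "nat \<Rightarrow> bipoly \<Rightarrow> bipoly" where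
  "lower j P = subst_lin 1 1 (-1) P * FG_poly + cst ((-1) ^ j) * (P * GF_poly j)"

lemma cls_scomm_F_G_power:
  "cls lam (scomm gF (in_free P * gG ^ Suc j)) = cls lam (in_free (lower j P) * gG ^ j)"
proof -
  have "scomm gF (in_free P * gG ^ Suc j) =
     (gF * in_free P) * gG ^ Suc j + smul ((-1) ^ j) (in_free P * (gG ^ Suc j * gF))"
    unfolding scomm_gF parity_mult parity_G_power
    by (simp add: algebra_simps smul_minus_left)
  also have "cls lam \<dots> = cls lam ((in_free (subst_lin 1 1 (-1) P) * gF) * gG ^ Suc j
      + smul ((-1) ^ j) (in_free P * (in_free (GF_poly j) * gG ^ j)))"
    by (intro cls_add cls_mult cls_smul cls_F_in_free cls_G_power_GF refl)
  also have "\<dots> = cls lam ((in_free (subst_lin 1 1 (-1) P) * in_free FG_poly) * gG ^ j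
      + smul ((-1) ^ j) ((in_free P * in_free (GF_poly j)) * gG ^ j))"
    by (simp add: in_free_FG_poly mult.assoc)
  also have "\<dots> = cls lam (in_free (subst_lin 1 1 (-1) P * FG_poly) * gG ^ j
      + smul ((-1) ^ j) (in_free (P * GF_poly j) * gG ^ j))"
    by (intro cls_add cls_mult cls_smul cls_in_free_mult[symmetric] refl)
  finally show ?thesis by (simp add: lower_def in_free_add distrib_right)
qed

fun lowers :: "nat \<Rightarrow> nat \<Rightarrow> bipoly \<Rightarrow> bipoly" where
  "lowers 0 j P = P"
| "lowers (Suc m) j P = lower j (lowers m (Suc j) P)"

lemma cls_scomm_F_funpow:
  "cls lam ((scomm gF ^^ m) (in_free P * gG ^ (j + m))) = cls lam (in_free (lowers m j P) * gG ^ j)"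
proof (induction m arbitrary: j)
  case (Suc m)
  have "cls lam ((scomm gF ^^ Suc m) (in_free P * gG ^ (j + Suc m))) =
     cls lam (scomm gF (in_free (lowers m (Suc j) P) * gG ^ Suc j))"
    using cls_scomm_gF[OF Suc.IH[of "Suc j"]] by simp
  then show ?case by (simp only: cls_scomm_F_G_power lowers.simps)
qed simp

lemma cls_scomm_F_funpow_cong:
  "cls lam u = cls lam v \<Longrightarrow> cls lam ((scomm gF ^^ m) u) = cls lam ((scomm gF ^^ m) v)"
proof (induction m)
  case (Suc m)
  then show ?case using cls_scomm_gF[of lam "(scomm gF ^^ m) u" "(scomm gF ^^ m) v"] by simp
qed simp

lemma cls_G_power_tau: "cls lam (gG ^ n * gtau) = cls lam (in_free (cst ((-1) ^ n) * vtau) * gG ^ n)"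
proof (induction n)
  case (Suc n)
  have "cls lam (gG ^ Suc n * gtau) = cls lam (gG * (gG ^ n * gtau))" by (simp add: mult.assoc)
  also have "\<dots> = cls lam (smul ((-1) ^ n) ((gG * gtau) * gG ^ n))"
    using cls_mult_left[OF Suc.IH, of gG] by (simp add: mult.assoc)
  also have "\<dots> = cls lam (smul ((-1) ^ n) ((- gtau * gG) * gG ^ n))"
    by (intro cls_smul cls_mult_right cls_Gtau)
  finally show ?case by (simp add: mult.assoc smul_minus_left smul_minus_right)
qed simp

text \<open>The vector \<open>top_poly n\<close> times \<open>G\<^sup>n\<close> is the highest weight vector of weight \<open>n\<close>: \<open>G\<^sup>n\<close> for even
  \<open>n\<close>, and \<open>G\<^sup>n\<tau> = -\<tau>G\<^sup>n\<close> for odd \<open>n\<close>.\<close>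

definition top_poly :: "nat \<Rightarrow> bipoly" where
  "top_poly n = (if even n then 1 else - vtau)"

text \<open>The number of times \<open>ad F\<close> is applied to the highest weight vector in the definition of \<open>f\<^bsub>k,j\<^esub>\<close>.
  For odd \<open>j\<close> it is not monotone in \<open>k\<close>: the sequence is 1, 0, 3, 2, 5, 4 and so on.\<close>

definition ad_steps :: "nat \<Rightarrow> nat \<Rightarrow> nat" where
  "ad_steps k j = (if even j then k else if even k then k + 1 else k - 1)"

lemma ad_F_element_eq:
  "ad_F_element k j = (scomm gF ^^ ad_steps k j)
     (if even (j + ad_steps k j) then gG ^ (j + ad_steps k j) else gG ^ (j + ad_steps k j) * gtau)"
proof -
  let ?top = "\<lambda>n. if even n then gG ^ n else gG ^ n * gtau"
  define m where "m = ad_steps k j"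
  have "ad_F_element k j = (scomm gF ^^ m) (?top (j + m))"
  proof (cases "even j")
    case True
    then show ?thesis by (auto simp: ad_F_element_def m_def ad_steps_def Let_def)
  next
    case False
    then have "j = 2 * (j div 2) + 1" by simp
    show ?thesis
    proof (cases "even k")
      case True
      have "2 * (j div 2) + k + 2 = j + m" using False True by (simp add: m_def ad_steps_def)
      moreover have "ad_F_element k j = (scomm gF ^^ (k + 1)) (gG ^ (2 * (j div 2) + k + 2))"
        using True False by (simp only: ad_F_element_def Let_def if_True if_False)
      moreover have "m = k + 1" "even (j + m)" using True False by (simp_all add: m_def ad_steps_def)
      ultimately show ?thesis by (simp only: if_True)
    next
      case k: False
      then have "k > 0" "j > 0" using False by (auto intro: odd_pos)
      with False k have "2 * (j div 2) + k = j + m" by (simp add: m_def ad_steps_def)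
      then show ?thesis using k False by (simp add: ad_F_element_def m_def ad_steps_def Let_def)
    qed
  qed
  then show ?thesis by (simp only: m_def)
qed

lemma cls_ad_F_element:
  "cls lam (ad_F_element k j) =
     cls lam (in_free (lowers (ad_steps k j) j (top_poly (j + ad_steps k j))) * gG ^ j)"
proof -
  let ?top = "\<lambda>n. if even n then gG ^ n else gG ^ n * gtau"
  define m where "m = ad_steps k j"
  have "cls lam (?top n) = cls lam (in_free (top_poly n) * gG ^ n)" for n
    using cls_G_power_tau[of lam n] by (auto simp: top_poly_def smul_minus_left)
  then have "cls lam ((scomm gF ^^ m) (?top (j + m))) = cls lam ((scomm gF ^^ m) (in_free (top_poly (j + m)) * gG ^ (j + m)))"
    by (intro cls_scomm_F_funpow_cong)
  then show ?thesis by (simp only: ad_F_element_eq cls_scomm_F_funpow m_def)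
qed

text \<open>Existence comes from \<open>lowers\<close> followed by reduction modulo the relation for \<open>\<tau>\<^sup>2\<close>, uniqueness
  from \<open>in_free_G_power_inj\<close>.\<close>

lemma fpoly_props:
  assumes "lam \<noteq> -1/2"
  shows fpoly_CHtau: "fpoly lam k j \<in> CHtau"
    and cls_fpoly: "cls lam (in_free (fpoly lam k j) * gG ^ j) = cls lam (ad_F_element k j)"
    and bival_fpoly: "bival (fpoly lam k j) h (tau_val (lam + 1/2) s) =
       bival (lowers (ad_steps k j) j (top_poly (j + ad_steps k j))) h (tau_val (lam + 1/2) s)"
proof -
  define V where "V = lowers (ad_steps k j) j (top_poly (j + ad_steps k j))"
  obtain Q where Q: "Q \<in> CHtau" "ev lam Q = ev lam V"
    "\<And>h s. bival Q h (tau_val (lam + 1/2) s) = bival V h (tau_val (lam + 1/2) s)" using CHtau_reduce by blast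
  have cQ: "cls lam (in_free Q * gG ^ j) = cls lam (ad_F_element k j)"
    using Q(2) unfolding cls_ad_F_element V_def ev_def by (rule cls_mult_right)
  have "fpoly lam k j = Q"
    unfolding fpoly_def
  proof (rule the_equality)
    fix P assume "P \<in> CHtau \<and> cls lam (in_free P * gG ^ j) = cls lam (ad_F_element k j)"
    then show "P = Q" using cQ by (intro in_free_G_power_inj[OF assms _ Q(1), of _ j]) auto
  qed (use Q(1) cQ in simp)
  then show "fpoly lam k j \<in> CHtau"
    "cls lam (in_free (fpoly lam k j) * gG ^ j) = cls lam (ad_F_element k j)"
    "bival (fpoly lam k j) h (tau_val (lam + 1/2) s) =
       bival (lowers (ad_steps k j) j (top_poly (j + ad_steps k j))) h (tau_val (lam + 1/2) s)"
    using Q cQ by (auto simp: V_def)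
qed

section \<open>Lowering and raising operators on functions\<close>

type_synonym symbol = "complex \<Rightarrow> complex \<Rightarrow> complex"

text \<open>The operator \<open>ad F\<close> from weight \<open>j + 1\<close> to weight \<open>j\<close>, in terms of values.\<close>

definition lower_fun :: "nat \<Rightarrow> symbol \<Rightarrow> symbol" where
  "lower_fun j \<phi> = (\<lambda>h t. (h + 1/2 - t) / 2 * \<phi> (h + 1) (- t) +
     (-1) ^ j * \<phi> h t * ((h - of_nat j - 1/2 + (-1) ^ j * t) / 2))"

text \<open>The operator \<open>ad G\<close> from weight \<open>j\<close> to weight \<open>j + 1\<close>.\<close>

definition raise_fun :: "nat \<Rightarrow> symbol \<Rightarrow> symbol" where
  "raise_fun j \<phi> = (\<lambda>h t. \<phi> (h - 1) (- t) - (-1) ^ j * \<phi> h t)"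

fun lowers_fun :: "nat \<Rightarrow> nat \<Rightarrow> symbol \<Rightarrow> symbol" where
  "lowers_fun 0 j \<phi> = \<phi>"
| "lowers_fun (Suc m) j \<phi> = lower_fun j (lowers_fun m (Suc j) \<phi>)"

lemma bival_lower: "bival (lower j P) = lower_fun j (bival P)"
  by (cases "even j")
    (simp_all add: fun_eq_iff lower_def lower_fun_def FG_poly_def GF_poly_def field_simps)

lemma bival_lowers: "bival (lowers m j P) = lowers_fun m j (bival P)"
  by (induction m arbitrary: j) (simp_all add: bival_lower)

lemma lower_fun_scale: "lower_fun j (\<lambda>h t. a * \<phi> h t) = (\<lambda>h t. a * lower_fun j \<phi> h t)"
  by (simp add: lower_fun_def algebra_simps fun_eq_iff)

text \<open>The relation \<open>(ad G)(ad F) + (ad F)(ad G) = ad H\<close> on weight \<open>j + 1\<close>.\<close>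

lemma raise_lower:
  "raise_fun j (lower_fun j \<phi>) h t + lower_fun (Suc j) (raise_fun (Suc j) \<phi>) h t = of_nat (Suc j) * \<phi> h t"
  by (cases "even j") (simp_all add: raise_fun_def lower_fun_def field_simps)

text \<open>The scalar in \<open>(ad G)(ad F)\<^sup>m x = c (ad F)\<^bsup>m-1\<^esup> x\<close> for a highest weight vector \<open>x\<close> of weight
  \<open>n\<close>. It satisfies \<open>c\<^bsub>m+1\<^esub> = n - m - c\<^sub>m\<close>, \<open>c\<^sub>0 = 0\<close>, which explains its dependence on the parity of \<open>m\<close>.\<close>

definition raise_coeff :: "nat \<Rightarrow> nat \<Rightarrow> complex" where
  "raise_coeff n m = (if even m then - of_nat m / 2 else of_nat n - (of_nat m - 1) / 2)"

lemma raise_lowers_fun: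
  assumes "\<And>h t. raise_fun (j + Suc m) \<phi> h t = 0"
  shows "raise_fun j (lowers_fun (Suc m) j \<phi>) = (\<lambda>h t. raise_coeff (j + Suc m) (Suc m) * lowers_fun m (Suc j) \<phi> h t)"
  using assms
proof (induction m arbitrary: j)
  case 0
  have "lower_fun (Suc j) (raise_fun (Suc j) \<phi>) h t = 0" for h t
    using 0 by (simp add: lower_fun_def)
  then show ?case using raise_lower[of j \<phi>] by (auto simp: fun_eq_iff raise_coeff_def)
next
  case (Suc m)
  define \<psi> where "\<psi> = lowers_fun (Suc m) (Suc j) \<phi>"
  have "raise_fun (Suc j) \<psi> = (\<lambda>h t. raise_coeff (j + Suc (Suc m)) (Suc m) * lowers_fun m (Suc (Suc j)) \<phi> h t)"
    unfolding \<psi>_def using Suc.IH[of "Suc j"] Suc.prems by simp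
  then have "lower_fun (Suc j) (raise_fun (Suc j) \<psi>) = (\<lambda>h t. raise_coeff (j + Suc (Suc m)) (Suc m) * \<psi> h t)"
    by (simp add: lower_fun_scale \<psi>_def)
  then have "raise_fun j (lower_fun j \<psi>) h t = (of_nat (Suc j) - raise_coeff (j + Suc (Suc m)) (Suc m)) * \<psi> h t" for h t
    using raise_lower[of j \<psi> h t] by (simp add: algebra_simps)
  moreover have "of_nat (Suc j) - raise_coeff (j + Suc (Suc m)) (Suc m) = raise_coeff (j + Suc (Suc m)) (Suc (Suc m))"
    by (simp add: raise_coeff_def field_simps)
  ultimately show ?case by (simp add: \<psi>_def fun_eq_iff)
qed

text \<open>This eigenvalue equation is the source of the difference equations in \<open>\<Delta>\<close> and \<open>\<nabla>\<close>.\<close>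

lemma lower_raise_lowers_fun:
  assumes "\<And>h t. raise_fun (j + m) \<phi> h t = 0"
  shows "lower_fun j (raise_fun j (lowers_fun m j \<phi>)) h t = raise_coeff (j + m) m * lowers_fun m j \<phi> h t"
proof (cases m)
  case 0
  then show ?thesis using assms by (simp add: lower_fun_def raise_coeff_def)
next
  case (Suc m')
  then show ?thesis using raise_lowers_fun[of j m' \<phi>] assms by (simp add: lower_fun_scale)
qed

definition top_fun :: "nat \<Rightarrow> symbol" where
  "top_fun n = (\<lambda>h t. if even n then 1 else - t)"

lemma bival_top_poly: "bival (top_poly n) = top_fun n"
  by (simp add: fun_eq_iff top_poly_def top_fun_def)

lemma raise_top_fun: "raise_fun n (top_fun n) h t = 0"
  by (simp add: raise_fun_def top_fun_def)

section \<open>The action of the even part\<close>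

text \<open>The operator \<open>ad F\<^sup>2\<close> from weight \<open>j + 2\<close> to weight \<open>j\<close>. The first coefficient is \<open>F\<^sup>2G\<^sup>2\<close>, the second
  one is \<open>G\<^sup>2F\<^sup>2\<close> moved to the left through \<open>G\<^sup>j\<close>. It does not change \<open>t\<close>, so functions of \<open>t\<close> are scalars
  for it.\<close>

definition lower2_fun :: "nat \<Rightarrow> symbol \<Rightarrow> symbol" where
  "lower2_fun j \<phi> = (\<lambda>h t. (h + 3/2 + t) / 2 * ((h + 1/2 - t) / 2) * \<phi> (h + 2) t -
     (h - of_nat j - 1/2 + (-1) ^ j * t) / 2 * ((h - of_nat j - 3/2 - (-1) ^ j * t) / 2) * \<phi> h t)"

fun lowers2_fun :: "nat \<Rightarrow> nat \<Rightarrow> symbol \<Rightarrow> symbol" where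
  "lowers2_fun 0 j \<phi> = \<phi>"
| "lowers2_fun (Suc r) j \<phi> = lower2_fun j (lowers2_fun r (Suc (Suc j)) \<phi>)"

lemma lower_fun_lower_fun: "lower_fun j (lower_fun (Suc j) \<phi>) = lower2_fun j \<phi>"
  by (cases "even j") (simp_all add: fun_eq_iff lower_fun_def lower2_fun_def field_simps)

lemma lowers_fun_even: "lowers_fun (2 * r) j \<phi> = lowers2_fun r j \<phi>"
  by (induction r arbitrary: j) (simp_all add: lower_fun_lower_fun)

lemma lowers_fun_odd: "lowers_fun (Suc (2 * r)) j \<phi> = lowers2_fun r j (lower_fun (j + 2 * r) \<phi>)"
  by (induction r arbitrary: j) (simp_all add: lower_fun_lower_fun)

lemma lower2_fun_scale: "lower2_fun j (\<lambda>h t. a t * \<phi> h t) = (\<lambda>h t. a t * lower2_fun j \<phi> h t)"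
  by (simp add: lower2_fun_def algebra_simps fun_eq_iff)

lemma lowers2_fun_scale: "lowers2_fun r j (\<lambda>h t. a t * \<phi> h t) = (\<lambda>h t. a t * lowers2_fun r j \<phi> h t)"
  by (induction r arbitrary: j) (simp_all add: lower2_fun_scale)

text \<open>The function that represents \<open>(ad F\<^sup>2)\<^sup>r (G\<^bsup>j+2r\<^esup>)\<close>.\<close>

definition hahn_fun :: "nat \<Rightarrow> nat \<Rightarrow> symbol" where
  "hahn_fun r j = lowers2_fun r j (\<lambda>h t. 1)"

lemma hahn_fun_0: "hahn_fun 0 j = (\<lambda>h t. 1)"
  and hahn_fun_Suc: "hahn_fun (Suc r) j = lower2_fun j (hahn_fun r (Suc (Suc j)))"
  by (simp_all add: hahn_fun_def)

text \<open>Going down by \<open>ad F\<^sup>2\<close> as often as possible leaves at most one application of \<open>ad F\<close>, to \<open>G\<^sup>n\<close> or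
  \<open>G\<^sup>n\<tau>\<close>; the result is a power of \<open>G\<close>
  times this function of \<open>t\<close>.\<close>

definition fpoly_factor :: "nat \<Rightarrow> nat \<Rightarrow> complex \<Rightarrow> complex" where
  "fpoly_factor k j t = (if even j then (if even k then 1 else (of_nat (k + j) * t - 2 * t ^ 2) / 2)
     else (if even k then of_nat (k + j + 1) / 2 else - t))"

lemma lowers_fun_top_fun:
  "lowers_fun (ad_steps k j) j (top_fun (j + ad_steps k j)) = (\<lambda>h t. fpoly_factor k j t * hahn_fun (k div 2) j h t)"
proof -
  consider (ee) r where "even j" "k = 2 * r" | (eo) r where "even j" "k = Suc (2 * r)"
    | (oe) r where "odd j" "k = 2 * r" | (oo) r where "odd j" "k = Suc (2 * r)"
    by (metis evenE oddE Suc_eq_plus1)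
  then show ?thesis
  proof cases
    case ee
    then show ?thesis by (simp add: ad_steps_def top_fun_def lowers_fun_even hahn_fun_def fpoly_factor_def)
  next
    case eo
    have "lower_fun (j + 2 * r) (\<lambda>h t. - t) = (\<lambda>h t. fpoly_factor k j t * 1)"
      using eo by (simp add: lower_fun_def fpoly_factor_def field_simps fun_eq_iff power2_eq_square)
    then show ?thesis using eo lowers2_fun_scale[of r j "fpoly_factor k j" "\<lambda>h t. 1"]
      by (simp add: ad_steps_def top_fun_def lowers_fun_odd hahn_fun_def del: lowers_fun.simps)
  next
    case oe
    have "lower_fun (j + 2 * r) (\<lambda>h t. 1) = (\<lambda>h t. fpoly_factor k j t * 1)"
      using oe by (simp add: lower_fun_def fpoly_factor_def field_simps fun_eq_iff)
    then show ?thesis using oe lowers2_fun_scale[of r j "fpoly_factor k j" "\<lambda>h t. 1"]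
      by (simp add: ad_steps_def top_fun_def lowers_fun_odd hahn_fun_def del: lowers_fun.simps)
  next
    case oo
    then show ?thesis using lowers2_fun_scale[of r j uminus "\<lambda>h t. 1"]
      by (simp add: ad_steps_def top_fun_def lowers_fun_even hahn_fun_def fpoly_factor_def)
  qed
qed

text \<open>The operator \<open>ad G\<^sup>2\<close>.\<close>

definition raise2_fun :: "symbol \<Rightarrow> symbol" where
  "raise2_fun \<phi> = (\<lambda>h t. \<phi> (h - 2) t - \<phi> h t)"

text \<open>The relation \<open>[G\<^sup>2, F\<^sup>2] = -H\<close>, acting on weight \<open>j + 2\<close>.\<close>

lemma raise2_lower2_fun: "raise2_fun (lower2_fun j \<phi>) h t = lower2_fun (Suc (Suc j)) (raise2_fun \<phi>) h t - of_nat (Suc (Suc j)) * \<phi> h t"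
  by (cases "even j") (simp_all add: raise2_fun_def lower2_fun_def field_simps)

lemma raise2_fun_hahn_fun:
  "raise2_fun (hahn_fun (Suc r) j) = (\<lambda>h t. - (of_nat (Suc r) * of_nat (j + r + 2)) * hahn_fun r (Suc (Suc j)) h t)"
proof (induction r arbitrary: j)
  case 0
  show ?case
    by (simp add: fun_eq_iff hahn_fun_Suc raise2_lower2_fun) (simp add: hahn_fun_0 lower2_fun_def raise2_fun_def)
next
  case (Suc r)
  have "lower2_fun (Suc (Suc j)) (raise2_fun (hahn_fun (Suc r) (Suc (Suc j)))) =
      (\<lambda>h t. - (of_nat (Suc r) * of_nat (Suc (Suc j) + r + 2)) * hahn_fun (Suc r) (Suc (Suc j)) h t)"
    unfolding Suc.IH by (subst lower2_fun_scale) (simp add: hahn_fun_Suc)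
  then show ?case
    by (simp add: fun_eq_iff hahn_fun_Suc[of "Suc r"] raise2_lower2_fun) (simp add: algebra_simps)
qed

text \<open>This eigenvalue equation is the source of the difference equations in \<open>\<Delta>\<^sub>2\<close> and \<open>\<nabla>\<^sub>2\<close>. It needs only
  \<open>[G\<^sup>2, G\<^sup>n] = 0\<close>, hence holds for both parities of \<open>j\<close>.\<close>

lemma lower2_raise2_hahn_fun:
  "lower2_fun j (raise2_fun (hahn_fun r j)) h t = - (of_nat r * of_nat (j + r + 1)) * hahn_fun r j h t"
proof (cases r)
  case 0
  then show ?thesis by (simp add: hahn_fun_0 raise2_fun_def lower2_fun_def)
next
  case (Suc r')
  then show ?thesis unfolding Suc raise2_fun_hahn_fun by (subst lower2_fun_scale) (simp add: hahn_fun_Suc)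
qed

section \<open>Closed form of the iterates\<close>

text \<open>The coefficient \<open>(-k)\<^sub>s (k + N - 1)\<^sub>s / s!\<close> of the hypergeometric sum, where \<open>N = j + 2\<close>.\<close>

definition hahn_coeff :: "nat \<Rightarrow> complex \<Rightarrow> nat \<Rightarrow> complex" where
  "hahn_coeff k N s = pochhammer (- of_nat k) s * pochhammer (of_nat k + N - 1) s / fact s"

lemma hahn_coeff_0 [simp]: "hahn_coeff k N 0 = 1"
  by (simp add: hahn_coeff_def)

lemma hahn_coeff_Suc: "hahn_coeff (Suc k) N (Suc s) = hahn_coeff k (N + 2) (Suc s) - (N + of_nat s) * hahn_coeff k (N + 2) s"
proof -
  define u where "u = pochhammer (- of_nat k :: complex) s"
  define v where "v = pochhammer (of_nat k + N + 1) s"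
  have 1: "pochhammer (- of_nat (Suc k)) (Suc s) = - of_nat (Suc k) * u"
    by (simp add: pochhammer_rec u_def)
  have 2: "pochhammer (of_nat (Suc k) + N - 1) (Suc s) = (of_nat k + N) * v"
    by (simp add: pochhammer_rec v_def add_ac)
  have 3: "pochhammer (- of_nat k :: complex) (Suc s) = (of_nat s - of_nat k) * u"
    by (simp add: pochhammer_rec' u_def)
  have 4: "pochhammer (of_nat k + (N + 2) - 1) (Suc s) = (of_nat k + N + 1 + of_nat s) * v"
    by (simp add: pochhammer_rec' v_def add_ac)
  have 5: "of_nat k + (N + 2) - 1 = of_nat k + N + 1" by simp
  have "hahn_coeff (Suc k) N (Suc s) = - of_nat (Suc k) * (of_nat k + N) / of_nat (Suc s) * (u * v / fact s)"
    unfolding hahn_coeff_def 1 2 by simp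
  also have "\<dots> = ((of_nat s - of_nat k) * (of_nat k + N + 1 + of_nat s) / of_nat (Suc s)
      - (N + of_nat s)) * (u * v / fact s)"
  proof (intro arg_cong2[of _ _ _ _ "(*)"] refl)
    define m where "m = (of_nat (Suc s) :: complex)"
    have "m \<noteq> 0" unfolding m_def by (rule of_nat_neq_0)
    moreover have s: "of_nat s = m - 1" by (simp add: m_def)
    ultimately show "- of_nat (Suc k) * (of_nat k + N) / of_nat (Suc s) =
        (of_nat s - of_nat k) * (of_nat k + N + 1 + of_nat s) / of_nat (Suc s) - (N + of_nat s)"
      unfolding m_def[symmetric] s by (simp add: field_simps)
  qed
  also have "\<dots> = hahn_coeff k (N + 2) (Suc s) - (N + of_nat s) * hahn_coeff k (N + 2) s"
    unfolding hahn_coeff_def 3 4 unfolding 5 u_def[symmetric] v_def[symmetric] fact_Suc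
    by (simp add: field_simps del: of_nat_Suc)
  finally show ?thesis .
qed

lemma hahn_coeff_eq_0: "hahn_coeff k N (Suc k) = 0"
  by (simp add: hahn_coeff_def pochhammer_of_nat_eq_0_lemma)

text \<open>The variable \<open>A\<close>, for even and odd \<open>j\<close> at once. It is chosen such that \<open>-A\<close> is a factor of the
  second coefficient of \<open>lower2_fun\<close> and that \<open>A\<close> at level \<open>j + 2\<close> is \<open>A + 1\<close> at level \<open>j\<close>.\<close>

definition hahn_arg :: "nat \<Rightarrow> symbol" where
  "hahn_arg j = (\<lambda>h t. (of_nat j + 1/2 + of_bool (odd j) - t - h) / 2)"

text \<open>With \<open>hahn_q\<close>, the denominator parameters: the first coefficient of \<open>lower2_fun\<close> is
  \<open>(hahn_p - A)(hahn_q - A)\<close>.\<close>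

definition hahn_p :: "nat \<Rightarrow> complex \<Rightarrow> complex" where
  "hahn_p j t = (of_nat j + 1 + of_bool (odd j)) / 2 - t"

definition hahn_q :: "nat \<Rightarrow> complex" where
  "hahn_q j = (of_nat j + 2 + of_bool (odd j)) / 2"

text \<open>Both terms of \<open>lower2_fun\<close> contain \<open>(A)\<^sub>s\<close>; in the remaining factor the terms quadratic in \<open>A\<close>
  cancel, and a linear polynomial in \<open>A\<close> is a combination of \<open>1\<close> and \<open>A + s\<close>.\<close>

lemma lower2_fun_pochhammer:
  "lower2_fun j (\<lambda>h t. pochhammer (hahn_arg (Suc (Suc j)) h t) s) h t =
     (hahn_p j t + of_nat s) * (hahn_q j + of_nat s) * pochhammer (hahn_arg j h t) s
       - (of_nat j + 2 + of_nat s) * pochhammer (hahn_arg j h t) (Suc s)"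
proof -
  define A where "A = hahn_arg j h t"
  have sh: "hahn_arg (Suc (Suc j)) h t = A + 1" "hahn_arg (Suc (Suc j)) (h + 2) t = A"
    by (simp_all add: A_def hahn_arg_def field_simps)
  have h: "h = of_nat j + 1/2 + of_bool (odd j) - t - 2 * A"
    by (cases "even j") (simp_all add: A_def hahn_arg_def field_simps)
  have p1: "A * pochhammer (A + 1) s = pochhammer A (Suc s)"
    by (simp add: pochhammer_rec)
  have p2: "pochhammer A (Suc s) = (A + of_nat s) * pochhammer A s"
    by (simp add: pochhammer_rec')
  \<comment> \<open>the cofactor of \<open>A\<close> in the second coefficient of \<open>lower2_fun\<close>\<close>
  define B where "B = (if even j then 1/2 + t + A else A + t - 1/2)"
  have b: "(h - of_nat j - 1/2 + (-1) ^ j * t) / 2 * ((h - of_nat j - 3/2 - (-1) ^ j * t) / 2) = A * B"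
    by (cases "even j") (simp_all add: h B_def field_simps)
  have a: "(h + 3/2 + t) / 2 * ((h + 1/2 - t) / 2) = (hahn_q j - A) * (hahn_p j t - A)"
    by (cases "even j") (simp_all add: h hahn_q_def hahn_p_def field_simps)
  have "lower2_fun j (\<lambda>h t. pochhammer (hahn_arg (Suc (Suc j)) h t) s) h t =
      (hahn_q j - A) * (hahn_p j t - A) * pochhammer A s - B * (A * pochhammer (A + 1) s)"
    unfolding lower2_fun_def sh a b by (simp add: algebra_simps)
  also have "\<dots> = ((hahn_q j - A) * (hahn_p j t - A) - B * (A + of_nat s)) * pochhammer A s"
    unfolding p1 p2 by (simp add: algebra_simps)
  also have "(hahn_q j - A) * (hahn_p j t - A) - B * (A + of_nat s) =
      (hahn_p j t + of_nat s) * (hahn_q j + of_nat s) - (of_nat j + 2 + of_nat s) * (A + of_nat s)"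
    by (cases "even j") (simp_all add: hahn_q_def hahn_p_def B_def field_simps)
  finally show ?thesis
    unfolding A_def[symmetric] p2 by (simp add: algebra_simps)
qed

lemma lower2_fun_sum: "lower2_fun j (\<lambda>h t. \<Sum>s\<in>S. \<phi> s h t) h t = (\<Sum>s\<in>S. lower2_fun j (\<phi> s) h t)"
  by (simp add: lower2_fun_def sum_distrib_left sum_subtractf)

text \<open>The denominators \<open>(p)\<^sub>s (q)\<^sub>s\<close> of the hypergeometric terms are already cancelled against the
  prefactor \<open>(p)\<^sub>k (q)\<^sub>k\<close>, so that the formula also holds where they vanish.\<close>

theorem hahn_fun_closed:
  "hahn_fun k j h t = (\<Sum>s\<le>k. hahn_coeff k (of_nat j + 2) s * pochhammer (hahn_p j t + of_nat s) (k - s) *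
     pochhammer (hahn_q j + of_nat s) (k - s) * pochhammer (hahn_arg j h t) s)"
proof (induction k arbitrary: j h t)
  case 0
  show ?case by (simp add: hahn_fun_0)
next
  case (Suc k)
  define p q N where "p = hahn_p j t" and "q = hahn_q j" and "N = (of_nat j + 2 :: complex)"
  define A where "A = pochhammer (hahn_arg j h t)"
  have pq: "hahn_p (Suc (Suc j)) t' = hahn_p j t' + 1" "hahn_q (Suc (Suc j)) = hahn_q j + 1" for t'
    by (simp_all add: hahn_p_def hahn_q_def field_simps)
  have N2: "of_nat (Suc (Suc j)) + 2 = N + 2" by (simp add: N_def)
  define C where "C s t = hahn_coeff k (N + 2) s * pochhammer (hahn_p j t + 1 + of_nat s) (k - s) *
       pochhammer (hahn_q j + 1 + of_nat s) (k - s)" for s t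
  have rec: "pochhammer (x + of_nat s) (Suc k - s) = (x + of_nat s) * pochhammer (x + 1 + of_nat s) (k - s)"
    if "s \<le> k" for x :: complex and s
    using that by (simp add: Suc_diff_le pochhammer_rec add_ac)
  define a where "a s = hahn_coeff k (N + 2) s * pochhammer (p + of_nat s) (Suc k - s) * pochhammer (q + of_nat s) (Suc k - s) * A s" for s
  have "hahn_fun (Suc k) j h t = lower2_fun j (\<lambda>h t. \<Sum>s\<le>k. C s t * pochhammer (hahn_arg (Suc (Suc j)) h t) s) h t"
    unfolding hahn_fun_Suc by (intro arg_cong[of _ _ "\<lambda>f. lower2_fun j f h t"] ext)
      (simp only: Suc.IH pq N2 C_def)
  also have "\<dots> = (\<Sum>s\<le>k. C s t * ((p + of_nat s) * (q + of_nat s) * A s - (N + of_nat s) * A (Suc s)))"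
    unfolding lower2_fun_sum lower2_fun_scale lower2_fun_pochhammer p_def q_def A_def N_def ..
  also have "\<dots> = (\<Sum>s\<le>k. a s) - (\<Sum>s\<le>k. C s t * (N + of_nat s) * A (Suc s))"
    unfolding sum_subtractf[symmetric]
  proof (rule sum.cong)
    fix s assume "s \<in> {..k}"
    then have s: "s \<le> k" by simp
    show "C s t * ((p + of_nat s) * (q + of_nat s) * A s - (N + of_nat s) * A (Suc s)) =
        a s - C s t * (N + of_nat s) * A (Suc s)"
      unfolding a_def rec[OF s] C_def p_def[symmetric] q_def[symmetric] by (simp only: algebra_simps)
  qed simp
  \<comment> \<open>the added term vanishes because of \<open>(-k)\<^bsub>k+1\<^esub> = 0\<close>\<close>
  also have "(\<Sum>s\<le>k. a s) = (\<Sum>s\<le>Suc k. a s)"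
    by (simp add: a_def hahn_coeff_eq_0)
  also have "\<dots> = a 0 + (\<Sum>s\<le>k. a (Suc s))"
    by (rule sum.atMost_Suc_shift)
  also have "a 0 + (\<Sum>s\<le>k. a (Suc s)) - (\<Sum>s\<le>k. C s t * (N + of_nat s) * A (Suc s)) =
      a 0 + (\<Sum>s\<le>k. hahn_coeff (Suc k) N (Suc s) * pochhammer (p + of_nat (Suc s)) (Suc k - Suc s) *
         pochhammer (q + of_nat (Suc s)) (Suc k - Suc s) * A (Suc s))"
    unfolding add_diff_eq[symmetric] sum_subtractf[symmetric]
    by (intro arg_cong2[of _ _ _ _ "(+)"] sum.cong refl)
      (simp add: a_def hahn_coeff_Suc C_def p_def q_def algebra_simps)
  also have "\<dots> = (\<Sum>s\<le>Suc k. hahn_coeff (Suc k) N s * pochhammer (p + of_nat s) (Suc k - s) *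
         pochhammer (q + of_nat s) (Suc k - s) * A s)"
    unfolding sum.atMost_Suc_shift[of _ k] by (simp add: a_def)
  finally show ?case by (simp add: p_def q_def N_def A_def)
qed

section \<open>Difference equations\<close>

lemma bival_fpoly_eq:
  assumes "lam \<noteq> -1/2" "t = lam + 1/2 \<or> t = - (lam + 1/2)"
  shows "bival (fpoly lam k j) h t = lowers_fun (ad_steps k j) j (top_fun (j + ad_steps k j)) h t" (is ?A)
    and "bival (fpoly lam k j) h t = fpoly_factor k j t * hahn_fun (k div 2) j h t" (is ?B)
proof -
  obtain s where "t = tau_val (lam + 1/2) s"
    using assms(2) that[of True] that[of False] by (auto simp: tau_val_def)
  then show ?A by (simp add: bival_fpoly[OF assms(1)] bival_lowers bival_top_poly)
  then show ?B by (simp add: lowers_fun_top_fun)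
qed

text \<open>\<open>ev_eqI\<close> with the two values of \<open>\<tau>\<close> spelt out, a hypothesis that is stable under \<open>t \<mapsto> -t\<close>.\<close>

lemma ev_eqI_roots:
  fixes k j :: nat
  assumes lam: "lam \<noteq> -1/2"
    and "\<And>h t. t = lam + 1/2 \<or> t = - (lam + 1/2) \<Longrightarrow> bival P h t = bival Q h t"
  shows "ev lam P = ev lam Q"
  by (rule ev_eqI[OF lam]) (use assms(2) in \<open>auto simp: tau_val_def\<close>)

text \<open>Writing out \<open>lower_raise_lowers_fun\<close>: in even weight \<open>ad G\<close> is \<open>P \<mapsto> -\<nabla>P\<close>, and \<open>ad F\<close> contributes
  the values of \<open>\<nabla>P\<close> at the given and at the shifted point.\<close>

lemma fpoly_even_first_order:
  assumes lam: "lam \<noteq> -1/2"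
  defines "f \<equiv> \<lambda>i k. fpoly lam k (2 * i)"
  shows "ev lam ((vH - vtau + cst (1/2)) * fwd (bwd (f i k))
               + cst 2 * (vH - cst (of_nat i)) * bwd (f i k)
               + cst (2 * of_nat i + 1/2) * f i k)
        = ev lam (cst ((-1) ^ k * (2 * of_nat i + of_nat k + 1/2)) * f i k)"
proof (rule ev_eqI_roots[OF lam])
  fix h t assume t: "t = lam + 1/2 \<or> t = - (lam + 1/2)"
  then have t': "- t = lam + 1/2 \<or> - t = - (lam + 1/2)" by auto
  define \<Phi> where "\<Phi> = lowers_fun k (2 * i) (top_fun (2 * i + k))"
  have b: "bival (f i k) h' t = \<Phi> h' t" "bival (f i k) h' (- t) = \<Phi> h' (- t)" for h'
    using bival_fpoly_eq(1)[OF lam t, of k "2 * i"] bival_fpoly_eq(1)[OF lam t', of k "2 * i"]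
    by (simp_all add: f_def \<Phi>_def ad_steps_def)
  define X Y Z where "X = \<Phi> (h + 1) (- t)" and "Y = \<Phi> h t" and "Z = \<Phi> (h - 1) (- t)"
  have main: "(h + 1/2 - t) / 2 * (Y - X) + (Z - Y) * ((h - of_nat (2 * i) - 1/2 + t) / 2) = raise_coeff (2 * i + k) k * Y"
    using lower_raise_lowers_fun[of "2 * i" k "top_fun (2 * i + k)" h t, OF raise_top_fun]
    unfolding \<Phi>_def[symmetric] by (simp add: lower_fun_def raise_fun_def X_def Y_def Z_def)
  have "(h - t + 1/2) * (X - Y - (Y - Z)) + 2 * (h - of_nat i) * (Y - Z) + (2 * of_nat i + 1/2) * Y
      - (-1) ^ k * (2 * of_nat i + of_nat k + 1/2) * Y =
      - 2 * ((h + 1/2 - t) / 2 * (Y - X) + (Z - Y) * ((h - of_nat (2 * i) - 1/2 + t) / 2) - raise_coeff (2 * i + k) k * Y)"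
    by (cases "even k") (simp_all add: raise_coeff_def field_simps)
  then have "(h - t + 1/2) * (X - Y - (Y - Z)) + 2 * (h - of_nat i) * (Y - Z) + (2 * of_nat i + 1/2) * Y
      = (-1) ^ k * (2 * of_nat i + of_nat k + 1/2) * Y"
    unfolding main by simp
  then show "bival ((vH - vtau + cst (1/2)) * fwd (bwd (f i k))
               + cst 2 * (vH - cst (of_nat i)) * bwd (f i k)
               + cst (2 * of_nat i + 1/2) * f i k) h t
        = bival (cst ((-1) ^ k * (2 * of_nat i + of_nat k + 1/2)) * f i k) h t"
    by (simp add: fwd_def bwd_def b X_def Y_def Z_def)
qed

text \<open>In odd weight \<open>ad G\<close> is \<open>P \<mapsto> 2P - \<nabla>P\<close> instead of \<open>P \<mapsto> -\<nabla>P\<close>, which accounts for the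
  differences from the even case.\<close>

lemma fpoly_odd_first_order:
  assumes lam: "lam \<noteq> -1/2"
  defines "f \<equiv> \<lambda>i k. fpoly lam k (2 * i + 1)"
  shows "ev lam ((vH - vtau + cst (1/2)) * fwd (bwd (f i k))
               + cst 2 * (vH - vtau - cst (of_nat i) - cst (1/2)) * bwd (f i k)
               + cst (2 * of_nat i + 5/2) * f i k)
        = ev lam (cst (if even k then 2 * of_nat i + of_nat k + 5/2
                                else - (2 * of_nat i + of_nat k + 1/2)) * f i k)"
    (is "ev lam ?L = ev lam (cst ?e * _)")
proof (rule ev_eqI_roots[OF lam])
  fix h t assume t: "t = lam + 1/2 \<or> t = - (lam + 1/2)"
  then have t': "- t = lam + 1/2 \<or> - t = - (lam + 1/2)" by auto
  define m where "m = ad_steps k (2 * i + 1)"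
  define \<Phi> where "\<Phi> = lowers_fun m (2 * i + 1) (top_fun (2 * i + 1 + m))"
  have b: "bival (f i k) h' t = \<Phi> h' t" "bival (f i k) h' (- t) = \<Phi> h' (- t)" for h'
    using bival_fpoly_eq(1)[OF lam t, of k "2 * i + 1"] bival_fpoly_eq(1)[OF lam t', of k "2 * i + 1"]
    by (simp_all add: f_def \<Phi>_def m_def)
  define X Y Z where "X = \<Phi> (h + 1) (- t)" and "Y = \<Phi> h t" and "Z = \<Phi> (h - 1) (- t)"
  have main: "(h + 1/2 - t) / 2 * (Y + X) + (- Z - Y) * ((h - of_nat (2 * i + 1) - 1/2 - t) / 2) = raise_coeff (2 * i + 1 + m) m * Y"
    using lower_raise_lowers_fun[of "2 * i + 1" m "top_fun (2 * i + 1 + m)" h t, OF raise_top_fun]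
    unfolding \<Phi>_def[symmetric] by (simp add: lower_fun_def raise_fun_def X_def Y_def Z_def)
  have e: "?e = 2 * raise_coeff (2 * i + 1 + m) m - 2 * of_nat i - 3/2"
    by (auto simp: m_def ad_steps_def raise_coeff_def field_simps of_nat_diff elim!: oddE)
  have "(h - t + 1/2) * (X - Y - (Y - Z)) + 2 * (h - t - of_nat i - 1/2) * (Y - Z) + (2 * of_nat i + 5/2) * Y
      - (2 * raise_coeff (2 * i + 1 + m) m - 2 * of_nat i - 3/2) * Y =
      2 * ((h + 1/2 - t) / 2 * (Y + X) + (- Z - Y) * ((h - of_nat (2 * i + 1) - 1/2 - t) / 2) - raise_coeff (2 * i + 1 + m) m * Y)"
    by (simp add: field_simps)
  then have "(h - t + 1/2) * (X - Y - (Y - Z)) + 2 * (h - t - of_nat i - 1/2) * (Y - Z) + (2 * of_nat i + 5/2) * Y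
      = ?e * Y"
    unfolding main e by simp
  then show "bival ?L h t = bival (cst ?e * f i k) h t"
    by (simp add: fwd_def bwd_def b X_def Y_def Z_def)
qed

text \<open>Both parities of \<open>j\<close> at once; the factor \<open>fpoly_factor\<close> depends on \<open>t\<close> only and is not seen by
  \<open>\<Delta>\<^sub>2\<close> and \<open>\<nabla>\<^sub>2\<close>.\<close>

lemma fpoly_second_order:
  fixes k j :: nat
  assumes lam: "lam \<noteq> -1/2" and t: "t = lam + 1/2 \<or> t = - (lam + 1/2)"
  defines "f \<equiv> bival (fpoly lam k j)"
  shows "((h + 1)^2 - (t + 1/2)^2) * (f (h + 2) t - f h t - (f h t - f (h - 2) t)) +
      ((h + 1)^2 - (t + 1/2)^2 - ((h - of_nat j - 1)^2 - (1/2 + (-1) ^ j * t)^2)) * (f h t - f (h - 2) t)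
      = 4 * of_nat (k div 2) * (of_nat j + of_nat (k div 2) + 1) * f h t"
proof -
  define r where "r = k div 2"
  define E where "E = hahn_fun r j"
  define X Y Z where "X = E (h + 2) t" and "Y = E h t" and "Z = E (h - 2) t"
  have b: "f h' t = fpoly_factor k j t * E h' t" for h'
    using bival_fpoly_eq(2)[OF lam t] by (simp add: f_def E_def r_def)
  have main: "(h + 3/2 + t) / 2 * ((h + 1/2 - t) / 2) * (Y - X) -
     (h - of_nat j - 1/2 + (-1) ^ j * t) / 2 * ((h - of_nat j - 3/2 - (-1) ^ j * t) / 2) * (Z - Y)
     = - (of_nat r * of_nat (j + r + 1)) * Y"
    using lower2_raise2_hahn_fun[of j r h t]
    unfolding E_def[symmetric] by (simp add: lower2_fun_def raise2_fun_def X_def Y_def Z_def)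
  have "((h + 1)^2 - (t + 1/2)^2) * (X - Y - (Y - Z)) +
      ((h + 1)^2 - (t + 1/2)^2 - ((h - of_nat j - 1)^2 - (1/2 + (-1) ^ j * t)^2)) * (Y - Z)
      - 4 * of_nat r * (of_nat j + of_nat r + 1) * Y =
    - 4 * (((h + 3/2 + t) / 2 * ((h + 1/2 - t) / 2) * (Y - X) -
     (h - of_nat j - 1/2 + (-1) ^ j * t) / 2 * ((h - of_nat j - 3/2 - (-1) ^ j * t) / 2) * (Z - Y))
     - (- (of_nat r * of_nat (j + r + 1)) * Y))"
    by (cases "even j") (simp_all add: field_simps power2_eq_square)
  then have "((h + 1)^2 - (t + 1/2)^2) * (X - Y - (Y - Z)) +
      ((h + 1)^2 - (t + 1/2)^2 - ((h - of_nat j - 1)^2 - (1/2 + (-1) ^ j * t)^2)) * (Y - Z)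
      = 4 * of_nat r * (of_nat j + of_nat r + 1) * Y"
    unfolding main by simp
  then have "fpoly_factor k j t * (((h + 1)^2 - (t + 1/2)^2) * (X - Y - (Y - Z)) +
      ((h + 1)^2 - (t + 1/2)^2 - ((h - of_nat j - 1)^2 - (1/2 + (-1) ^ j * t)^2)) * (Y - Z))
      = fpoly_factor k j t * (4 * of_nat r * (of_nat j + of_nat r + 1) * Y)"
    by (rule arg_cong)
  then show ?thesis
    unfolding b X_def[symmetric] Y_def[symmetric] Z_def[symmetric] r_def[symmetric]
    by (simp add: algebra_simps)
qed

text \<open>The equation for \<open>f(-H)\<close> is the one for \<open>f\<close> at \<open>-H\<close>, since the reflection turns \<open>\<nabla>\<^sub>2\<close> into \<open>-\<Delta>\<^sub>2\<close>.\<close>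

lemma fpoly_even_second_order:
  fixes i k :: nat
  assumes lam: "lam \<noteq> -1/2"
  defines "f \<equiv> fpoly lam k (2 * i)" and "g \<equiv> reflect_H (fpoly lam k (2 * i))"
    and "e \<equiv> (if even k then (2 * of_nat i + of_nat k) * (2 * of_nat i + of_nat k + 2)
               else (2 * of_nat i + of_nat k - 1) * (2 * of_nat i + of_nat k + 1))"
  shows "ev lam (((vH + cst 1) ^ 2 - (vtau + cst (1/2)) ^ 2) * fwd2 (bwd2 f)
               + cst (4 * (of_nat i + 1)) * (vH - cst (of_nat i)) * bwd2 f
               + cst (4 * of_nat i * (of_nat i + 1)) * f)
        = ev lam (cst e * f)" (is "ev lam ?L = _")
    and "ev lam (((vH - cst 1) ^ 2 - (vtau + cst (1/2)) ^ 2) * fwd2 (bwd2 g)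
               + cst (4 * (of_nat i + 1)) * (vH + cst (of_nat i)) * fwd2 g
               + cst (4 * of_nat i * (of_nat i + 1)) * g)
        = ev lam (cst e * g)" (is "ev lam ?R = _")
proof -
  have *: "((h + 1)^2 - (t + 1/2)^2) * (bival f (h + 2) t - bival f h t - (bival f h t - bival f (h - 2) t)) +
      4 * (of_nat i + 1) * (h - of_nat i) * (bival f h t - bival f (h - 2) t)
      + 4 * of_nat i * (of_nat i + 1) * bival f h t = e * bival f h t"
    if "t = lam + 1/2 \<or> t = - (lam + 1/2)" for h t
  proof -
    have e: "e = 4 * of_nat (k div 2) * (of_nat (2 * i) + of_nat (k div 2) + 1) + 4 * of_nat i * (of_nat i + 1)"
      by (cases "even k") (auto simp: e_def field_simps elim!: evenE oddE)
    have d: "(h + 1)^2 - (t + 1/2)^2 - ((h - of_nat (2 * i) - 1)^2 - (1/2 + (-1) ^ (2 * i) * t)^2)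
        = 4 * (of_nat i + 1) * (h - of_nat i)"
      by (simp add: field_simps power2_eq_square)
    show ?thesis
      using fpoly_second_order[OF lam that, of h k "2 * i"] unfolding f_def[symmetric] d e by (simp only: distrib_right)
  qed
  show "ev lam ?L = ev lam (cst e * f)"
  proof (rule ev_eqI_roots[OF lam])
    fix h t assume "t = lam + 1/2 \<or> t = - (lam + 1/2)"
    from *[OF this, of h] show "bival ?L h t = bival (cst e * f) h t"
      by (simp add: fwd2_def bwd2_def)
  qed
  have g: "bival g h t = bival f (- h) t" for h t
    by (simp add: g_def f_def reflect_H_def)
  show "ev lam ?R = ev lam (cst e * g)"
  proof (rule ev_eqI_roots[OF lam])
    fix h t assume "t = lam + 1/2 \<or> t = - (lam + 1/2)"
    from *[OF this, of "- h"] show "bival ?R h t = bival (cst e * g) h t"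
      by (simp add: fwd2_def bwd2_def g) (simp add: algebra_simps power2_eq_square)
  qed
qed

lemma fpoly_odd_second_order:
  fixes i k :: nat
  assumes lam: "lam \<noteq> -1/2"
  defines "f \<equiv> fpoly lam k (2 * i + 1)" and "g \<equiv> reflect_H (fpoly lam k (2 * i + 1))"
    and "e \<equiv> (if even k then (2 * of_nat i + of_nat k + 1) * (2 * of_nat i + of_nat k + 3)
               else (2 * of_nat i + of_nat k) * (2 * of_nat i + of_nat k + 2))"
  shows "ev lam (((vH + cst 1) ^ 2 - (vtau + cst (1/2)) ^ 2) * fwd2 (bwd2 f)
               + (cst (2 * of_nat i + 3) * (cst 2 * vH - cst (2 * of_nat i) - cst 1)
                    - cst 2 * vtau) * bwd2 f
               + cst ((2 * of_nat i + 1) * (2 * of_nat i + 3)) * f)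
        = ev lam (cst e * f)" (is "ev lam ?L = _")
    and "ev lam (((vH - cst 1) ^ 2 - (vtau + cst (1/2)) ^ 2) * fwd2 (bwd2 g)
               + (cst (2 * of_nat i + 3) * (cst 2 * vH + cst (2 * of_nat i) + cst 1)
                    + cst 2 * vtau) * fwd2 g
               + cst ((2 * of_nat i + 1) * (2 * of_nat i + 3)) * g)
        = ev lam (cst e * g)" (is "ev lam ?R = _")
proof -
  have *: "((h + 1)^2 - (t + 1/2)^2) * (bival f (h + 2) t - bival f h t - (bival f h t - bival f (h - 2) t)) +
      ((2 * of_nat i + 3) * (2 * h - 2 * of_nat i - 1) - 2 * t) * (bival f h t - bival f (h - 2) t)
      + (2 * of_nat i + 1) * (2 * of_nat i + 3) * bival f h t = e * bival f h t"
    if "t = lam + 1/2 \<or> t = - (lam + 1/2)" for h t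
  proof -
    have e: "e = 4 * of_nat (k div 2) * (of_nat (2 * i + 1) + of_nat (k div 2) + 1) + (2 * of_nat i + 1) * (2 * of_nat i + 3)"
      by (cases "even k") (auto simp: e_def field_simps elim!: evenE oddE)
    have d: "(h + 1)^2 - (t + 1/2)^2 - ((h - of_nat (2 * i + 1) - 1)^2 - (1/2 + (-1) ^ (2 * i + 1) * t)^2)
        = (2 * of_nat i + 3) * (2 * h - 2 * of_nat i - 1) - 2 * t"
      by (simp add: field_simps power2_eq_square)
    show ?thesis
      using fpoly_second_order[OF lam that, of h k "2 * i + 1"] unfolding f_def[symmetric] d e by (simp only: distrib_right)
  qed
  show "ev lam ?L = ev lam (cst e * f)"
  proof (rule ev_eqI_roots[OF lam])
    fix h t assume "t = lam + 1/2 \<or> t = - (lam + 1/2)"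
    from *[OF this, of h] show "bival ?L h t = bival (cst e * f) h t"
      by (simp add: fwd2_def bwd2_def)
  qed
  have g: "bival g h t = bival f (- h) t" for h t
    by (simp add: g_def f_def reflect_H_def)
  show "ev lam ?R = ev lam (cst e * g)"
  proof (rule ev_eqI_roots[OF lam])
    fix h t assume "t = lam + 1/2 \<or> t = - (lam + 1/2)"
    from *[OF this, of "- h"] show "bival ?R h t = bival (cst e * g) h t"
      by (simp add: fwd2_def bwd2_def g) (simp add: algebra_simps power2_eq_square)
  qed
qed

section \<open>Polynomials of odd degree\<close>

lemma fpoly_even_odd_degree:
  assumes lam: "lam \<noteq> -1/2"
  shows "ev lam (fpoly lam (2 * k + 1) (2 * i))
        = ev lam (cst (1/2) * (cst (2 * of_nat k + 2 * of_nat i + 1) * vtau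
                              - cst (2 * (lam + 1/2) ^ 2)) * fpoly lam (2 * k) (2 * i))"
proof (rule ev_eqI_roots[OF lam])
  fix h t assume t: "t = lam + 1/2 \<or> t = - (lam + 1/2)"
  then have "t ^ 2 = (lam + 1/2) ^ 2" by (metis power2_minus)
  then show "bival (fpoly lam (2 * k + 1) (2 * i)) h t = bival (cst (1/2) * (cst (2 * of_nat k + 2 * of_nat i + 1) * vtau
                              - cst (2 * (lam + 1/2) ^ 2)) * fpoly lam (2 * k) (2 * i)) h t"
    using bival_fpoly_eq(2)[OF lam t] by (simp add: fpoly_factor_def field_simps)
qed

lemma fpoly_odd_odd_degree:
  assumes lam: "lam \<noteq> -1/2"
  shows "ev lam (fpoly lam (2 * k + 1) (2 * i + 1))
        = ev lam (- cst (1 / (of_nat i + of_nat k + 1)) * vtau * fpoly lam (2 * k) (2 * i + 1))"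
proof (rule ev_eqI_roots[OF lam])
  fix h t assume t: "t = lam + 1/2 \<or> t = - (lam + 1/2)"
  have n: "(2 * of_nat k + (2 * of_nat i + 1) + 1) / 2 = (of_nat i + of_nat k + 1 :: complex)" by simp
  have "of_nat i + of_nat k + 1 = (of_nat (Suc (i + k)) :: complex)" by simp
  then have "of_nat i + of_nat k + 1 \<noteq> (0 :: complex)" by (simp only: of_nat_neq_0 not_False_eq_True)
  moreover have "bival (fpoly lam (2 * k + 1) (2 * i + 1)) h t = - t * hahn_fun k (2 * i + 1) h t"
    "bival (fpoly lam (2 * k) (2 * i + 1)) h t = (of_nat i + of_nat k + 1) * hahn_fun k (2 * i + 1) h t"
    using n by (simp_all add: bival_fpoly_eq(2)[OF lam t] fpoly_factor_def)
  ultimately show "bival (fpoly lam (2 * k + 1) (2 * i + 1)) h t =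
      bival (- cst (1 / (of_nat i + of_nat k + 1)) * vtau * fpoly lam (2 * k) (2 * i + 1)) h t"
    by simp
qed

section \<open>Hahn polynomials\<close>

lemma ratf_simps:
  "ratf (P + Q) = ratf P + ratf Q" "ratf (P * Q) = ratf P * ratf Q"
  "ratf (P - Q) = ratf P - ratf Q" "ratf (- P) = - ratf P" "ratf 0 = 0" "ratf 1 = 1"
  by (simp_all add: ratf_def Zero_fract_def One_fract_def)

lemma ratf_sum: "ratf (sum f A) = (\<Sum>x\<in>A. ratf (f x))"
  by (induction A rule: infinite_finite_induct) (simp_all add: ratf_simps)

lemma ratf_of_nat: "ratf (of_nat n) = of_nat n"
  by (induction n) (simp_all add: ratf_simps)

lemma ratf_pochhammer: "ratf (pochhammer P n) = pochhammer (ratf P) n"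
  by (induction n) (simp_all add: pochhammer_Suc ratf_simps ratf_of_nat)

lemma ratf_eq_iff: "ratf P = ratf Q \<longleftrightarrow> P = Q"
  by (simp add: ratf_def eq_fract)

lemma cst_simps:
  "cst (a + b) = cst a + cst b" "cst (a * b) = cst a * cst b" "cst (a - b) = cst a - cst b"
  "cst (- a) = - cst a" "cst 0 = 0" "cst 1 = 1"
  by (simp_all add: cst_def one_pCons)

lemma cst_of_nat: "cst (of_nat n) = of_nat n"
  by (induction n) (simp_all add: cst_simps)

lemma cst_pochhammer: "cst (pochhammer a n) = pochhammer (cst a) n"
  by (induction n) (simp_all add: pochhammer_Suc cst_simps cst_of_nat)

lemma bival_of_nat [simp]: "bival (of_nat n) h t = of_nat n"
  by (induction n) simp_all

lemma bival_pochhammer [simp]: "bival (pochhammer P n) h t = pochhammer (bival P h t) n"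
  by (induction n) (simp_all add: pochhammer_Suc)

lemma bival_sum [simp]: "bival (sum f A) h t = (\<Sum>x\<in>A. bival (f x) h t)"
  by (induction A rule: infinite_finite_induct) simp_all

text \<open>In the sum over the non-zero terms the range may be enlarged to \<open>s \<le> k\<close>, because \<open>(-k)\<^sub>s\<close> vanishes
  beyond; then \<open>(p)\<^sub>k = (p)\<^sub>s (p + s)\<^bsub>k-s\<^esub>\<close> clears the denominators.\<close>

lemma hyp3F2_terminating:
  fixes a p q A :: "'a::field"
  assumes "pochhammer p k \<noteq> 0" "pochhammer q k \<noteq> 0"
  shows "pochhammer q k * pochhammer p k * hyp3F2 (- of_nat k) a A q p 1 =
    (\<Sum>s\<le>k. pochhammer (- of_nat k) s * pochhammer a s / of_nat (fact s) *
       pochhammer (p + of_nat s) (k - s) * pochhammer (q + of_nat s) (k - s) * pochhammer A s)"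
proof -
  define T where "T s = pochhammer (- of_nat k) s * pochhammer a s * pochhammer A s
                        / (pochhammer q s * pochhammer p s) * 1 ^ s / of_nat (fact s)" for s
  have "hyp3F2 (- of_nat k) a A q p 1 = (\<Sum>s | T s \<noteq> 0. T s)"
    by (simp add: hyp3F2_def Let_def T_def)
  also have "\<dots> = (\<Sum>s\<le>k. T s)"
  proof (rule sum.mono_neutral_left)
    have "T s = 0" if "s > k" for s unfolding T_def pochhammer_of_nat_eq_0_lemma[OF that] by simp
    then show "{s. T s \<noteq> 0} \<subseteq> {..k}" by (metis (mono_tags) mem_Collect_eq atMost_iff not_le subsetI)
  qed auto
  finally have *: "hyp3F2 (- of_nat k) a A q p 1 = (\<Sum>s\<le>k. T s)" .
  show ?thesis
    unfolding * sum_distrib_left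
  proof (rule sum.cong)
    fix s assume "s \<in> {..k}"
    then have s: "k = s + (k - s)" by simp
    have e: "pochhammer x k = pochhammer x s * pochhammer (x + of_nat s) (k - s)" for x :: 'a
      using s pochhammer_product'[of x s "k - s"] by simp
    have "pochhammer p s \<noteq> 0" "pochhammer q s \<noteq> 0" using assms e by auto
    then show "pochhammer q k * pochhammer p k * T s =
        pochhammer (- of_nat k) s * pochhammer a s / of_nat (fact s) *
       pochhammer (p + of_nat s) (k - s) * pochhammer (q + of_nat s) (k - s) * pochhammer A s"
      unfolding T_def e by simp
  qed simp
qed

text \<open>The closed form of \<open>hahn_fun\<close> as a polynomial in independent variables \<open>H\<close> and \<open>\<tau>\<close>.\<close>

definition hahn_poly :: "nat \<Rightarrow> nat \<Rightarrow> bipoly" where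
  "hahn_poly k j = (\<Sum>s\<le>k. cst (hahn_coeff k (of_nat j + 2) s) *
     pochhammer (cst ((of_nat j + 1 + of_bool (odd j)) / 2) - vtau + of_nat s) (k - s) *
     pochhammer (cst (hahn_q j) + of_nat s) (k - s) *
     pochhammer (cst (1/2) * (cst (of_nat j + 1/2 + of_bool (odd j)) - vtau - vH)) s)"

lemma bival_hahn_poly: "bival (hahn_poly k j) h t = hahn_fun k j h t"
  unfolding hahn_poly_def hahn_fun_closed by (simp add: hahn_p_def hahn_arg_def)

lemma ratf_hahn_poly:
  "ratf (hahn_poly k j) = pochhammer (rc (hahn_q j)) k *
     pochhammer (rc ((of_nat j + 1 + of_bool (odd j)) / 2) - ratf vtau) k *
     hyp3F2 (- rc (of_nat k)) (rc (of_nat k + (of_nat j + 1)))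
       (rc (1/2) * (rc (of_nat j + 1/2 + of_bool (odd j)) - ratf vtau - ratf vH))
       (rc (hahn_q j)) (rc ((of_nat j + 1 + of_bool (odd j)) / 2) - ratf vtau) 1"
proof -
  define p where "p = cst ((of_nat j + 1 + of_bool (odd j)) / 2) - vtau"
  define A where "A = cst (1/2) * (cst (of_nat j + 1/2 + of_bool (odd j)) - vtau - vH)"
  have fact: "rc (a / fact s) = rc a / of_nat (fact s)" for a s
  proof -
    have "rc (of_nat (fact s)) = of_nat (fact s)" by (simp only: cst_of_nat ratf_of_nat)
    then have "rc (fact s) = of_nat (fact s)" by (simp only: of_nat_fact)
    moreover have "rc (fact s) \<noteq> 0" unfolding ratf_simps(5)[symmetric] ratf_eq_iff by (simp add: cst_def)
    moreover have "rc (a / fact s) * rc (fact s) = rc a"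
      unfolding ratf_simps(2)[symmetric] cst_simps(2)[symmetric] by simp
    ultimately show ?thesis by (simp add: field_simps)
  qed
  have "pochhammer p k \<noteq> 0"
  proof
    assume "pochhammer p k = 0"
    then have "pochhammer (bival p h t) k = 0" for h t
      unfolding bival_pochhammer[symmetric] by simp
    \<comment> \<open>a value of \<open>\<tau>\<close> at which the parameter becomes 1\<close>
    from this[of 0 "(of_nat j + 1 + of_bool (odd j)) / 2 - 1"]
    have "pochhammer 1 k = (0 :: complex)" by (simp add: p_def)
    then show False by (simp add: pochhammer_fact[symmetric])
  qed
  then have 1: "pochhammer (ratf p) k \<noteq> 0"
    unfolding ratf_pochhammer[symmetric] ratf_simps(5)[symmetric] ratf_eq_iff .
  have "pochhammer (hahn_q j) k \<noteq> 0"
  proof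
    assume "pochhammer (hahn_q j) k = 0"
    then obtain n where "hahn_q j = - of_nat n" by (auto simp: pochhammer_eq_0_iff)
    moreover have "of_nat (j + 2 + of_bool (odd j) + 2 * n) = 2 * hahn_q j + 2 * (of_nat n :: complex)"
      by (simp add: hahn_q_def)
    ultimately have "of_nat (j + 2 + of_bool (odd j) + 2 * n) = (0 :: complex)" by simp
    then show False unfolding of_nat_eq_0_iff by simp
  qed
  then have 2: "pochhammer (rc (hahn_q j)) k \<noteq> 0"
    unfolding ratf_pochhammer[symmetric] cst_pochhammer[symmetric] ratf_simps(5)[symmetric] ratf_eq_iff
    by (simp add: cst_def)
  have "ratf (hahn_poly k j) = (\<Sum>s\<le>k. pochhammer (- of_nat k) s * pochhammer (rc (of_nat k + (of_nat j + 1))) s / of_nat (fact s) *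
       pochhammer (ratf p + of_nat s) (k - s) * pochhammer (rc (hahn_q j) + of_nat s) (k - s) * pochhammer (ratf A) s)"
    unfolding hahn_poly_def ratf_sum p_def[symmetric] A_def[symmetric]
    by (intro sum.cong refl)
      (simp add: ratf_simps ratf_pochhammer hahn_coeff_def fact cst_simps cst_pochhammer cst_of_nat ratf_of_nat add_ac)
  also have "\<dots> = pochhammer (rc (hahn_q j)) k * pochhammer (ratf p) k *
     hyp3F2 (- of_nat k) (rc (of_nat k + (of_nat j + 1))) (ratf A) (rc (hahn_q j)) (ratf p) 1"
    by (rule hyp3F2_terminating[symmetric, OF 1 2])
  also have "of_nat k = rc (of_nat k)" by (simp add: cst_of_nat ratf_of_nat)
  finally show ?thesis unfolding p_def A_def ratf_simps .
qed

lemma fpoly_even_hypergeometric: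
  assumes lam: "lam \<noteq> -1/2"
  shows "equals_ratfun lam (fpoly lam (2 * k) (2 * i))
          (pochhammer (rc (of_nat i + 1)) k
             * pochhammer (rc (of_nat i + 1/2) - ratf vtau) k
             * hyp3F2 (- rc (of_nat k)) (rc (of_nat k + 2 * of_nat i + 1))
                 (rc (1/2) * (rc (2 * of_nat i + 1/2) - ratf vtau - ratf vH))
                 (rc (of_nat i + 1)) (rc (of_nat i + 1/2) - ratf vtau) 1)"
proof -
  have h: "hahn_q (2 * i) = of_nat i + 1" "(of_nat (2 * i) + 1 + of_bool (odd (2 * i))) / 2 = (of_nat i + 1/2 :: complex)"
    "of_nat (2 * i) + 1/2 + of_bool (odd (2 * i)) = (2 * of_nat i + 1/2 :: complex)"
    "of_nat k + (of_nat (2 * i) + 1) = (of_nat k + 2 * of_nat i + 1 :: complex)"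
    by (simp_all add: hahn_q_def field_simps)
  show ?thesis
    unfolding equals_ratfun_def
  proof (intro exI conjI)
    show "ratf (hahn_poly k (2 * i)) = pochhammer (rc (of_nat i + 1)) k
             * pochhammer (rc (of_nat i + 1/2) - ratf vtau) k
             * hyp3F2 (- rc (of_nat k)) (rc (of_nat k + 2 * of_nat i + 1))
                 (rc (1/2) * (rc (2 * of_nat i + 1/2) - ratf vtau - ratf vH))
                 (rc (of_nat i + 1)) (rc (of_nat i + 1/2) - ratf vtau) 1"
      unfolding ratf_hahn_poly h ..
    show "ev lam (fpoly lam (2 * k) (2 * i)) = ev lam (hahn_poly k (2 * i))"
      by (rule ev_eqI_roots[OF lam]) (simp add: bival_fpoly_eq(2)[OF lam] fpoly_factor_def bival_hahn_poly)
  qed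
qed

lemma fpoly_odd_hypergeometric:
  assumes lam: "lam \<noteq> -1/2"
  shows "equals_ratfun lam (fpoly lam (2 * k) (2 * i + 1))
          (rc (of_nat i + of_nat k + 1) * pochhammer (rc (of_nat i + 2)) k
             * pochhammer (rc (of_nat i + 3/2) - ratf vtau) k
             * hyp3F2 (- rc (of_nat k)) (rc (of_nat k + 2 * of_nat i + 2))
                 (rc (1/2) * (rc (2 * of_nat i + 5/2) - ratf vtau - ratf vH))
                 (rc (of_nat i + 2)) (rc (of_nat i + 3/2) - ratf vtau) 1)"
proof -
  have h: "hahn_q (2 * i + 1) = of_nat i + 2" "(of_nat (2 * i + 1) + 1 + of_bool (odd (2 * i + 1))) / 2 = (of_nat i + 3/2 :: complex)"
    "of_nat (2 * i + 1) + 1/2 + of_bool (odd (2 * i + 1)) = (2 * of_nat i + 5/2 :: complex)"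
    "of_nat k + (of_nat (2 * i + 1) + 1) = (of_nat k + 2 * of_nat i + 2 :: complex)"
    by (simp_all add: hahn_q_def field_simps)
  have n: "(2 * of_nat k + (2 * of_nat i + 1) + 1) / 2 = (of_nat i + of_nat k + 1 :: complex)" by simp
  show ?thesis
    unfolding equals_ratfun_def
  proof (intro exI conjI)
    show "ratf (cst (of_nat i + of_nat k + 1) * hahn_poly k (2 * i + 1)) = rc (of_nat i + of_nat k + 1) * pochhammer (rc (of_nat i + 2)) k
             * pochhammer (rc (of_nat i + 3/2) - ratf vtau) k
             * hyp3F2 (- rc (of_nat k)) (rc (of_nat k + 2 * of_nat i + 2))
                 (rc (1/2) * (rc (2 * of_nat i + 5/2) - ratf vtau - ratf vH))
                 (rc (of_nat i + 2)) (rc (of_nat i + 3/2) - ratf vtau) 1"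
      unfolding ratf_simps(2) ratf_hahn_poly h by (simp only: mult.assoc)
    show "ev lam (fpoly lam (2 * k) (2 * i + 1)) = ev lam (cst (of_nat i + of_nat k + 1) * hahn_poly k (2 * i + 1))"
      by (rule ev_eqI_roots[OF lam]) (simp add: bival_fpoly_eq(2)[OF lam] fpoly_factor_def bival_hahn_poly n)
  qed
qed

section \<open>Degrees and bases\<close>

text \<open>For \<open>P = p(H) + q(H) \<tau>\<close> every degree \<open>n\<close> belongs to exactly one monomial, \<open>H\<^sup>a\<close> if \<open>n = 2a\<close> and
  \<open>H\<^sup>a\<tau>\<close> if \<open>n = 2a + 1\<close>; this is its coefficient.\<close>

definition wcoeff :: "bipoly \<Rightarrow> nat \<Rightarrow> complex" where
  "wcoeff P n = coeff (coeff P (n mod 2)) (n div 2)"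

lemma wcoeff_add: "wcoeff (P + Q) n = wcoeff P n + wcoeff Q n"
  and wcoeff_diff: "wcoeff (P - Q) n = wcoeff P n - wcoeff Q n"
  and wcoeff_cst_mult: "wcoeff (cst c * P) n = c * wcoeff P n"
  and wcoeff_0: "wcoeff 0 n = 0"
  by (simp_all add: wcoeff_def cst_def)

lemma wcoeff_sum: "wcoeff (sum f A) n = (\<Sum>x\<in>A. wcoeff (f x) n)"
  by (induction A rule: infinite_finite_induct) (simp_all add: wcoeff_0 wcoeff_add)

lemma wcoeff_pCons: "wcoeff [:p, q:] n = (if even n then coeff p (n div 2) else coeff q (n div 2))"
  by (auto simp: wcoeff_def even_iff_mod_2_eq_zero odd_iff_mod_2_eq_one)

lemma CHtau_wcoeff_eq_0:
  assumes "P \<in> CHtau" "\<And>n. wcoeff P n = 0" shows "P = 0"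
proof -
  obtain p q where P: "P = [:p, q:]" using assms(1) by (auto simp: CHtau_iff)
  have "coeff p a = 0" for a using assms(2)[of "2 * a"] by (simp add: P wcoeff_pCons)
  then have "p = 0" by (simp add: poly_eq_iff)
  moreover have "coeff q a = 0" for a using assms(2)[of "Suc (2 * a)"] by (simp add: P wcoeff_pCons)
  then have "q = 0" by (simp add: poly_eq_iff)
  ultimately show ?thesis by (simp add: P)
qed

lemma CHtau_closed:
  "P \<in> CHtau \<Longrightarrow> Q \<in> CHtau \<Longrightarrow> P - Q \<in> CHtau" "P \<in> CHtau \<Longrightarrow> cst c * P \<in> CHtau"
  by (auto simp: CHtau_iff cst_def)

lemma wcoeff_finite: "finite {n. wcoeff P n \<noteq> 0}"
proof -
  have "finite (\<Union>b<2. (\<lambda>a. 2 * a + b) ` {..degree (coeff P b)})" by auto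
  moreover have "{n. wcoeff P n \<noteq> 0} \<subseteq> (\<Union>b<2. (\<lambda>a. 2 * a + b) ` {..degree (coeff P b)})"
  proof
    fix n assume "n \<in> {n. wcoeff P n \<noteq> 0}"
    then have "n div 2 \<le> degree (coeff P (n mod 2))" by (intro le_degree) (simp add: wcoeff_def)
    moreover have "n = 2 * (n div 2) + n mod 2" by simp
    ultimately show "n \<in> (\<Union>b<2. (\<lambda>a. 2 * a + b) ` {..degree (coeff P b)})"
      by (intro UN_I[of "n mod 2"] image_eqI[of _ _ "n div 2"]) auto
  qed
  ultimately show ?thesis by (rule finite_subset[rotated])
qed

lemma wdeg_CHtau:
  assumes "P \<in> CHtau" shows "wdeg P = Max (insert 0 {n. wcoeff P n \<noteq> 0})"
proof -
  have "{2 * a + b |a b. coeff (coeff P b) a \<noteq> 0} = {n. wcoeff P n \<noteq> 0}"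
  proof safe
    fix a b assume n: "coeff (coeff P b) a \<noteq> 0"
    then have "coeff P b \<noteq> 0" by auto
    then have "b \<le> 1" using assms le_degree[of P b] by (simp add: CHtau_def)
    then show "wcoeff P (2 * a + b) = 0 \<Longrightarrow> False" using n by (auto simp: wcoeff_def le_Suc_eq)
  next
    fix n assume "wcoeff P n \<noteq> 0"
    then show "\<exists>a b. n = 2 * a + b \<and> coeff (coeff P b) a \<noteq> 0"
      by (intro exI[of _ "n div 2"] exI[of _ "n mod 2"]) (simp add: wcoeff_def)
  qed
  then show ?thesis by (simp add: wdeg_def)
qed

lemma wdeg_less_wcoeff:
  assumes "P \<in> CHtau" "wdeg P < k" "k \<le> n" shows "wcoeff P n = 0"
proof (rule ccontr)
  assume "wcoeff P n \<noteq> 0"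
  then have "n \<le> wdeg P" unfolding wdeg_CHtau[OF assms(1)] using wcoeff_finite by (intro Max_ge) auto
  then show False using assms by simp
qed

lemma wdeg_eqI:
  assumes "P \<in> CHtau" "wcoeff P k \<noteq> 0" "\<And>n. n > k \<Longrightarrow> wcoeff P n = 0" shows "wdeg P = k"
  unfolding wdeg_CHtau[OF assms(1)]
proof (rule Max_eqI)
  fix y assume "y \<in> insert 0 {n. wcoeff P n \<noteq> 0}"
  then show "y \<le> k" using assms(3) by (cases "k < y") auto
qed (use assms wcoeff_finite in auto)

text \<open>Triangularity with respect to the degree. Existence subtracts leading terms; for uniqueness,
  compare the coefficients of the largest degree in which two expansions differ.\<close>

lemma basis_CHtauI:
  assumes mem: "\<And>k. f k \<in> CHtau" and lead: "\<And>k. wcoeff (f k) k \<noteq> 0"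
    and upper: "\<And>k n. n > k \<Longrightarrow> wcoeff (f k) n = 0"
  shows "basis_CHtau f"
  unfolding basis_CHtau_def
proof (intro conjI allI ballI)
  fix P assume P: "P \<in> CHtau"
  have ex: "\<exists>c. (\<forall>k\<ge>n. c k = 0) \<and> P = (\<Sum>k<n. cst (c k) * f k)"
    if "P \<in> CHtau" "\<And>m. m \<ge> n \<Longrightarrow> wcoeff P m = 0" for n P
    using that
  proof (induction n arbitrary: P)
    case 0
    then show ?case using CHtau_wcoeff_eq_0 by (intro exI[of _ "\<lambda>k. 0"]) auto
  next
    case (Suc n)
    define x where "x = wcoeff P n / wcoeff (f n) n"
    have "P - cst x * f n \<in> CHtau" using Suc.prems(1) mem by (intro CHtau_closed)
    moreover have "wcoeff (P - cst x * f n) m = 0" if "m \<ge> n" for m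
      using that Suc.prems(2)[of m] lead[of n] upper[of n m]
      by (cases "m = n") (auto simp: wcoeff_diff wcoeff_cst_mult x_def)
    ultimately obtain c where c: "\<forall>k\<ge>n. c k = 0" "P - cst x * f n = (\<Sum>k<n. cst (c k) * f k)"
      using Suc.IH by blast
    have "P = (\<Sum>k<Suc n. cst ((c(n := x)) k) * f k)"
      using c(2) by (simp add: algebra_simps)
    then show ?case using c(1) by (intro exI[of _ "c(n := x)"]) auto
  qed
  have uniq: "c = d"
    if "finite {k. c k \<noteq> 0}" "finite {k. d k \<noteq> 0}"
      "(\<Sum>k | c k \<noteq> 0. cst (c k) * f k) = (\<Sum>k | d k \<noteq> 0. cst (d k) * f k)" for c d
  proof (rule ccontr)
    assume "c \<noteq> d"
    define S where "S = {k. c k \<noteq> 0} \<union> {k. d k \<noteq> 0}"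
    have S: "finite S" using that by (simp add: S_def)
    have "(\<Sum>k | c k \<noteq> 0. cst (c k) * f k) = (\<Sum>k\<in>S. cst (c k) * f k)"
      "(\<Sum>k | d k \<noteq> 0. cst (d k) * f k) = (\<Sum>k\<in>S. cst (d k) * f k)"
      using S by (auto intro!: sum.mono_neutral_left simp: S_def cst_def)
    then have z: "(\<Sum>k\<in>S. cst (c k - d k) * f k) = 0"
      using that(3) by (simp add: cst_simps left_diff_distrib sum_subtractf)
    define T where "T = {k. c k \<noteq> d k}"
    have T: "T \<noteq> {}" "T \<subseteq> S"
      using \<open>c \<noteq> d\<close> by (auto simp: T_def S_def)
    have "finite T" using T(2) S by (rule finite_subset)
    define K where "K = Max T"
    have K: "K \<in> T" and le: "\<And>k. k \<in> T \<Longrightarrow> k \<le> K" using \<open>finite T\<close> T by (simp_all add: K_def)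
    have "0 = (\<Sum>k\<in>S. (c k - d k) * wcoeff (f k) K)"
      using arg_cong[OF z, of "\<lambda>P. wcoeff P K"] by (simp add: wcoeff_sum wcoeff_cst_mult wcoeff_0)
    also have "\<dots> = (\<Sum>k\<in>{K}. (c k - d k) * wcoeff (f k) K)"
    proof (rule sum.mono_neutral_right)
      show "\<forall>i\<in>S - {K}. (c i - d i) * wcoeff (f i) K = 0"
      proof
        fix i assume "i \<in> S - {K}"
        then show "(c i - d i) * wcoeff (f i) K = 0"
          using le[of i] upper[of i K] by (cases "i \<in> T") (auto simp: T_def)
      qed
    qed (use S K T in auto)
    finally show False using K lead[of K] by (simp add: T_def)
  qed
  have "\<exists>n. \<forall>m\<ge>n. wcoeff P m = 0"
    using wcoeff_finite[of P] by (metis (mono_tags, lifting) mem_Collect_eq finite_nat_set_iff_bounded not_less)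
  then obtain n where "\<And>m. m \<ge> n \<Longrightarrow> wcoeff P m = 0" by blast
  from ex[OF P this] obtain c where c: "\<forall>k\<ge>n. c k = 0" "P = (\<Sum>k<n. cst (c k) * f k)" by blast
  have sub: "{k. c k \<noteq> 0} \<subseteq> {..<n}" using c(1) by (metis (mono_tags, lifting) mem_Collect_eq lessThan_iff not_le subsetI)
  have fin: "finite {k. c k \<noteq> 0}" using sub finite_subset by blast
  have "P = (\<Sum>k | c k \<noteq> 0. cst (c k) * f k)"
    unfolding c(2) by (rule sum.mono_neutral_right) (use sub in \<open>auto simp: cst_def\<close>)
  with fin uniq show "\<exists>!c. finite {k. c k \<noteq> 0} \<and> P = (\<Sum>k | c k \<noteq> 0. cst (c k) * f k)"
    by (intro ex1I[of _ c]) auto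
qed (rule mem)

lemma coeff_pochhammer_linear:
  fixes a b :: complex
  shows "(\<forall>n>s. coeff (pochhammer [:a, b:] s) n = 0) \<and> coeff (pochhammer [:a, b:] s) s = b ^ s"
proof (induction s)
  case 0
  show ?case by (simp add: one_pCons coeff_pCons split: nat.split)
next
  case (Suc s)
  have "pochhammer [:a, b:] (Suc s) = smult (a + of_nat s) (pochhammer [:a, b:] s) + pCons 0 (smult b (pochhammer [:a, b:] s))"
    by (simp add: pochhammer_Suc of_nat_poly mult.commute)
  with Suc show ?case by (auto simp: coeff_pCons split: nat.split)
qed

text \<open>The function \<open>hahn_fun k j\<close> for fixed \<open>t\<close>, as a polynomial in \<open>h\<close>.\<close>

definition hahn_uni :: "nat \<Rightarrow> nat \<Rightarrow> complex \<Rightarrow> complex poly" where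
  "hahn_uni k j t = (\<Sum>s\<le>k. smult (hahn_coeff k (of_nat j + 2) s * pochhammer (hahn_p j t + of_nat s) (k - s) *
     pochhammer (hahn_q j + of_nat s) (k - s)) (pochhammer [:hahn_arg j 0 t, -1/2:] s))"

lemma poly_pochhammer: "poly (pochhammer p n) x = pochhammer (poly p x) n"
  by (induction n) (simp_all add: pochhammer_Suc)

lemma poly_hahn_uni: "poly (hahn_uni k j t) h = hahn_fun k j h t"
proof -
  have "poly [:hahn_arg j 0 t, -1/2:] h = hahn_arg j h t" by (simp add: hahn_arg_def field_simps)
  then show ?thesis
    unfolding hahn_uni_def hahn_fun_closed poly_sum poly_smult poly_pochhammer by (simp only:)
qed

text \<open>In the closed form only the term \<open>s = k\<close> contributes to \<open>h\<^sup>k\<close>, and its coefficient does not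
  involve \<open>t\<close>.\<close>

definition hahn_lead :: "nat \<Rightarrow> nat \<Rightarrow> complex" where
  "hahn_lead k j = hahn_coeff k (of_nat j + 2) k * (-1/2) ^ k"

lemma coeff_hahn_uni: "coeff (hahn_uni k j t) k = hahn_lead k j"
  and coeff_hahn_uni_above: "n > k \<Longrightarrow> coeff (hahn_uni k j t) n = 0"
proof -
  show "n > k \<Longrightarrow> coeff (hahn_uni k j t) n = 0"
    by (simp add: hahn_uni_def coeff_sum coeff_pochhammer_linear)
  have "coeff (hahn_uni k j t) k = (\<Sum>s\<in>{k}. hahn_coeff k (of_nat j + 2) s * pochhammer (hahn_p j t + of_nat s) (k - s) *
     pochhammer (hahn_q j + of_nat s) (k - s) * coeff (pochhammer [:hahn_arg j 0 t, -1/2:] s) k)"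
    unfolding hahn_uni_def coeff_sum coeff_smult
    by (rule sum.mono_neutral_right) (auto simp: coeff_pochhammer_linear)
  then show "coeff (hahn_uni k j t) k = hahn_lead k j"
    by (simp add: coeff_pochhammer_linear hahn_lead_def)
qed

lemma hahn_lead_nonzero: "hahn_lead k j \<noteq> 0"
proof -
  have "pochhammer (of_nat (k + j + 1) :: complex) k \<noteq> 0"
  proof
    assume "pochhammer (of_nat (k + j + 1) :: complex) k = 0"
    then obtain n where "of_nat (k + j + 1) = - (of_nat n :: complex)" by (auto simp: pochhammer_eq_0_iff)
    then show False unfolding eq_neg_iff_add_eq_0 of_nat_add[symmetric] of_nat_eq_0_iff by simp
  qed
  moreover have "of_nat k + (of_nat j + 2) - 1 = (of_nat (k + j + 1) :: complex)" by simp
  ultimately show ?thesis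
    unfolding hahn_lead_def hahn_coeff_def by (simp only:) (simp add: pochhammer_same)
qed

text \<open>Write \<open>f = p + q\<tau>\<close>. The values at \<open>\<tau> = \<plusminus>c\<close> give \<open>2p\<close> and \<open>2cq\<close> as sum and difference of two polynomials in
  \<open>h\<close> with the same leading coefficient: for even \<open>k\<close> the leading terms cancel in \<open>q\<close>, for odd \<open>k\<close>
  the additional factor, linear in \<open>\<tau>\<close> modulo the relation for \<open>\<tau>\<^sup>2\<close>, brings them into \<open>q\<close>.\<close>

lemma fpoly_coeffs:
  assumes lam: "lam \<noteq> -1/2"
  shows "wcoeff (fpoly lam k j) k \<noteq> 0" and "n > k \<Longrightarrow> wcoeff (fpoly lam k j) n = 0"
proof -
  define c where "c = lam + 1/2"
  have c: "c \<noteq> 0" using lam by (auto simp: c_def add_eq_0_iff2)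
  define r where "r = k div 2"
  define u v where "u = hahn_uni r j c" and "v = hahn_uni r j (- c)"
  obtain p q where pq: "fpoly lam k j = [:p, q:]"
    using fpoly_CHtau[OF lam, of k j] by (auto simp: CHtau_iff)
  have "poly (p + smult c q) h = poly (smult (fpoly_factor k j c) u) h" for h
    using bival_fpoly_eq(2)[OF lam, of c k j h] by (simp add: pq poly_hahn_uni u_def c_def r_def)
  then have 1: "p + smult c q = smult (fpoly_factor k j c) u" by (simp add: poly_eq_poly_eq_iff[symmetric] fun_eq_iff)
  have "poly (p - smult c q) h = poly (smult (fpoly_factor k j (- c)) v) h" for h
    using bival_fpoly_eq(2)[OF lam, of "- c" k j h] by (simp add: pq poly_hahn_uni v_def c_def r_def algebra_simps)
  then have 2: "p - smult c q = smult (fpoly_factor k j (- c)) v" by (simp add: poly_eq_poly_eq_iff[symmetric] fun_eq_iff)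
  have C: "coeff p a + c * coeff q a = fpoly_factor k j c * coeff u a" "coeff p a - c * coeff q a = fpoly_factor k j (- c) * coeff v a" for a
    using arg_cong[OF 1, of "\<lambda>p. coeff p a"] arg_cong[OF 2, of "\<lambda>p. coeff p a"] by simp_all
  have P: "2 * coeff p a = fpoly_factor k j c * coeff u a + fpoly_factor k j (- c) * coeff v a"
    and Q: "2 * c * coeff q a = fpoly_factor k j c * coeff u a - fpoly_factor k j (- c) * coeff v a" for a
    unfolding C[symmetric] by simp_all
  have lead: "coeff u r = hahn_lead r j" "coeff v r = hahn_lead r j"
    by (simp_all add: u_def v_def coeff_hahn_uni)
  have above: "coeff p a = 0" "coeff q a = 0" if "a > r" for a
    using P[of a] Q[of a] c that by (simp_all add: u_def v_def coeff_hahn_uni_above)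
  have top: "if even k then coeff p r \<noteq> 0 \<and> coeff q r = 0 else coeff q r \<noteq> 0"
  proof (cases "even k")
    case True
    define x where "x = (if even j then 1 else (of_nat (k + j + 1) / 2 :: complex))"
    have x: "fpoly_factor k j c = x" "fpoly_factor k j (- c) = x" using True by (simp_all add: fpoly_factor_def x_def)
    have "of_nat (Suc (k + j)) \<noteq> (0 :: complex)" by (rule of_nat_neq_0)
    then have "x \<noteq> 0" by (simp add: x_def del: of_nat_Suc)
    moreover have "2 * coeff p r = 2 * (x * hahn_lead r j)" "2 * c * coeff q r = 0"
      unfolding P Q lead x by simp_all
    ultimately show ?thesis using True hahn_lead_nonzero[of r j] c by simp
  next
    case False
    then have "k > 0" by (intro Nat.gr0I) auto
    define x where "x = (if even j then of_nat (k + j) / 2 else (- 1 :: complex))"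
    have "x \<noteq> 0" using \<open>k > 0\<close> unfolding x_def by (simp del: of_nat_add)
    moreover have "fpoly_factor k j c - fpoly_factor k j (- c) = 2 * c * x"
      using False by (simp add: fpoly_factor_def x_def field_simps)
    then have "2 * c * coeff q r = 2 * c * (x * hahn_lead r j)"
      unfolding Q lead by (simp add: left_diff_distrib[symmetric])
    ultimately show ?thesis using False hahn_lead_nonzero[of r j] c by simp
  qed
  show "wcoeff (fpoly lam k j) k \<noteq> 0" using top by (auto simp: pq wcoeff_pCons r_def)
  show "n > k \<Longrightarrow> wcoeff (fpoly lam k j) n = 0"
  proof -
    assume n: "n > k"
    have "n div 2 > k div 2 \<or> n div 2 = k div 2 \<and> even k \<and> odd n"
      using n by presburger
    then show ?thesis using above top by (auto simp: pq wcoeff_pCons r_def)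
  qed
qed

lemma reflect_H_pCons: "reflect_H [:p, q:] = [:pcompose p [:0, -1:], pcompose q [:0, -1:]:]"
  by (simp add: reflect_H_def subst_lin_pCons flip: one_pCons)

lemma reflect_H_CHtau: "P \<in> CHtau \<Longrightarrow> reflect_H P \<in> CHtau"
  by (auto simp: CHtau_iff reflect_H_pCons simp del: pCons_0_0)

lemma reflect_H_reflect_H: "reflect_H (reflect_H P) = P"
  by (rule bipoly_eqI) (simp add: reflect_H_def)

lemma wcoeff_reflect_H: "P \<in> CHtau \<Longrightarrow> wcoeff (reflect_H P) n = (-1) ^ (n div 2) * wcoeff P n"
  by (auto simp: CHtau_iff reflect_H_pCons wcoeff_pCons coeff_pcompose_linear)

section \<open>Invariance of supertraces\<close>

text \<open>The properties of a supertrace, pulled back to the free algebra, that orthogonality depends on.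
  In this form they are stable under composition with \<open>refl_aut\<close>.\<close>

definition tracial :: "complex \<Rightarrow> (free \<Rightarrow> complex) \<Rightarrow> bool" where
  "tracial lam \<theta> \<longleftrightarrow> (\<forall>u v. \<theta> (u + v) = \<theta> u + \<theta> v) \<and> (\<forall>c u. \<theta> (smul c u) = c * \<theta> u) \<and>
     (\<forall>u v. cls lam u = cls lam v \<longrightarrow> \<theta> u = \<theta> v) \<and>
     (\<forall>u. \<theta> (scomm gF u) = 0) \<and> (\<forall>u. \<theta> (scomm gG u) = 0)"

lemma tracial_supertrace: "supertrace lam L \<Longrightarrow> tracial lam (\<lambda>u. L (cls lam u))"
  unfolding supertrace_def tracial_def by metis

lemma tracial_refl_aut:
  assumes "tracial lam \<theta>" shows "tracial lam (\<lambda>u. \<theta> (refl_aut u))"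
proof -
  have F: "refl_aut (scomm gF u) = scomm gG (refl_aut u)" for u
    by (simp add: scomm_gF scomm_gG parity_refl_aut)
  have G: "refl_aut (scomm gG u) = smul (-1) (scomm gF (refl_aut u))" for u
    by (simp add: scomm_gF scomm_gG parity_refl_aut smul_minus_left)
  have "\<theta> (refl_aut u) = \<theta> (refl_aut v)" if "cls lam u = cls lam v" for u v
    using assms cls_refl_aut[OF that] unfolding tracial_def by blast
  moreover have "\<theta> (smul c u) = c * \<theta> u" "\<theta> (u + v) = \<theta> u + \<theta> v"
    "\<theta> (scomm gF u) = 0" "\<theta> (scomm gG u) = 0" for c u v
    using assms unfolding tracial_def by blast+
  ultimately show ?thesis
    unfolding tracial_def F G refl_aut_add refl_aut_smul by (intro conjI allI impI) (assumption | simp only: mult_zero_right)+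
qed

lemma tracial_cong: "tracial lam \<theta> \<Longrightarrow> cls lam u = cls lam v \<Longrightarrow> \<theta> u = \<theta> v"
  unfolding tracial_def by blast

lemma tracial_smul: "tracial lam \<theta> \<Longrightarrow> \<theta> (smul c u) = c * \<theta> u"
  unfolding tracial_def by blast

lemma tracial_uminus: "tracial lam \<theta> \<Longrightarrow> \<theta> (- u) = - \<theta> u"
proof -
  assume "tracial lam \<theta>"
  then have "\<theta> (smul (-1) u) = -1 * \<theta> u" unfolding tracial_def by blast
  then show ?thesis by (simp add: smul_minus_left)
qed

lemma tracial_diff: "tracial lam \<theta> \<Longrightarrow> \<theta> (u - v) = \<theta> u - \<theta> v"
proof -
  assume t: "tracial lam \<theta>"
  then have "\<theta> (u + - v) = \<theta> u + \<theta> (- v)" unfolding tracial_def by blast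
  then show ?thesis by (simp add: tracial_uminus[OF t])
qed

lemma tracial_zero: "tracial lam \<theta> \<Longrightarrow> \<theta> 0 = 0"
  using tracial_diff[of lam \<theta> 0 0] by simp

lemma scomm_gF_mult: "scomm gF (u * v) = scomm gF u * v + parity u * scomm gF v"
  by (simp add: scomm_gF algebra_simps)

lemma scomm_gG_mult: "scomm gG (u * v) = scomm gG u * v + parity u * scomm gG v"
  by (simp add: scomm_gG algebra_simps)

lemma tracial_scomm_F:
  assumes "tracial lam \<theta>" shows "\<theta> (scomm gF u * v) = - \<theta> (parity u * scomm gF v)"
proof -
  have "\<theta> (scomm gF (u * v)) = 0" using assms unfolding tracial_def by blast
  moreover have "\<theta> (scomm gF (u * v)) = \<theta> (scomm gF u * v) + \<theta> (parity u * scomm gF v)"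
    using assms unfolding tracial_def scomm_gF_mult by blast
  ultimately have "\<theta> (scomm gF u * v) + \<theta> (parity u * scomm gF v) = 0" by simp
  then show ?thesis by (simp add: eq_neg_iff_add_eq_0)
qed

lemma tracial_scomm_G:
  assumes "tracial lam \<theta>" shows "\<theta> (scomm gG u * v) = - \<theta> (parity u * scomm gG v)"
proof -
  have "\<theta> (scomm gG (u * v)) = 0" using assms unfolding tracial_def by blast
  moreover have "\<theta> (scomm gG (u * v)) = \<theta> (scomm gG u * v) + \<theta> (parity u * scomm gG v)"
    using assms unfolding tracial_def scomm_gG_mult by blast
  ultimately have "\<theta> (scomm gG u * v) + \<theta> (parity u * scomm gG v) = 0" by simp
  then show ?thesis by (simp add: eq_neg_iff_add_eq_0)
qed

lemma scomm_gF_smul: "scomm gF (smul c u) = smul c (scomm gF u)"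
  by (simp add: scomm_gF smul_diff_right)

lemma parity_scomm_F_funpow:
  "parity u = smul e u \<Longrightarrow> parity ((scomm gF ^^ m) u) = smul ((-1) ^ m * e) ((scomm gF ^^ m) u)"
proof (induction m)
  case (Suc m)
  have "parity (scomm gF w) = - scomm gF (parity w)" for w
    by (simp add: scomm_gF)
  then show ?case using Suc by (simp add: scomm_gF_smul smul_minus_left)
qed simp

text \<open>Each step contributes the factor by which \<open>parity\<close> acts; \<open>\<sigma>\<close> depends on \<open>m\<close> and \<open>e\<close>, but not on \<open>v\<close>.\<close>

lemma tracial_scomm_F_funpow:
  assumes l: "tracial lam \<theta>" and u: "parity u = smul e u"
  shows "\<exists>\<sigma>. \<forall>v. \<theta> ((scomm gF ^^ m) u * v) = \<sigma> * \<theta> (u * (scomm gF ^^ m) v)"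
proof (induction m)
  case 0
  show ?case by (intro exI[of _ 1]) simp
next
  case (Suc m)
  then obtain \<sigma> where \<sigma>: "\<And>v. \<theta> ((scomm gF ^^ m) u * v) = \<sigma> * \<theta> (u * (scomm gF ^^ m) v)" by blast
  have "\<theta> ((scomm gF ^^ Suc m) u * v) = - ((-1) ^ m * e * \<sigma>) * \<theta> (u * (scomm gF ^^ Suc m) v)" for v
  proof -
    have "\<theta> ((scomm gF ^^ Suc m) u * v) = - \<theta> (parity ((scomm gF ^^ m) u) * scomm gF v)"
      using tracial_scomm_F[OF l] by simp
    also have "\<dots> = - ((-1) ^ m * e * \<theta> ((scomm gF ^^ m) u * scomm gF v))"
      unfolding parity_scomm_F_funpow[OF u] by (simp add: tracial_smul[OF l])
    also have "\<dots> = - ((-1) ^ m * e * \<sigma>) * \<theta> (u * (scomm gF ^^ Suc m) v)"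
      unfolding \<sigma> funpow_Suc_right by simp
    finally show ?thesis .
  qed
  then show ?case by blast
qed

section \<open>The adjoint action of \<open>F\<close> on \<open>F\<^sup>j Q\<close>\<close>

text \<open>The polynomial is kept on the right of \<open>F\<^sup>j\<close>: in \<open>\<langle>f G\<^sup>j, Q G\<^sup>j\<rangle>\<close> the transpose of \<open>Q G\<^sup>j\<close> is
  \<open>\<plusminus>F\<^sup>j Q\<close>.\<close>

lemma cls_scomm_F_F_power:
  "cls lam (scomm gF (gF ^ j * in_free Q)) =
     cls lam (gF ^ Suc j * in_free (Q - cst ((-1) ^ j) * subst_lin 1 (-1) (-1) Q))"
proof -
  let ?Q = "subst_lin 1 (-1) (-1) Q"
  have e: "subst_lin 1 1 (-1) ?Q = Q" by (rule bipoly_eqI) simp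
  have c: "cls lam (in_free Q * gF) = cls lam (gF * in_free ?Q)"
    using cls_F_in_free[of lam ?Q] by (simp add: e)
  have "scomm gF (gF ^ j * in_free Q) = gF ^ Suc j * in_free Q - smul ((-1) ^ j) (gF ^ j * (in_free Q * gF))"
    unfolding scomm_gF parity_mult parity_F_power by (simp add: mult.assoc)
  also have "cls lam \<dots> = cls lam (gF ^ Suc j * in_free Q - smul ((-1) ^ j) (gF ^ j * (gF * in_free ?Q)))"
    by (intro cls_diff cls_smul cls_mult_left c refl)
  also have "gF ^ Suc j * in_free Q - smul ((-1) ^ j) (gF ^ j * (gF * in_free ?Q)) =
     gF ^ Suc j * in_free (Q - cst ((-1) ^ j) * ?Q)"
    by (simp add: in_free_diff algebra_simps) (simp add: power_commutes flip: mult.assoc)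
  finally show ?thesis .
qed

lemma cls_scomm_F_F_power_funpow:
  "cls lam ((scomm gF ^^ (2 * r)) (gF ^ j * in_free Q)) = cls lam (gF ^ (j + 2 * r) * in_free ((bwd2 ^^ r) Q))"
proof (induction r)
  case (Suc r)
  let ?Q = "(bwd2 ^^ r) Q" and ?n = "j + 2 * r"
  let ?Q' = "?Q - cst ((-1) ^ ?n) * subst_lin 1 (-1) (-1) ?Q"
  have e: "?Q' - cst ((-1) ^ Suc ?n) * subst_lin 1 (-1) (-1) ?Q' = bwd2 ?Q"
    by (rule bipoly_eqI, cases "even j") (simp_all add: bwd2_def)
  have "cls lam ((scomm gF ^^ (2 * Suc r)) (gF ^ j * in_free Q)) = cls lam (scomm gF (scomm gF (gF ^ ?n * in_free ?Q)))"
    using cls_scomm_gF[OF cls_scomm_gF[OF Suc.IH]] by simp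
  also have "\<dots> = cls lam (scomm gF (gF ^ Suc ?n * in_free ?Q'))"
    by (intro cls_scomm_gF cls_scomm_F_F_power)
  also have "\<dots> = cls lam (gF ^ Suc (Suc ?n) * in_free (bwd2 ?Q))"
    unfolding cls_scomm_F_F_power e ..
  finally show ?case by simp
qed simp

text \<open>The operator \<open>\<nabla>\<^sub>2\<close> on polynomials in \<open>H\<close>; on \<open>\<complex>[H,\<tau>]\<close> it acts on both coefficients separately.\<close>

definition bwd2_uni :: "complex poly \<Rightarrow> complex poly" where
  "bwd2_uni p = p - pcompose p [:-2, 1:]"

lemma bwd2_pCons: "bwd2 [:p, q:] = [:bwd2_uni p, bwd2_uni q:]"
  by (simp add: bwd2_def bwd2_uni_def subst_lin_pCons flip: one_pCons)

lemma bwd2_funpow_pCons: "(bwd2 ^^ r) [:p, q:] = [:(bwd2_uni ^^ r) p, (bwd2_uni ^^ r) q:]"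
  by (induction r) (simp_all add: bwd2_pCons del: pCons_0_0)

text \<open>The leading terms of \<open>p(x)\<close> and \<open>p(x - 2)\<close> cancel.\<close>

lemma coeff_bwd2_uni:
  assumes "\<And>n. n \<ge> Suc d \<Longrightarrow> coeff p n = 0" "n \<ge> d"
  shows "coeff (bwd2_uni p) n = 0"
proof -
  have d: "degree p \<le> d" using assms(1) by (intro degree_le) auto
  have d': "degree (pcompose p [:-2, 1:]) = degree p" by (simp add: degree_pcompose)
  consider "n > degree p" | "n = degree p" using d assms(2) by linarith
  then show ?thesis
  proof cases
    case 1
    then show ?thesis by (simp add: bwd2_uni_def coeff_eq_0 d')
  next
    case 2
    have "coeff (pcompose p [:-2, 1:]) n = lead_coeff (pcompose p [:-2, 1:])" by (simp add: d' 2)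
    also have "\<dots> = lead_coeff p" by (subst lead_coeff_comp) simp_all
    finally show ?thesis by (simp add: bwd2_uni_def 2)
  qed
qed

lemma coeff_bwd2_uni_funpow:
  assumes "\<And>n. n \<ge> r + d \<Longrightarrow> coeff p n = 0" "n \<ge> d"
  shows "coeff ((bwd2_uni ^^ r) p) n = 0"
  using assms
proof (induction r arbitrary: d n)
  case (Suc r)
  have "coeff ((bwd2_uni ^^ r) p) m = 0" if "m \<ge> Suc d" for m
    using that Suc.prems(1) by (intro Suc.IH[of "Suc d"]) auto
  from coeff_bwd2_uni[OF this, of n] show ?case using Suc.prems(2) by simp
qed simp

section \<open>The exceptional trace\<close>

text \<open>Induction on \<open>m\<close> by the derivation rule, from \<open>[G, F\<^sup>2] = [G, F] F - F [G, F] = -F\<close>.\<close>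

lemma cls_scomm_G_F_power: "cls lam (scomm gG (gF ^ (2 * m))) = cls lam (smul (- of_nat m) (gF ^ (2 * m - 1)))"
proof (induction m)
  case 0
  show ?case by (simp add: scomm_gG)
next
  case (Suc m)
  have base: "cls lam (scomm gG (gF * gF)) = cls lam (- gF)"
  proof -
    have "cls lam (gG * gF * gF) = cls lam ((gH - gF * gG) * gF)"
      by (intro cls_mult_right cls_GF)
    also have "\<dots> = cls lam (gH * gF - gF * (gG * gF))" by (simp add: algebra_simps)
    also have "\<dots> = cls lam ((gF * gH - gF) - gF * (gH - gF * gG))"
      by (intro cls_diff cls_mult_left cls_HF cls_GF)
    finally have "cls lam (gG * gF * gF - gF * gF * gG) = cls lam ((gF * gH - gF) - gF * (gH - gF * gG) - gF * gF * gG)"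
      by (intro cls_diff refl)
    then show ?thesis by (simp add: scomm_gG algebra_simps)
  qed
  have p: "parity (gF ^ (2 * m)) = gF ^ (2 * m)" unfolding parity_F_power by simp
  have "cls lam (scomm gG (gF ^ (2 * m) * (gF * gF))) =
      cls lam (smul (- of_nat m) (gF ^ (2 * m - 1)) * (gF * gF) + gF ^ (2 * m) * (- gF))"
    unfolding scomm_gG_mult[of "gF ^ (2 * m)" "gF * gF"] p by (intro cls_add cls_mult Suc.IH base refl)
  also have "smul (- of_nat m) (gF ^ (2 * m - 1)) * (gF * gF) = smul (- of_nat m) (gF ^ (2 * m + 1))"
  proof (cases m)
    case (Suc m')
    have "gF ^ (2 * m - 1) * (gF * gF) = gF ^ (2 * m - 1 + 2)"
      by (simp only: power_add power2_eq_square)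
    then show ?thesis using Suc by simp
  qed simp
  also have "gF ^ (2 * m) * - gF = smul (-1) (gF ^ (2 * m + 1))"
    by (simp add: smul_minus_left power_commutes)
  also have "smul (- of_nat m) (gF ^ (2 * m + 1)) + smul (-1) (gF ^ (2 * m + 1)) =
      smul (- of_nat (Suc m)) (gF ^ (2 * Suc m - 1))"
  proof -
    have "- of_nat m + -1 = (- of_nat (Suc m) :: complex)" by simp
    then show ?thesis unfolding smul_add_left[symmetric] by (simp only:) simp
  qed
  also have "gF ^ (2 * m) * (gF * gF) = gF ^ (2 * Suc m)"
    using power_add[of gF "2 * m" 2] by (simp add: power2_eq_square)
  finally show ?case .
qed

text \<open>With \<open>x = G\<^sup>n\<tau>\<close> and \<open>n = 2m + 1\<close>, \<open>F\<^sup>n\<close> is a multiple of \<open>[G, F\<^bsup>n+1\<^esup>]\<close>, and the trace of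
  \<open>x [G, F\<^bsup>n+1\<^esup>]\<close> equals that of \<open>[G, x] F\<^bsup>n+1\<^esup> = 0\<close>.\<close>

lemma tracial_G_tau_F:
  assumes l: "tracial lam \<theta>" and n: "odd n"
  shows "\<theta> (gG ^ n * gtau * gF ^ n) = 0"
proof -
  define x where "x = gG ^ n * gtau"
  obtain m where m: "n = 2 * m + 1" using n by (elim oddE)
  have px: "parity x = - x" unfolding x_def parity_mult parity_G_power using n by (simp add: smul_minus_left)
  have "scomm gG x = gG ^ n * (gG * gtau + gtau * gG)"
    by (simp add: scomm_gG px) (simp add: x_def algebra_simps power_commutes flip: mult.assoc)
  also have "cls lam \<dots> = cls lam (gG ^ n * (- gtau * gG + gtau * gG))"
    by (intro cls_mult_left cls_add cls_Gtau refl)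
  finally have cx: "cls lam (scomm gG x) = cls lam 0" by simp
  have "\<theta> (x * scomm gG (gF ^ (2 * Suc m))) = \<theta> (scomm gG x * gF ^ (2 * Suc m))"
    unfolding tracial_scomm_G[OF l] px by (simp add: tracial_uminus[OF l])
  also have "\<dots> = \<theta> (0 * gF ^ (2 * Suc m))"
    by (rule tracial_cong[OF l cls_mult_right[OF cx]])
  also have "\<dots> = 0" using tracial_zero[OF l] by simp
  also have "\<theta> (x * scomm gG (gF ^ (2 * Suc m))) = \<theta> (x * smul (- of_nat (Suc m)) (gF ^ (2 * Suc m - 1)))"
    by (rule tracial_cong[OF l cls_mult_left[OF cls_scomm_G_F_power]])
  also have "\<dots> = - of_nat (Suc m) * \<theta> (x * gF ^ n)"
    by (simp add: tracial_smul[OF l] m del: of_nat_Suc)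
  finally show ?thesis by (simp add: x_def del: of_nat_Suc)
qed

section \<open>Orthogonality\<close>

text \<open>With \<open>r = k div 2\<close>, the \<open>r\<close>-th power of \<open>\<nabla>\<^sub>2\<close> kills \<open>Q\<close> if \<open>k\<close> is even and leaves a constant if \<open>k\<close>
  is odd. If \<open>j\<close> is even as well, a further \<open>ad F\<close> kills this constant; if \<open>j\<close> is odd, there are
  only \<open>2r\<close> factors \<open>ad F\<close>, and the exceptional trace remains.\<close>

lemma ad_F_element_orthogonal:
  assumes l: "tracial lam \<theta>" and Q: "Q \<in> CHtau" "\<And>n. n \<ge> k \<Longrightarrow> wcoeff Q n = 0"
  shows "\<theta> (ad_F_element k j * (gF ^ j * in_free Q)) = 0"
proof -
  define m where "m = ad_steps k j"
  define x where "x = (if even (j + m) then gG ^ (j + m) else gG ^ (j + m) * gtau)"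
  define r where "r = k div 2"
  have "parity x = smul ((-1) ^ (j + m)) x"
    unfolding x_def by (simp add: parity_G_power del: parity_power)
  from tracial_scomm_F_funpow[OF l this, of m] obtain \<sigma>
    where \<sigma>: "\<theta> (ad_F_element k j * (gF ^ j * in_free Q)) = \<sigma> * \<theta> (x * (scomm gF ^^ m) (gF ^ j * in_free Q))"
    unfolding ad_F_element_eq m_def[symmetric] x_def[symmetric] by blast
  obtain p q where pq: "Q = [:p, q:]" using Q(1) by (auto simp: CHtau_iff)
  have p: "coeff p a = 0" if "2 * a \<ge> k" for a using Q(2)[OF that] by (simp add: pq wcoeff_pCons)
  have q: "coeff q a = 0" if "2 * a + 1 \<ge> k" for a using Q(2)[OF that] by (simp add: pq wcoeff_pCons)
  have cQ: "cls lam ((scomm gF ^^ (2 * r)) (gF ^ j * in_free Q)) =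
      cls lam (gF ^ (j + 2 * r) * in_free [:(bwd2_uni ^^ r) p, (bwd2_uni ^^ r) q:])"
    unfolding cls_scomm_F_F_power_funpow pq bwd2_funpow_pCons ..
  have "(bwd2_uni ^^ r) q = 0"
  proof (rule poly_eqI)
    fix n show "coeff ((bwd2_uni ^^ r) q) n = coeff 0 n"
      using coeff_bwd2_uni_funpow[of r 0 q n] q by (auto simp: r_def)
  qed
  note cQ = cQ[unfolded this]
  have "\<theta> (x * (scomm gF ^^ m) (gF ^ j * in_free Q)) = 0"
  proof (cases "even k")
    case True
    have "(bwd2_uni ^^ r) p = 0"
    proof (rule poly_eqI)
      fix n show "coeff ((bwd2_uni ^^ r) p) n = coeff 0 n"
        using coeff_bwd2_uni_funpow[of r 0 p n] p True by (auto simp: r_def)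
    qed
    then have z: "cls lam ((scomm gF ^^ (2 * r)) (gF ^ j * in_free Q)) = cls lam 0" using cQ by simp
    have "cls lam (scomm gF ((scomm gF ^^ (2 * r)) (gF ^ j * in_free Q))) = cls lam 0"
      using cls_scomm_gF[OF z] by (simp add: scomm_gF)
    then have "cls lam ((scomm gF ^^ m) (gF ^ j * in_free Q)) = cls lam 0"
      using z True by (cases "even j") (simp_all add: m_def ad_steps_def r_def)
    from tracial_cong[OF l cls_mult_left[OF this]] show ?thesis
      by (simp only: mult_zero_right tracial_zero[OF l])
  next
    case False
    then have k: "k = 2 * r + 1" by (simp add: r_def)
    define \<kappa> where "\<kappa> = coeff ((bwd2_uni ^^ r) p) 0"
    have "(bwd2_uni ^^ r) p = [:\<kappa>:]"
    proof (rule poly_eqI)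
      fix n
      have "coeff ((bwd2_uni ^^ r) p) n = 0" if "n \<ge> 1"
        using that p k by (intro coeff_bwd2_uni_funpow[of r 1]) auto
      then show "coeff ((bwd2_uni ^^ r) p) n = coeff [:\<kappa>:] n"
        by (cases n) (auto simp: \<kappa>_def)
    qed
    then have cQ: "cls lam ((scomm gF ^^ (2 * r)) (gF ^ j * in_free Q)) = cls lam (gF ^ (j + 2 * r) * in_free (cst \<kappa>))"
      using cQ by (simp add: cst_def)
    show ?thesis
    proof (cases "even j")
      case True
      have "cst \<kappa> - cst ((-1) ^ (j + 2 * r)) * subst_lin 1 (-1) (-1) (cst \<kappa>) = 0"
        by (rule bipoly_eqI) (use True in simp)
      then have "cls lam ((scomm gF ^^ Suc (2 * r)) (gF ^ j * in_free Q)) = cls lam 0"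
        using cls_scomm_gF[OF cQ] cls_scomm_F_F_power[of lam "j + 2 * r" "cst \<kappa>"] by simp
      moreover have "m = Suc (2 * r)" using True k by (simp add: m_def ad_steps_def)
      ultimately have "cls lam ((scomm gF ^^ m) (gF ^ j * in_free Q)) = cls lam 0" by simp
      from tracial_cong[OF l cls_mult_left[OF this]] show ?thesis
        by (simp only: mult_zero_right tracial_zero[OF l])
    next
      case odd: False
      have m: "m = 2 * r" using odd k by (simp add: m_def ad_steps_def)
      have "\<theta> (x * (scomm gF ^^ m) (gF ^ j * in_free Q)) = \<theta> (x * (gF ^ (j + 2 * r) * in_free (cst \<kappa>)))"
        unfolding m by (rule tracial_cong[OF l cls_mult_left[OF cQ]])
      also have "\<dots> = \<kappa> * \<theta> (gG ^ (j + 2 * r) * gtau * gF ^ (j + 2 * r))"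
        using odd by (simp add: x_def m tracial_smul[OF l] mult.assoc)
      also have "\<dots> = 0" using odd by (simp add: tracial_G_tau_F[OF l])
      finally show ?thesis .
    qed
  qed
  then show ?thesis by (simp add: \<sigma>)
qed

text \<open>The element \<open>G\<^sup>jF\<^sup>j\<close> has weight 0; as it is a polynomial in \<open>H\<close> and \<open>\<tau>\<close>, it commutes with these,
  which makes the form symmetric on \<open>P G\<^sup>j\<close>, \<open>Q G\<^sup>j\<close>.\<close>

lemma cls_G_F_power_in_free: "\<exists>Y. cls lam (gG ^ j * gF ^ j) = cls lam (in_free Y)"
proof (induction j)
  case 0
  show ?case by (intro exI[of _ 1]) simp
next
  case (Suc j)
  then obtain Y where Y: "cls lam (gG ^ j * gF ^ j) = cls lam (in_free Y)" by blast
  let ?Y = "subst_lin 1 (-1) (-1) Y"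
  have "cls lam (gG ^ Suc j * gF ^ Suc j) = cls lam (gG * (gG ^ j * gF ^ j) * gF)"
    by (simp add: mult.assoc power_commutes)
  also have "\<dots> = cls lam (gG * in_free Y * gF)"
    by (intro cls_mult Y refl)
  also have "\<dots> = cls lam (in_free ?Y * gG * gF)"
    by (intro cls_mult cls_G_in_free refl)
  also have "\<dots> = cls lam (in_free ?Y * in_free (GF_poly 0))"
    unfolding mult.assoc using cls_G_power_GF[of lam 0] by (intro cls_mult) simp_all
  also have "\<dots> = cls lam (in_free (?Y * GF_poly 0))"
    by (rule cls_in_free_mult[symmetric])
  finally show ?case by blast
qed

lemma fpoly_orthogonal:
  assumes lam: "lam \<noteq> -1/2" and l: "tracial lam \<theta>"
    and Q: "Q \<in> CHtau" "\<And>n. n \<ge> k \<Longrightarrow> wcoeff Q n = 0"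
  shows "\<theta> (in_free (fpoly lam k j) * gG ^ j * (gF ^ j * in_free Q)) = 0"
    and "\<theta> (in_free Q * gG ^ j * (gF ^ j * in_free (fpoly lam k j))) = 0"
proof -
  let ?f = "fpoly lam k j"
  show 1: "\<theta> (in_free ?f * gG ^ j * (gF ^ j * in_free Q)) = 0"
    by (rule trans[OF tracial_cong[OF l cls_mult_right[OF cls_fpoly[OF lam]]]
          ad_F_element_orthogonal[OF l Q]])
  obtain Y where Y: "cls lam (gG ^ j * gF ^ j) = cls lam (in_free Y)" using cls_G_F_power_in_free by blast
  have c: "cls lam (in_free A * gG ^ j * (gF ^ j * in_free B)) = cls lam (in_free (A * Y * B))" for A B
  proof -
    have "cls lam (in_free A * gG ^ j * (gF ^ j * in_free B)) = cls lam (in_free A * (gG ^ j * gF ^ j) * in_free B)"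
      by (simp add: mult.assoc)
    also have "\<dots> = cls lam (in_free A * in_free Y * in_free B)"
      by (intro cls_mult Y refl)
    also have "\<dots> = cls lam (in_free (A * Y) * in_free B)"
      by (intro cls_mult cls_in_free_mult[symmetric] refl)
    also have "\<dots> = cls lam (in_free (A * Y * B))"
      by (rule cls_in_free_mult[symmetric])
    finally show ?thesis .
  qed
  have "cls lam (in_free Q * gG ^ j * (gF ^ j * in_free ?f)) = cls lam (in_free ?f * gG ^ j * (gF ^ j * in_free Q))"
    unfolding c by (simp add: mult_ac)
  then show "\<theta> (in_free Q * gG ^ j * (gF ^ j * in_free ?f)) = 0"
    by (rule trans[OF tracial_cong[OF l] 1])
qed

lemma form_pos_eq:
  assumes "supertrace lam L"
  shows "\<exists>e. \<forall>P Q. form_pos lam L j P Q = e * L (cls lam (in_free P * gG ^ j * (gF ^ j * in_free Q)))"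
proof -
  obtain e where e: "stransp (gG ^ j) = smul e (gF ^ j)" using stransp_powers(1) by blast
  have l: "L (cls lam (smul c u)) = c * L (cls lam u)" for c u
    using assms by (simp add: supertrace_def)
  have "form_pos lam L j P Q = e * L (cls lam (in_free P * gG ^ j * (gF ^ j * in_free Q)))" for P Q
  proof -
    have "cls lam (in_free P * gG ^ j * stransp (in_free Q * gG ^ j)) =
        cls lam (smul e (in_free P * gG ^ j * (gF ^ j * stransp (in_free Q))))"
      by (simp add: stransp_mult_even e)
    also have "\<dots> = cls lam (smul e (in_free P * gG ^ j * (gF ^ j * in_free Q)))"
      by (intro cls_smul cls_mult stransp_in_free refl)
    finally show ?thesis by (simp add: form_pos_def form_def l)
  qed
  then show ?thesis by blast
qed

lemma form_neg_eq:
  assumes "supertrace lam L"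
  shows "\<exists>e. \<forall>P Q. form_neg lam L j (reflect_H P) (reflect_H Q) =
    e * L (cls lam (refl_aut (in_free P * gG ^ j * (gF ^ j * in_free Q))))"
proof -
  obtain e where e: "stransp (gF ^ j) = smul e (gG ^ j)" using stransp_powers(2) by blast
  have l: "L (cls lam (smul c u)) = c * L (cls lam u)" for c u
    using assms by (simp add: supertrace_def)
  have pw: "(- gF) ^ j = smul ((-1) ^ j) (gF ^ j)"
    using parity_F_power[of j] by simp
  have ss: "(-1) ^ j * ((-1) ^ j * x) = (x :: complex)" for x
    by (simp flip: mult.assoc power_add)
  have "form_neg lam L j (reflect_H P) (reflect_H Q) =
    (-1) ^ j * e * L (cls lam (refl_aut (in_free P * gG ^ j * (gF ^ j * in_free Q))))" for P Q
  proof -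
    let ?X = "in_free (reflect_H P) * gF ^ j * (gG ^ j * in_free (reflect_H Q))"
    have "cls lam (in_free (reflect_H P) * gF ^ j * stransp (in_free (reflect_H Q) * gF ^ j)) =
        cls lam (smul e (in_free (reflect_H P) * gF ^ j * (gG ^ j * stransp (in_free (reflect_H Q)))))"
      by (simp add: stransp_mult_even e)
    also have "\<dots> = cls lam (smul e ?X)"
      by (intro cls_smul cls_mult stransp_in_free refl)
    finally have 1: "form_neg lam L j (reflect_H P) (reflect_H Q) = e * L (cls lam ?X)"
      by (simp add: form_neg_def form_def l)
    have "cls lam (refl_aut (in_free P * gG ^ j * (gF ^ j * in_free Q))) =
        cls lam (refl_aut (in_free P) * (- gF) ^ j * (gG ^ j * refl_aut (in_free Q)))"
      by simp
    also have "\<dots> = cls lam (in_free (reflect_H P) * (- gF) ^ j * (gG ^ j * in_free (reflect_H Q)))"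
      by (intro cls_mult cls_refl_aut_in_free refl)
    also have "\<dots> = cls lam (smul ((-1) ^ j) ?X)"
      unfolding pw by simp
    finally have "L (cls lam (refl_aut (in_free P * gG ^ j * (gF ^ j * in_free Q)))) = (-1) ^ j * L (cls lam ?X)"
      by (simp only: l)
    then show ?thesis unfolding 1 by (simp add: ss mult.left_commute)
  qed
  then show ?thesis by blast
qed

lemma orthogonal_polynomials_pos:
  assumes lam: "lam \<noteq> -1/2" and L: "supertrace lam L"
  shows "orthogonal_polynomials (form_pos lam L j) (\<lambda>k. fpoly lam k j)"
proof -
  obtain e where e: "\<And>P Q. form_pos lam L j P Q = e * L (cls lam (in_free P * gG ^ j * (gF ^ j * in_free Q)))"
    using form_pos_eq[OF L] by blast
  have "form_pos lam L j (fpoly lam k j) P = 0 \<and> form_pos lam L j P (fpoly lam k j) = 0"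
    if "P \<in> CHtau" "wdeg P < k" for k P
    unfolding e
    using fpoly_orthogonal[OF lam tracial_supertrace[OF L] that(1), of k j] wdeg_less_wcoeff[OF that] by simp
  then show ?thesis
    unfolding orthogonal_polynomials_def
    by (intro conjI allI basis_CHtauI ballI impI wdeg_eqI fpoly_CHtau fpoly_coeffs lam) auto
qed

lemma orthogonal_polynomials_neg:
  assumes lam: "lam \<noteq> -1/2" and L: "supertrace lam L"
  shows "orthogonal_polynomials (form_neg lam L j) (\<lambda>k. reflect_H (fpoly lam k j))"
proof -
  obtain e where e: "\<And>P Q. form_neg lam L j (reflect_H P) (reflect_H Q) =
      e * L (cls lam (refl_aut (in_free P * gG ^ j * (gF ^ j * in_free Q))))"
    using form_neg_eq[OF L] by blast
  have orth: "form_neg lam L j (reflect_H (fpoly lam k j)) P = 0 \<and> form_neg lam L j P (reflect_H (fpoly lam k j)) = 0"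
    if P: "P \<in> CHtau" "wdeg P < k" for k P
  proof -
    define Q where "Q = reflect_H P"
    have PQ: "P = reflect_H Q" by (simp add: Q_def reflect_H_reflect_H)
    have "wcoeff Q n = 0" if "n \<ge> k" for n
      using wdeg_less_wcoeff[OF P that] by (simp add: Q_def wcoeff_reflect_H P)
    then show ?thesis
      unfolding PQ e
      using fpoly_orthogonal[OF lam tracial_refl_aut[OF tracial_supertrace[OF L]], of Q k j]
        reflect_H_CHtau[OF P(1)] by (simp add: Q_def)
  qed
  have r: "reflect_H (fpoly lam k j) \<in> CHtau" "wcoeff (reflect_H (fpoly lam k j)) k \<noteq> 0"
    "n > k \<Longrightarrow> wcoeff (reflect_H (fpoly lam k j)) n = 0" for k n
    by (simp_all add: wcoeff_reflect_H fpoly_CHtau[OF lam] fpoly_coeffs[OF lam] reflect_H_CHtau)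
  show ?thesis
    unfolding orthogonal_polynomials_def
    by (intro conjI allI basis_CHtauI ballI impI wdeg_eqI r) (use orth in auto)
qed

text \<open>The transpose of an element of weight \<open>j\<close> has weight \<open>-j\<close>, and an element of non-zero weight \<open>d\<close> is
  \<open>d\<^sup>-\<^sup>1\<close> times its supercommutator with \<open>H\<close>.\<close>

lemma graded_parts_orthogonal:
  assumes L: "supertrace lam L" and ij: "i \<noteq> j"
    and u: "u \<in> graded_part lam i" and v: "v \<in> graded_part lam j"
  shows "form lam L u v = 0"
proof -
  define w where "w = stransp v"
  have "cls lam (stransp (scomm gH v)) = cls lam (stransp (smul (of_int j) v))"
    using v by (intro cls_stransp) (simp add: graded_part_def)
  moreover have "stransp (scomm gH v) = - scomm gH w"
    by (simp add: scomm_gH stransp_mult_even stransp_mult_gens w_def)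
  ultimately have "cls lam (- scomm gH w) = cls lam (smul (of_int j) w)" by (simp add: w_def)
  from cls_uminus[OF this] have w: "cls lam (scomm gH w) = cls lam (smul (- of_int j) w)"
    by (simp add: smul_minus_left)
  have "scomm gH (u * w) = scomm gH u * w + u * scomm gH w"
    by (simp add: scomm_gH algebra_simps)
  also have "cls lam \<dots> = cls lam (smul (of_int i) u * w + u * smul (- of_int j) w)"
    using u w by (intro cls_add cls_mult) (simp_all add: graded_part_def)
  also have "smul (of_int i) u * w + u * smul (- of_int j) w = smul (of_int i - of_int j) (u * w)"
    by (simp add: smul_diff_left smul_minus_left)
  finally have "(of_int i - of_int j) * L (cls lam (u * w)) = L (cls lam (scomm gH (u * w)))"
    using L by (simp add: supertrace_def)
  then show ?thesis using L ij by (simp add: supertrace_def form_def w_def)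
qed

theorem theorem2p2:
  fixes lam :: complex and L :: "free set \<Rightarrow> complex"
  assumes "lam \<notin> \<nat>" and "lam \<noteq> -1/2"
    and "supertrace lam L"
  shows
    "(\<forall>i j :: int. i \<noteq> j \<longrightarrow>
        (\<forall>u \<in> graded_part lam i. \<forall>v \<in> graded_part lam j. form lam L u v = 0))
     \<and>
     (\<forall>j. orthogonal_polynomials (form_pos lam L j) (\<lambda>k. fpoly lam k j))
     \<and>
     (\<forall>i k :: nat. let f = fpoly lam k (2 * i) in
        ev lam ((vH - vtau + cst (1/2)) * fwd (bwd f)
               + cst 2 * (vH - cst (of_nat i)) * bwd f
               + cst (2 * of_nat i + 1/2) * f)
        = ev lam (cst ((-1) ^ k * (2 * of_nat i + of_nat k + 1/2)) * f))
     \<and>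
     (\<forall>i k :: nat. let f = fpoly lam k (2 * i + 1) in
        ev lam ((vH - vtau + cst (1/2)) * fwd (bwd f)
               + cst 2 * (vH - vtau - cst (of_nat i) - cst (1/2)) * bwd f
               + cst (2 * of_nat i + 5/2) * f)
        = ev lam (cst (if even k then 2 * of_nat i + of_nat k + 5/2
                                else - (2 * of_nat i + of_nat k + 1/2)) * f))
     \<and>
     (\<forall>j. orthogonal_polynomials (form_neg lam L j) (\<lambda>k. reflect_H (fpoly lam k j)))
     \<and>
     (\<forall>i k :: nat. let f = fpoly lam k (2 * i); g = reflect_H f;
          e = (if even k then (2 * of_nat i + of_nat k) * (2 * of_nat i + of_nat k + 2)
               else (2 * of_nat i + of_nat k - 1) * (2 * of_nat i + of_nat k + 1)) in
        ev lam (((vH + cst 1) ^ 2 - (vtau + cst (1/2)) ^ 2) * fwd2 (bwd2 f)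
               + cst (4 * (of_nat i + 1)) * (vH - cst (of_nat i)) * bwd2 f
               + cst (4 * of_nat i * (of_nat i + 1)) * f)
        = ev lam (cst e * f)
        \<and>
        ev lam (((vH - cst 1) ^ 2 - (vtau + cst (1/2)) ^ 2) * fwd2 (bwd2 g)
               + cst (4 * (of_nat i + 1)) * (vH + cst (of_nat i)) * fwd2 g
               + cst (4 * of_nat i * (of_nat i + 1)) * g)
        = ev lam (cst e * g))
     \<and>
     (\<forall>i k :: nat. let f = fpoly lam k (2 * i + 1); g = reflect_H f;
          e = (if even k then (2 * of_nat i + of_nat k + 1) * (2 * of_nat i + of_nat k + 3)
               else (2 * of_nat i + of_nat k) * (2 * of_nat i + of_nat k + 2)) in
        ev lam (((vH + cst 1) ^ 2 - (vtau + cst (1/2)) ^ 2) * fwd2 (bwd2 f)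
               + (cst (2 * of_nat i + 3) * (cst 2 * vH - cst (2 * of_nat i) - cst 1)
                    - cst 2 * vtau) * bwd2 f
               + cst ((2 * of_nat i + 1) * (2 * of_nat i + 3)) * f)
        = ev lam (cst e * f)
        \<and>
        ev lam (((vH - cst 1) ^ 2 - (vtau + cst (1/2)) ^ 2) * fwd2 (bwd2 g)
               + (cst (2 * of_nat i + 3) * (cst 2 * vH + cst (2 * of_nat i) + cst 1)
                    + cst 2 * vtau) * fwd2 g
               + cst ((2 * of_nat i + 1) * (2 * of_nat i + 3)) * g)
        = ev lam (cst e * g))
     \<and>
     (\<forall>i k :: nat.
        equals_ratfun lam (fpoly lam (2 * k) (2 * i))
          (pochhammer (rc (of_nat i + 1)) k
             * pochhammer (rc (of_nat i + 1/2) - ratf vtau) k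
             * hyp3F2 (- rc (of_nat k)) (rc (of_nat k + 2 * of_nat i + 1))
                 (rc (1/2) * (rc (2 * of_nat i + 1/2) - ratf vtau - ratf vH))
                 (rc (of_nat i + 1)) (rc (of_nat i + 1/2) - ratf vtau) 1)
        \<and>
        ev lam (fpoly lam (2 * k + 1) (2 * i))
        = ev lam (cst (1/2) * (cst (2 * of_nat k + 2 * of_nat i + 1) * vtau
                              - cst (2 * (lam + 1/2) ^ 2)) * fpoly lam (2 * k) (2 * i)))
     \<and>
     (\<forall>i k :: nat.
        equals_ratfun lam (fpoly lam (2 * k) (2 * i + 1))
          (rc (of_nat i + of_nat k + 1) * pochhammer (rc (of_nat i + 2)) k
             * pochhammer (rc (of_nat i + 3/2) - ratf vtau) k
             * hyp3F2 (- rc (of_nat k)) (rc (of_nat k + 2 * of_nat i + 2))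
                 (rc (1/2) * (rc (2 * of_nat i + 5/2) - ratf vtau - ratf vH))
                 (rc (of_nat i + 2)) (rc (of_nat i + 3/2) - ratf vtau) 1)
        \<and>
        ev lam (fpoly lam (2 * k + 1) (2 * i + 1))
        = ev lam (- cst (1 / (of_nat i + of_nat k + 1)) * vtau * fpoly lam (2 * k) (2 * i + 1)))"
proof (intro conjI allI impI ballI; (unfold Let_def)?; (intro conjI)?)
  note lam = assms(2)
  show "form lam L u v = 0" if "i \<noteq> j" "u \<in> graded_part lam i" "v \<in> graded_part lam j" for i j u v
    using graded_parts_orthogonal[OF assms(3) that] .
  show "orthogonal_polynomials (form_pos lam L j) (\<lambda>k. fpoly lam k j)" for j
    by (rule orthogonal_polynomials_pos[OF lam assms(3)])
  show "orthogonal_polynomials (form_neg lam L j) (\<lambda>k. reflect_H (fpoly lam k j))" for j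
    by (rule orthogonal_polynomials_neg[OF lam assms(3)])
qed (rule fpoly_even_first_order fpoly_odd_first_order fpoly_even_second_order fpoly_odd_second_order
    fpoly_even_hypergeometric fpoly_odd_hypergeometric fpoly_even_odd_degree fpoly_odd_odd_degree,
    rule assms(2))+

end
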